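(* Let $S\in M_{op}^*$. There exist constants $C_S^1>0$ and $C_S^2>0$ such that for all $R>1$ $$C_S^1R^{2d-1}\le\|\rho^S_{B(0,R)}-\chi_{B(0,R)}\|_{L^1(\mathbb{R}^{2d})}\le C_S^2R^{2d-1}.$$
   Context: Fix $d\ge 1$. For $z=(x,\omega)\in\mathbb{R}^{2d}$ let $\pi(z)\psi(t)=e^{2\pi i\omega\cdot t}\psi(t-x)$ on $L^2(\mathbb{R}^d)$. For a bounded operator $A$ on $L^2(\mathbb{R}^d)$ let $\alpha_z(A)=\pi(z)A\pi(z)^*$ and $\check A=PAP$, where $P\psi(x)=\psi(-x)$. For $f\in L^1(\mathbb{R}^{2d})$ and a trace class operator $S$, $f\star S=\int_{\mathbb{R}^{2d}}f(z)\alpha_z(S)\,dz$ (weakly defined; a trace class operator). For trace class operators $S,T$, $S\star T$ is the function $S\star T(z)=\mathrm{tr}(S\,\alpha_z(\check T))$ on $\mathbb{R}^{2d}$. The rank-one operator $\psi\otimes\varphi$ is $\xi\mapsto\langle\xi,\varphi\rangle\psi$. A density operator is a positive trace class operator $S$ with $\mathrm{tr}(S)=1$. Write $\tilde S=S\star\check S$ and, for $\psi\in L^2(\mathbb{R}^d)$, $Q_S(\psi)=\check S\star(\psi\otimes\psi)$. $M_{op}^*$ is the set of density operators $S$ on $L^2(\mathbb{R}^d)$ with $\|S\|_{M_{op}^*}^2:=\int_{\mathbb{R}^{2d}}\tilde S(z)|z|\,dz<\infty$, where $|z|$ is the Euclidean norm. $B(z,R)=\{z'\in\mathbb{R}^{2d}:|z'-z|<R\}$.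 For a bounded measurable set $\Omega\subset\mathbb{R}^{2d}$ (here $\Omega=B(0,R)$), with Lebesgue measure $|\Omega|$ and characteristic function $\chi_\Omega$, the operator $\chi_\Omega\star S$ is positive and trace class; $\lambda_1^\Omega\ge\lambda_2^\Omega\ge\cdots$ are its eigenvalues (with multiplicity, in decreasing order) and $\{h_k^\Omega\}_{k\in\mathbb{N}}$ is an orthonormal system of corresponding eigenfunctions, so that $\chi_\Omega\star S=\sum_{k\ge1}\lambda_k^\Omega h_k^\Omega\otimes h_k^\Omega$ (any fixed choice). With $A_\Omega=\lceil|\Omega|\rceil$, $\rho_\Omega^S(z)=\sum_{k=1}^{A_\Omega}Q_S(h_k^\Omega)(z)$. *)

theory Defs
  imports "HOL-Analysis.Analysis"
begin

section \<open>The complex Hilbert space of square integrable functions\<close>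

definition square_integrable :: "('a::euclidean_space \<Rightarrow> complex) \<Rightarrow> bool" where
  "square_integrable f \<longleftrightarrow>
     f \<in> borel_measurable lborel \<and> integrable lborel (\<lambda>x. (cmod (f x))\<^sup>2)"

definition L2_rel :: "('a::euclidean_space \<Rightarrow> complex) \<Rightarrow> ('a \<Rightarrow> complex) \<Rightarrow> bool" where
  "L2_rel f g \<longleftrightarrow> square_integrable f \<and> square_integrable g \<and> (AE x in lborel. f x = g x)"

lemma square_integrable_measurable [measurable_dest]:
  "square_integrable f \<Longrightarrow> f \<in> borel_measurable borel"
  by (simp add: square_integrable_def)

lemma square_integrable_zero [simp]: "square_integrable (\<lambda>_. 0)"
  by (simp add: square_integrable_def)

lemma square_integrable_scale:
  assumes "square_integrable f" shows "square_integrable (\<lambda>x. c * f x)"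
  using assms by (auto simp: square_integrable_def norm_mult power_mult_distrib)

lemma square_integrable_add:
  assumes f: "square_integrable f" and g: "square_integrable g"
  shows "square_integrable (\<lambda>x. f x + g x)"
proof -
  note [measurable] = square_integrable_measurable[OF f] square_integrable_measurable[OF g]
  have i: "integrable lborel (\<lambda>x. 2 * (cmod (f x))\<^sup>2 + 2 * (cmod (g x))\<^sup>2)"
    using f g by (simp add: square_integrable_def)
  have "(cmod (f x + g x))\<^sup>2 \<le> 2 * (cmod (f x))\<^sup>2 + 2 * (cmod (g x))\<^sup>2" for x
  proof -
    have "(cmod (f x + g x))\<^sup>2 \<le> (cmod (f x) + cmod (g x))\<^sup>2"
      by (intro power_mono norm_triangle_ineq) simp
    also have "\<dots> \<le> 2 * (cmod (f x))\<^sup>2 + 2 * (cmod (g x))\<^sup>2"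
      using sum_squares_bound[of "cmod (f x)" "cmod (g x)"] by (simp add: power2_sum)
    finally show ?thesis .
  qed
  then have "integrable lborel (\<lambda>x. (cmod (f x + g x))\<^sup>2)"
    by (intro Bochner_Integration.integrable_bound[OF i]) auto
  then show ?thesis by (simp add: square_integrable_def)
qed

lemma integrable_square_integrable_mult:
  assumes f: "square_integrable f" and g: "square_integrable g"
  shows "integrable lborel (\<lambda>x. f x * cnj (g x))"
proof -
  note [measurable] = square_integrable_measurable[OF f] square_integrable_measurable[OF g]
  have cnj_meas [measurable]: "cnj \<in> borel_measurable borel"
    by (intro borel_measurable_continuous_onI continuous_intros)
  have i: "integrable lborel (\<lambda>x. (cmod (f x))\<^sup>2 + (cmod (g x))\<^sup>2)"
    using f g by (simp add: square_integrable_def)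
  have "cmod (f x * cnj (g x)) \<le> (cmod (f x))\<^sup>2 + (cmod (g x))\<^sup>2" for x
  proof -
    have "2 * (cmod (f x) * cmod (g x)) \<le> (cmod (f x))\<^sup>2 + (cmod (g x))\<^sup>2"
      using sum_squares_bound[of "cmod (f x)" "cmod (g x)"] by (simp add: mult.assoc)
    moreover have "0 \<le> cmod (f x) * cmod (g x)" by simp
    ultimately show ?thesis unfolding norm_mult complex_mod_cnj by linarith
  qed
  then show ?thesis
    by (intro Bochner_Integration.integrable_bound[OF i]) auto
qed

lemma AE_lborel_reparam:
  fixes T :: "'a::euclidean_space \<Rightarrow> 'a" and f g :: "'a \<Rightarrow> complex"
  assumes T: "T \<in> borel_measurable borel" and d: "distr lborel borel T = lborel"
    and [measurable]: "f \<in> borel_measurable borel" "g \<in> borel_measurable borel"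
    and ae: "AE x in lborel. f x = g x"
  shows "AE x in lborel. f (T x) = g (T x)"
proof -
  have "AE x in distr lborel borel T. f x = g x" unfolding d by (rule ae)
  then show ?thesis by (subst (asm) AE_distr_iff) (use T in auto)
qed

lemma square_integrable_reparam:
  fixes T :: "'a::euclidean_space \<Rightarrow> 'a" and f :: "'a \<Rightarrow> complex"
  assumes T: "T \<in> borel_measurable borel" and d: "distr lborel borel T = lborel"
    and f: "square_integrable f"
  shows "square_integrable (\<lambda>x. f (T x))"
proof -
  note [measurable] = T square_integrable_measurable[OF f]
  have "integrable (distr lborel borel T) (\<lambda>x. (cmod (f x))\<^sup>2)"
    using f d by (simp add: square_integrable_def)
  then have "integrable lborel (\<lambda>x. (cmod (f (T x)))\<^sup>2)"
    by (subst (asm) integrable_distr_eq) auto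
  then show ?thesis by (simp add: square_integrable_def)
qed

lemma distr_lborel_shift: "distr lborel borel (\<lambda>t. t - x) = (lborel :: 'a::euclidean_space measure)"
proof -
  have "(\<lambda>t. t - x) = (+) (- x)" by auto
  then show ?thesis using lborel_distr_plus[of "- x"] by metis
qed

lemma distr_lborel_uminus: "distr lborel borel uminus = (lborel :: 'a::euclidean_space measure)"
proof -
  have "(\<lambda>x::'a. 0 + (- 1) *\<^sub>R x) = uminus" by auto
  then show ?thesis using lborel_affine[of "- 1" "0 :: 'a"]
    by (simp add: density_1)
qed

lemma L2_rel_shift:
  assumes "L2_rel f g"
  shows "L2_rel (\<lambda>t. cis (2 * pi * (w \<bullet> t)) * f (t - x)) (\<lambda>t. cis (2 * pi * (w \<bullet> t)) * g (t - x))"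
proof -
  have [measurable]: "(\<lambda>t. cis (2 * pi * (w \<bullet> t))) \<in> borel_measurable borel"
    by (intro borel_measurable_continuous_onI continuous_intros)
  have sq: "square_integrable (\<lambda>t. cis (2 * pi * (w \<bullet> t)) * h (t - x))"
    if "square_integrable h" for h
  proof -
    have "square_integrable (\<lambda>t. h (t - x))"
      by (rule square_integrable_reparam[OF _ distr_lborel_shift that]) simp
    then show ?thesis by (auto simp: square_integrable_def norm_mult)
  qed
  have "AE t in lborel. f (t - x) = g (t - x)"
    using assms by (intro AE_lborel_reparam[where T = "\<lambda>t. t - x", OF _ distr_lborel_shift])
      (auto simp: L2_rel_def square_integrable_def)
  with assms sq show ?thesis by (auto simp: L2_rel_def)
qed

lemma L2_rel_parity:
  assumes "L2_rel f g"
  shows "L2_rel (\<lambda>t. f (- t)) (\<lambda>t. g (- t))"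
proof -
  have "AE t in lborel. f (- t) = g (- t)"
    using assms by (intro AE_lborel_reparam[where T = uminus, OF _ distr_lborel_uminus])
      (auto simp: L2_rel_def square_integrable_def)
  moreover have "square_integrable (\<lambda>t. h (- t))" if "square_integrable h"
    for h :: "'a \<Rightarrow> complex"
    by (rule square_integrable_reparam[OF _ distr_lborel_uminus that]) simp
  ultimately show ?thesis using assms by (auto simp: L2_rel_def)
qed

quotient_type (overloaded) 'a L2 = "'a::euclidean_space \<Rightarrow> complex" / partial: L2_rel
proof (rule part_equivpI)
  show "\<exists>f. L2_rel f f" by (rule exI[of _ "\<lambda>_. 0"]) (simp add: L2_rel_def)
  show "symp L2_rel" by (auto simp: symp_def L2_rel_def)
  show "transp L2_rel" by (auto simp: transp_def L2_rel_def)
qed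

text \<open>The inner product is linear in its first and conjugate linear in its second argument.\<close>

lift_definition cinner :: "'a::euclidean_space L2 \<Rightarrow> 'a L2 \<Rightarrow> complex"
  is "\<lambda>f g. LINT x|lborel. f x * cnj (g x)"
proof -
  fix f f' g g' :: "'a \<Rightarrow> complex"
  assume "L2_rel f f'" "L2_rel g g'"
  then have m: "square_integrable f" "square_integrable f'" "square_integrable g"
      "square_integrable g'"
    and ae: "AE x in lborel. f x = f' x" "AE x in lborel. g x = g' x"
    by (auto simp: L2_rel_def)
  show "(LINT x|lborel. f x * cnj (g x)) = (LINT x|lborel. f' x * cnj (g' x))"
    using ae by (intro integral_cong_AE borel_measurable_integrable
        integrable_square_integrable_mult m) auto
qed

lift_definition scaleC :: "complex \<Rightarrow> 'a::euclidean_space L2 \<Rightarrow> 'a L2" (infixr \<open>*\<^sub>C\<close> 75)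
  is "\<lambda>c f x. c * f x"
  by (auto simp: L2_rel_def intro: square_integrable_scale)

instantiation L2 :: (euclidean_space) real_vector
begin

lift_definition zero_L2 :: "'a L2" is "\<lambda>_. 0" by (simp add: L2_rel_def)
lift_definition plus_L2 :: "'a L2 \<Rightarrow> 'a L2 \<Rightarrow> 'a L2" is "\<lambda>f g x. f x + g x"
  by (auto simp: L2_rel_def intro: square_integrable_add)
definition uminus_L2 :: "'a L2 \<Rightarrow> 'a L2" where "- \<psi> = (- 1) *\<^sub>C \<psi>"
definition minus_L2 :: "'a L2 \<Rightarrow> 'a L2 \<Rightarrow> 'a L2" where "\<psi> - \<phi> = \<psi> + - (\<phi> :: 'a L2)"
definition scaleR_L2 :: "real \<Rightarrow> 'a L2 \<Rightarrow> 'a L2" where "r *\<^sub>R \<psi> = of_real r *\<^sub>C \<psi>"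

instance
proof
  fix a b c :: "'a L2" and r s :: real
  show "a + b + c = a + (b + c)"
    by transfer (auto simp: L2_rel_def add.assoc intro!: square_integrable_add)
  show "a + b = b + a"
    by transfer (auto simp: L2_rel_def add.commute intro!: square_integrable_add)
  show "0 + a = a"
    by transfer (auto simp: L2_rel_def)
  show "- a + a = 0" unfolding uminus_L2_def
    by transfer (auto simp: L2_rel_def intro!: square_integrable_add)
  show "a - b = a + - b" by (fact minus_L2_def)
  show "r *\<^sub>R (a + b) = r *\<^sub>R a + r *\<^sub>R b" unfolding scaleR_L2_def
    by transfer (auto simp: L2_rel_def ring_distribs
        intro!: square_integrable_add square_integrable_scale)
  show "(r + s) *\<^sub>R a = r *\<^sub>R a + s *\<^sub>R a" unfolding scaleR_L2_def
    by transfer (auto simp: L2_rel_def ring_distribs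
        intro!: square_integrable_add square_integrable_scale)
  show "r *\<^sub>R s *\<^sub>R a = (r * s) *\<^sub>R a" unfolding scaleR_L2_def
    by transfer (auto simp: L2_rel_def mult.assoc intro!: square_integrable_scale)
  show "1 *\<^sub>R a = a" unfolding scaleR_L2_def
    by transfer (auto simp: L2_rel_def)
qed

end

lemma cinner_add_left: "cinner (a + b) c = cinner a c + cinner b c"
proof (transfer, goal_cases)
  case (1 a b c)
  then have i: "square_integrable a" "square_integrable b" "square_integrable c"
    by (auto simp: L2_rel_def)
  show ?case
    unfolding distrib_right
    by (intro Bochner_Integration.integral_add integrable_square_integrable_mult i)
qed

lemma cinner_scaleC_left: "cinner (r *\<^sub>C a) b = r * cinner a b"
  by transfer (simp add: mult.assoc)

lemma cinner_commute: "cinner a b = cnj (cinner b a)"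
proof (transfer, goal_cases)
  case (1 a b)
  have "(LINT x|lborel. a x * cnj (b x)) = (LINT x|lborel. cnj (b x * cnj (a x)))"
    by (simp add: mult.commute)
  then show ?case unfolding Bochner_Integration.integral_cnj .
qed

lemma cinner_self:
  "Im (cinner a a) = 0 \<and> 0 \<le> Re (cinner a a) \<and> (cinner a a = 0 \<longleftrightarrow> a = 0)"
proof (transfer, goal_cases)
  case (1 f)
  then have f: "square_integrable f" by (simp add: L2_rel_def)
  have eq: "(LINT x|lborel. f x * cnj (f x)) = of_real (LINT x|lborel. (cmod (f x))\<^sup>2)"
    unfolding complex_norm_square[symmetric] of_real_power[symmetric]
      integral_complex_of_real by (rule refl)
  have "(LINT x|lborel. (cmod (f x))\<^sup>2) = 0 \<longleftrightarrow> (AE x in lborel. (cmod (f x))\<^sup>2 = 0)"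
    using f by (intro integral_nonneg_eq_0_iff_AE) (simp_all add: square_integrable_def)
  then have "(LINT x|lborel. (cmod (f x))\<^sup>2) = 0 \<longleftrightarrow> L2_rel f (\<lambda>_. 0)"
    using f by (simp add: L2_rel_def)
  moreover have "0 \<le> (LINT x|lborel. (cmod (f x))\<^sup>2)" by simp
  ultimately show ?case unfolding eq of_real_eq_0_iff Im_complex_of_real Re_complex_of_real
    by blast
qed

instantiation L2 :: (euclidean_space) real_inner
begin

definition inner_L2 :: "'a L2 \<Rightarrow> 'a L2 \<Rightarrow> real" where "\<psi> \<bullet> \<phi> = Re (cinner \<psi> \<phi>)"
definition norm_L2 :: "'a L2 \<Rightarrow> real" where "norm \<psi> = sqrt (\<psi> \<bullet> (\<psi> :: 'a L2))"
definition dist_L2 :: "'a L2 \<Rightarrow> 'a L2 \<Rightarrow> real" where "dist \<psi> \<phi> = norm (\<psi> - (\<phi> :: 'a L2))"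
definition sgn_L2 :: "'a L2 \<Rightarrow> 'a L2" where "sgn \<psi> = (\<psi> :: 'a L2) /\<^sub>R norm \<psi>"
definition uniformity_L2 :: "('a L2 \<times> 'a L2) filter" where
  "uniformity_L2 = (INF e\<in>{0<..}. principal {(x :: 'a L2, y). dist x y < e})"
definition open_L2 :: "'a L2 set \<Rightarrow> bool" where
  "open_L2 U \<longleftrightarrow> (\<forall>x\<in>U. eventually (\<lambda>(x', y). x' = x \<longrightarrow> y \<in> U) uniformity)"

instance
proof
  fix a b c :: "'a L2" and r :: real and U :: "'a L2 set"
  show "dist a b = norm (a - b)" by (fact dist_L2_def)
  show "sgn a = a /\<^sub>R norm a" by (fact sgn_L2_def)
  show "uniformity = (INF e\<in>{0<..}. principal {(x :: 'a L2, y). dist x y < e})"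
    by (fact uniformity_L2_def)
  show "open U \<longleftrightarrow> (\<forall>x\<in>U. eventually (\<lambda>(x', y). x' = x \<longrightarrow> y \<in> U) uniformity)"
    by (fact open_L2_def)
  show "a \<bullet> b = b \<bullet> a" unfolding inner_L2_def by (subst cinner_commute) simp
  show "(a + b) \<bullet> c = a \<bullet> c + b \<bullet> c" by (simp add: inner_L2_def cinner_add_left)
  show "(r *\<^sub>R a) \<bullet> b = r * (a \<bullet> b)"
    by (simp add: inner_L2_def scaleR_L2_def cinner_scaleC_left)
  show "0 \<le> a \<bullet> a" using cinner_self[of a] by (simp add: inner_L2_def)
  show "(a \<bullet> a = 0) = (a = 0)" using cinner_self[of a] by (auto simp: inner_L2_def complex_eq_iff)
  show "norm a = sqrt (a \<bullet> a)" by (fact norm_L2_def)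
qed

end

section \<open>Operators\<close>

definition bounded_op :: "('a::euclidean_space L2 \<Rightarrow> 'a L2) \<Rightarrow> bool" where
  "bounded_op A \<longleftrightarrow> bounded_linear A \<and> (\<forall>c \<psi>. A (c *\<^sub>C \<psi>) = c *\<^sub>C A \<psi>)"

definition adj :: "('a::euclidean_space L2 \<Rightarrow> 'a L2) \<Rightarrow> 'a L2 \<Rightarrow> 'a L2" where
  "adj A = (THE B. \<forall>\<psi> \<phi>. cinner (A \<psi>) \<phi> = cinner \<psi> (B \<phi>))"

definition positive_op :: "('a::euclidean_space L2 \<Rightarrow> 'a L2) \<Rightarrow> bool" where
  "positive_op A \<longleftrightarrow> bounded_op A \<and> (\<forall>\<psi>. cinner (A \<psi>) \<psi> \<in> \<real>\<^sub>\<ge>\<^sub>0)"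

definition abs_op :: "('a::euclidean_space L2 \<Rightarrow> 'a L2) \<Rightarrow> 'a L2 \<Rightarrow> 'a L2" where
  "abs_op A = (THE B. positive_op B \<and> B \<circ> B = adj A \<circ> A)"

definition orthonormal :: "(nat \<Rightarrow> 'a::euclidean_space L2) \<Rightarrow> bool" where
  "orthonormal e \<longleftrightarrow> (\<forall>m n. cinner (e m) (e n) = (if m = n then 1 else 0))"

definition orthonormal_basis :: "(nat \<Rightarrow> 'a::euclidean_space L2) \<Rightarrow> bool" where
  "orthonormal_basis e \<longleftrightarrow> orthonormal e \<and> (\<forall>\<psi>. (\<forall>n. cinner \<psi> (e n) = 0) \<longrightarrow> \<psi> = 0)"

text \<open>Trace and trace class do not depend on the basis; one is fixed once and for all.\<close>

definition some_basis :: "nat \<Rightarrow> 'a::euclidean_space L2" where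
  "some_basis = (SOME e. orthonormal_basis e)"

definition trace_class :: "('a::euclidean_space L2 \<Rightarrow> 'a L2) \<Rightarrow> bool" where
  "trace_class A \<longleftrightarrow> bounded_op A \<and>
     (\<lambda>n. cinner (abs_op A (some_basis n)) (some_basis n)) summable_on UNIV"

definition tr :: "('a::euclidean_space L2 \<Rightarrow> 'a L2) \<Rightarrow> complex" where
  "tr A = (\<Sum>\<^sub>\<infinity>n. cinner (A (some_basis n)) (some_basis n))"

definition rank_one :: "'a::euclidean_space L2 \<Rightarrow> 'a L2 \<Rightarrow> 'a L2 \<Rightarrow> 'a L2" where
  "rank_one \<psi> \<phi> = (\<lambda>\<xi>. cinner \<xi> \<phi> *\<^sub>C \<psi>)"

section \<open>Quantum harmonic analysis on phase space\<close>

text \<open>Phase space is \<^typ>\<open>'a \<times> 'a\<close>, whose library norm is the Euclidean one.\<close>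

lift_definition tf_shift :: "'a::euclidean_space \<times> 'a \<Rightarrow> 'a L2 \<Rightarrow> 'a L2"
  is "\<lambda>(x, w) f t. cis (2 * pi * (w \<bullet> t)) * f (t - x)"
  by (auto intro: L2_rel_shift)

lift_definition parity :: "'a::euclidean_space L2 \<Rightarrow> 'a L2"
  is "\<lambda>f t. f (- t)"
  by (rule L2_rel_parity)

definition op_shift ::
  "'a::euclidean_space \<times> 'a \<Rightarrow> ('a L2 \<Rightarrow> 'a L2) \<Rightarrow> 'a L2 \<Rightarrow> 'a L2" where
  "op_shift z A = tf_shift z \<circ> A \<circ> adj (tf_shift z)"

definition op_check :: "('a::euclidean_space L2 \<Rightarrow> 'a L2) \<Rightarrow> 'a L2 \<Rightarrow> 'a L2" where
  "op_check A = parity \<circ> A \<circ> parity"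

text \<open>The operator \<open>f \<star> S\<close> is the weak integral of \<open>f(z) \<alpha>\<^sub>z(S)\<close>.\<close>

definition conv_fun_op ::
  "('a::euclidean_space \<times> 'a \<Rightarrow> complex) \<Rightarrow> ('a L2 \<Rightarrow> 'a L2) \<Rightarrow> 'a L2 \<Rightarrow> 'a L2" where
  "conv_fun_op f S = (THE A. \<forall>\<psi> \<phi>.
     cinner (A \<psi>) \<phi> = (LINT z|lborel. f z * cinner (op_shift z S \<psi>) \<phi>))"

definition conv_op_op ::
  "('a::euclidean_space L2 \<Rightarrow> 'a L2) \<Rightarrow> ('a L2 \<Rightarrow> 'a L2) \<Rightarrow> 'a \<times> 'a \<Rightarrow> complex" where
  "conv_op_op S T = (\<lambda>z. tr (S \<circ> op_shift z (op_check T)))"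

definition density_op :: "('a::euclidean_space L2 \<Rightarrow> 'a L2) \<Rightarrow> bool" where
  "density_op S \<longleftrightarrow> positive_op S \<and> trace_class S \<and> tr S = 1"

definition autoconv :: "('a::euclidean_space L2 \<Rightarrow> 'a L2) \<Rightarrow> 'a \<times> 'a \<Rightarrow> complex" where
  "autoconv S = conv_op_op S (op_check S)"

definition cohen :: "('a::euclidean_space L2 \<Rightarrow> 'a L2) \<Rightarrow> 'a L2 \<Rightarrow> 'a \<times> 'a \<Rightarrow> complex" where
  "cohen S \<psi> = conv_op_op (op_check S) (rank_one \<psi> \<psi>)"

text \<open>
  The function \<open>autoconv S\<close> is real and nonnegative for a density operator, so finiteness of the
  integral defining the \<open>M\<^sub>o\<^sub>p\<^sup>*\<close> norm is integrability.
\<close>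

definition M_op_star :: "('a::euclidean_space L2 \<Rightarrow> 'a L2) set" where
  "M_op_star = {S. density_op S \<and> integrable lborel (\<lambda>z. autoconv S z * of_real (norm z))}"

text \<open>
  An eigenvalue sequence in decreasing order, with multiplicity, together with an orthonormal
  system of eigenfunctions that diagonalises \<open>A\<close>; the indices start at 0.  The expansion forces
  every nonzero eigenvalue to occur with its full multiplicity.  If \<open>A\<close> has finite rank, the
  sequences continue with eigenvalue 0.
\<close>

definition eigen_system ::
  "('a::euclidean_space L2 \<Rightarrow> 'a L2) \<Rightarrow> (nat \<Rightarrow> real) \<Rightarrow> (nat \<Rightarrow> 'a L2) \<Rightarrow> bool" where
  "eigen_system A lam h \<longleftrightarrow> decseq lam \<and> orthonormal h \<and>
     (\<forall>k. A (h k) = lam k *\<^sub>R h k) \<and>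
     (\<forall>\<psi>. (\<lambda>k. lam k *\<^sub>R rank_one (h k) (h k) \<psi>) sums A \<psi>)"

definition accumulated_cohen ::
  "('a::euclidean_space L2 \<Rightarrow> 'a L2) \<Rightarrow> ('a \<times> 'a) set \<Rightarrow> (nat \<Rightarrow> 'a L2) \<Rightarrow> 'a \<times> 'a \<Rightarrow> complex" where
  "accumulated_cohen S \<Omega> h = (\<lambda>z. \<Sum>k<nat \<lceil>measure lborel \<Omega>\<rceil>. cohen S (h k) z)"

text \<open>Extended-valued, so that a finite upper bound carries integrability with it.\<close>

definition L1_norm :: "('a::euclidean_space \<Rightarrow> complex) \<Rightarrow> ennreal" where
  "L1_norm f = (\<integral>\<^sup>+ z. ennreal (cmod (f z)) \<partial>lborel)"

end

theory Submission
  imports Defs "HOL-Probability.Probability"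
begin

text \<open>
  Write \<open>S = \<Sum>\<^sub>j f\<^sub>j \<otimes> f\<^sub>j\<close> with \<open>\<Sum>\<^sub>j \<parallel>f\<^sub>j\<parallel>\<^sup>2 = 1\<close> and let \<open>G\<close> be the autocorrelation of \<open>S\<close>;
  by Moyal's identity \<open>G\<close> has integral 1.  With \<open>\<Omega>\<close> the ball, \<open>V\<close> its measure, \<open>N = \<lceil>V\<rceil>\<close> and
  \<open>\<lambda>\<^sub>k\<close> the eigenvalues, the accumulated distribution \<open>\<rho>\<close> takes values in \<open>[0,1]\<close>, its total mass is
  \<open>N\<close> and its mass on \<open>\<Omega>\<close> is \<open>\<Sum>\<^sub>k\<^sub><\<^sub>N \<lambda>\<^sub>k\<close>, so the \<open>L\<^sup>1\<close> distance equals
  \<open>\<Sum>\<^sub>k\<^sub><\<^sub>N (1 - \<lambda>\<^sub>k) + \<Sum>\<^sub>k\<^sub>\<ge>\<^sub>N \<lambda>\<^sub>k\<close>.  Since \<open>\<lambda>\<close> decreases, this lies between \<open>E\<close> and \<open>1 + 2 E\<close>, where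
  \<open>E = \<Sum>\<^sub>k \<lambda>\<^sub>k (1 - \<lambda>\<^sub>k) = \<integral> G(w) |\<Omega> \<setminus> (\<Omega> - w)| dw\<close> by the trace formulas for \<open>\<chi>\<^sub>\<Omega> \<star> S\<close> and its
  square.  Finally \<open>|\<Omega> \<setminus> (\<Omega> - w)|\<close> is at most a multiple of \<open>|w| R\<^sup>2\<^sup>d\<^sup>-\<^sup>1\<close>, and at least a multiple of
  \<open>min |w| 1 R\<^sup>2\<^sup>d\<^sup>-\<^sup>1\<close> because it is subadditive in \<open>w\<close> and equals \<open>V\<close> for \<open>|w| \<ge> 2 R\<close>.
\<close>

section \<open>The Hilbert space structure\<close>

text \<open>The spectrum of the localization operator enters only through its first two moments. The
  rank-one vectors of \<open>S\<close> come from a Cholesky factorisation along an orthonormal basis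
  instead of a spectral theorem: eliminating one basis vector after another leaves a positive
  remainder by Cauchy-Schwarz. These vectors need not be orthogonal, which does no harm because only
  sums over \<open>j\<close> of squared moduli of inner products with
  \<open>tf_shift z (f j)\<close> occur. Run on the identity, the same iteration is Gram--Schmidt
  and supplies the basis behind \<open>some_basis\<close>. Sums and integrals are exchanged
  throughout, so quantities stay in \<open>ennreal\<close>, where Tonelli has no side conditions,
  and become real only once the measure of the ball bounds them. The analytic obstacle is Moyal's
  identity: for fixed \<open>x\<close> the product of \<open>f(t)\<close> and the conjugate of
  \<open>g(t - x)\<close> is guaranteed to be integrable only, so Plancherel cannot be applied to it
  directly. A Gaussian cutoff in frequency, removed by monotone convergence, takes its place. The
  additive 1 in the upper bound is the rounding in \<open>N = \<lceil>V\<rceil>\<close>; it is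
  absorbed because \<open>R > 1\<close>.\<close>

lemma abs_L2_cases:
  obtains f where "square_integrable f" "\<psi> = abs_L2 f"
proof (rule that)
  show "square_integrable (rep_L2 \<psi>)"
    using Quotient3_rep_reflp[OF Quotient3_L2, of \<psi>] by (simp add: L2_rel_def)
  show "\<psi> = abs_L2 (rep_L2 \<psi>)"
    by (rule Quotient3_abs_rep[OF Quotient3_L2, symmetric])
qed

lemma L2_rel_refl_iff [simp]: "L2_rel f f \<longleftrightarrow> square_integrable f"
  by (auto simp: L2_rel_def)

lemma cinner_abs_L2:
  "square_integrable f \<Longrightarrow> square_integrable g \<Longrightarrow>
    cinner (abs_L2 f) (abs_L2 g) = (LINT x|lborel. f x * cnj (g x))"
  by (simp add: cinner.abs_eq)

lemma cinner_scaleC_right: "cinner a (r *\<^sub>C b) = cnj r * cinner a b"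
  by (metis cinner_commute cinner_scaleC_left complex_cnj_mult)

lemma cinner_self_norm: "cinner a a = of_real ((norm a)\<^sup>2)"
proof -
  have "(norm a)\<^sup>2 = Re (cinner a a)"
    by (simp add: power2_norm_eq_inner inner_L2_def)
  then show ?thesis using cinner_self[of a] by (auto simp: complex_eq_iff)
qed

lemma norm_abs_L2:
  assumes "square_integrable f"
  shows "(norm (abs_L2 f))\<^sup>2 = (LINT x|lborel. (cmod (f x))\<^sup>2)"
proof -
  have "(norm (abs_L2 f))\<^sup>2 = Re (LINT x|lborel. f x * cnj (f x))"
    by (metis Re_complex_of_real assms cinner_abs_L2 cinner_self_norm)
  also have "\<dots> = (LINT x|lborel. (cmod (f x))\<^sup>2)"
    unfolding complex_norm_square[symmetric] of_real_power[symmetric]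
      integral_complex_of_real by simp
  finally show ?thesis .
qed

lemma norm_scaleC: "norm (c *\<^sub>C a) = cmod c * norm a"
proof -
  have "(of_real ((norm (c *\<^sub>C a))\<^sup>2) :: complex) = c * cnj c * cinner a a"
    by (simp only: cinner_self_norm[symmetric] cinner_scaleC_left cinner_scaleC_right mult.assoc)
      (simp add: mult.left_commute)
  also have "\<dots> = of_real ((cmod c * norm a)\<^sup>2)"
    unfolding cinner_self_norm complex_norm_square[symmetric] by (simp add: power_mult_distrib)
  finally have "(norm (c *\<^sub>C a))\<^sup>2 = (cmod c * norm a)\<^sup>2" using of_real_eq_iff by blast
  then show ?thesis by simp
qed

lemma scaleC_scaleC: "a *\<^sub>C b *\<^sub>C \<psi> = (a * b) *\<^sub>C \<psi>"
  by transfer (auto simp: L2_rel_def mult.assoc intro!: square_integrable_scale)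

lemma scaleC_one [simp]: "1 *\<^sub>C \<psi> = \<psi>"
  by transfer (auto simp: L2_rel_def)

lemma scaleC_add_left: "(a + b) *\<^sub>C \<psi> = a *\<^sub>C \<psi> + b *\<^sub>C \<psi>"
  by transfer (auto simp: L2_rel_def ring_distribs
      intro!: square_integrable_add square_integrable_scale)

lemma scaleC_add_right: "a *\<^sub>C (\<psi> + \<phi>) = a *\<^sub>C \<psi> + a *\<^sub>C \<phi>"
  by transfer (auto simp: L2_rel_def ring_distribs
      intro!: square_integrable_add square_integrable_scale)

lemma bounded_bilinear_scaleC: "bounded_bilinear scaleC"
proof (rule bounded_bilinear.intro)
  show "(a + a') *\<^sub>C \<psi> = a *\<^sub>C \<psi> + a' *\<^sub>C \<psi>" for a a' and \<psi> :: "'a L2"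
    by (rule scaleC_add_left)
  show "a *\<^sub>C (\<psi> + \<phi>) = a *\<^sub>C \<psi> + a *\<^sub>C \<phi>" for a and \<psi> \<phi> :: "'a L2"
    by (rule scaleC_add_right)
  show "(r *\<^sub>R a) *\<^sub>C \<psi> = r *\<^sub>R (a *\<^sub>C \<psi>)" for r a and \<psi> :: "'a L2"
    unfolding scaleR_L2_def scaleC_scaleC scaleR_conv_of_real ..
  show "a *\<^sub>C (r *\<^sub>R \<psi>) = r *\<^sub>R (a *\<^sub>C \<psi>)" for r a and \<psi> :: "'a L2"
    unfolding scaleR_L2_def scaleC_scaleC by (simp only: mult.commute)
  show "\<exists>K. \<forall>a (\<psi>::'a L2). norm (a *\<^sub>C \<psi>) \<le> norm a * norm \<psi> * K"
    by (intro exI[of _ 1]) (simp add: norm_scaleC)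
qed

text \<open>Rotating \<open>a\<close> by a unimodular factor makes the inner product equal to its
  modulus, so the inequality of the underlying real inner product applies.\<close>

lemma cinner_cauchy_schwarz: "cmod (cinner a b) \<le> norm a * norm b"
proof (cases "cinner a b = 0")
  case False
  define c where "c = cnj (sgn (cinner a b))"
  have "cmod c = 1" using False by (simp add: c_def norm_sgn)
  have "cinner (c *\<^sub>C a) b = of_real (cmod (cinner a b))"
  proof -
    have "cnj x / of_real (cmod x) * x = of_real (cmod x)" if "x \<noteq> 0" for x
    proof -
      have "x * cnj x = of_real (cmod x) * of_real (cmod x)"
        using complex_norm_square[of x] by (simp add: power2_eq_square)
      then show ?thesis using that by (simp add: field_simps)
    qed
    from this[OF False] show ?thesis by (simp add: cinner_scaleC_left c_def sgn_eq)
  qed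
  then have "cmod (cinner a b) = (c *\<^sub>C a) \<bullet> b" by (simp add: inner_L2_def)
  also have "\<dots> \<le> norm (c *\<^sub>C a) * norm b" by (rule norm_cauchy_schwarz)
  finally show ?thesis using \<open>cmod c = 1\<close> by (simp add: norm_scaleC)
qed simp

lemma cinner_add_right: "cinner a (b + c) = cinner a b + cinner a c"
  using cinner_add_left[of b c a] cinner_commute[of a "b + c"] cinner_commute[of a b]
    cinner_commute[of a c] by simp

lemma bounded_bilinear_cinner: "bounded_bilinear cinner"
proof (rule bounded_bilinear.intro)
  show "cinner (a + a') b = cinner a b + cinner a' b" for a a' b :: "'a L2"
    by (rule cinner_add_left)
  show "cinner a (b + b') = cinner a b + cinner a b'" for a b b' :: "'a L2"
    by (rule cinner_add_right)
  show "cinner (r *\<^sub>R a) b = r *\<^sub>R cinner a b" for r and a b :: "'a L2"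
    unfolding scaleR_L2_def cinner_scaleC_left by (simp add: scaleR_conv_of_real)
  show "cinner a (r *\<^sub>R b) = r *\<^sub>R cinner a b" for r and a b :: "'a L2"
    unfolding scaleR_L2_def cinner_scaleC_right by (simp add: scaleR_conv_of_real)
  show "\<exists>K. \<forall>(a::'a L2) b. norm (cinner a b) \<le> norm a * norm b * K"
    by (intro exI[of _ 1]) (simp add: cinner_cauchy_schwarz)
qed

interpretation cinner: bounded_bilinear cinner by (rule bounded_bilinear_cinner)
interpretation scaleC: bounded_bilinear scaleC by (rule bounded_bilinear_scaleC)

lemma cinner_ext_left: "(\<And>\<phi>. cinner \<psi> \<phi> = cinner \<psi>' \<phi>) \<Longrightarrow> \<psi> = \<psi>'"
  using cinner_self[of "\<psi> - \<psi>'"] by (simp add: cinner.diff_left)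

lemma cinner_ext_right: "(\<And>\<phi>. cinner \<phi> \<psi> = cinner \<phi> \<psi>') \<Longrightarrow> \<psi> = \<psi>'"
  using cinner_self[of "\<psi> - \<psi>'"] by (simp add: cinner.diff_right)

lemma plus_abs_L2:
  "square_integrable f \<Longrightarrow> square_integrable g \<Longrightarrow> abs_L2 f + abs_L2 g = abs_L2 (\<lambda>x. f x + g x)"
  by (simp add: plus_L2.abs_eq)

lemma scaleC_abs_L2:
  "square_integrable f \<Longrightarrow> c *\<^sub>C abs_L2 f = abs_L2 (\<lambda>x. c * f x)"
  by (simp add: scaleC.abs_eq)

lemma square_integrable_diff:
  "square_integrable f \<Longrightarrow> square_integrable g \<Longrightarrow> square_integrable (\<lambda>x. f x - g x)"
  using square_integrable_add[of f "\<lambda>x. - 1 * g x"] square_integrable_scale[of g "- 1"] by simp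

lemma minus_abs_L2:
  "square_integrable f \<Longrightarrow> square_integrable g \<Longrightarrow> abs_L2 f - abs_L2 g = abs_L2 (\<lambda>x. f x - g x)"
  unfolding minus_L2_def uminus_L2_def
  using plus_abs_L2[of f "\<lambda>x. - 1 * g x"] square_integrable_scale[of g "- 1"]
  by (simp add: scaleC_abs_L2)

section \<open>Completeness of \<open>L2\<close>\<close>

lemma nn_integral_norm_abs_L2:
  assumes "square_integrable f"
  shows "(\<integral>\<^sup>+ x. ennreal ((cmod (f x))\<^sup>2) \<partial>lborel) = ennreal ((norm (abs_L2 f))\<^sup>2)"
  using assms by (subst nn_integral_eq_integral) (auto simp: norm_abs_L2 square_integrable_def)

lemma square_integrable_nnI:
  assumes "f \<in> borel_measurable lborel" "(\<integral>\<^sup>+ x. ennreal ((cmod (f x))\<^sup>2) \<partial>lborel) < \<infinity>"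
  shows "square_integrable f"
  using assms by (auto simp: square_integrable_def integrable_iff_bounded)

lemma ennreal_le_suminf: "t n \<le> (\<Sum>n. t n)" for t :: "nat \<Rightarrow> ennreal"
  using sum_le_suminf[OF summableI, of "{n}" t] by simp

lemma ennreal_finiteE:
  fixes x :: ennreal
  assumes "x \<noteq> \<infinity>"
  obtains C where "x = ennreal C" "C \<ge> 0"
  using assms by (cases x) auto

text \<open>Riesz--Fischer: a subsequence with geometrically small increments converges almost
  everywhere, Fatou shows that the pointwise limit is also its norm limit, and a Cauchy sequence
  with a convergent subsequence converges.\<close>

lemma L2_Cauchy_convergent:
  fixes X :: "nat \<Rightarrow> 'a::euclidean_space L2"
  assumes X: "Cauchy X"
  shows "convergent X"
proof -
  have "\<exists>r. \<forall>n. (\<forall>p\<ge>r n. dist (X p) (X (r n)) < (1/2) ^ n) \<and> r n < r (Suc n)"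
  proof (rule dependent_nat_choice)
    show "\<exists>x. \<forall>p\<ge>x. dist (X p) (X x) < (1/2) ^ 0"
      using X[unfolded Cauchy_def, rule_format, of 1] by (auto simp: dest: spec)
  next
    fix x n
    obtain M where M: "\<And>p q. p \<ge> M \<Longrightarrow> q \<ge> M \<Longrightarrow> dist (X p) (X q) < (1/2) ^ Suc n"
      using X[unfolded Cauchy_def, rule_format, of "(1/2) ^ Suc n"] by auto
    then show "\<exists>y. (\<forall>p\<ge>y. dist (X p) (X y) < (1/2) ^ Suc n) \<and> x < y"
      by (intro exI[of _ "max M (Suc x)"]) auto
  qed
  then obtain r where r: "\<And>n p. p \<ge> r n \<Longrightarrow> dist (X p) (X (r n)) < (1/2) ^ n"
      "\<And>n. r n < r (Suc n)" by blast
  have "strict_mono r" using r(2) by (simp add: strict_mono_Suc_iff)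
  define Y where "Y n = X (r n)" for n
  have Y: "norm (Y m - Y n) \<le> (1/2) ^ n" if "n \<le> m" for m n
    using r(1)[of n "r m"] that \<open>strict_mono r\<close>
    by (simp add: Y_def dist_norm strict_mono_less_eq)
  have "\<exists>f. square_integrable f \<and> Y n = abs_L2 f" for n by (rule abs_L2_cases) blast
  then obtain F where F: "\<And>n. square_integrable (F n)" "\<And>n. Y n = abs_L2 (F n)"
    using choice[of "\<lambda>n f. square_integrable f \<and> Y n = abs_L2 f"] by auto
  note [measurable] = square_integrable_measurable[OF F(1)]
  have nn: "(\<integral>\<^sup>+ x. ennreal ((cmod (F m x - F n x))\<^sup>2) \<partial>lborel) = ennreal ((norm (Y m - Y n))\<^sup>2)"
    for m n
    using nn_integral_norm_abs_L2[OF square_integrable_diff[OF F(1) F(1)]]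
    by (simp add: minus_abs_L2 F)
  \<comment> \<open>The increments have squared norm at most \<open>(1/4) ^ n\<close>, so the weight
    \<open>2 ^ n\<close> keeps the sum finite; pointwise it forces geometric decay of
    \<open>F (Suc n) x - F n x\<close>.\<close>
  have "(\<integral>\<^sup>+ x. (\<Sum>n. ennreal (2 ^ n * (cmod (F (Suc n) x - F n x))\<^sup>2)) \<partial>lborel)
      = (\<Sum>n. ennreal (2 ^ n) * ennreal ((norm (Y (Suc n) - Y n))\<^sup>2))"
    by (simp add: nn_integral_suminf ennreal_mult nn_integral_cmult nn)
  also have "\<dots> \<le> (\<Sum>n. ennreal ((1/2) ^ n))"
  proof (intro suminf_le summableI)
    fix n
    have "(norm (Y (Suc n) - Y n))\<^sup>2 \<le> ((1/2) ^ n)\<^sup>2"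
      by (intro power_mono Y) auto
    then have "2 ^ n * (norm (Y (Suc n) - Y n))\<^sup>2 \<le> 2 ^ n * ((1/2) ^ n)\<^sup>2"
      by (intro mult_left_mono) auto
    also have "2 ^ n * ((1/2) ^ n)\<^sup>2 = (1/2 :: real) ^ n"
      by (simp add: power2_eq_square power_one_over)
    finally show "ennreal (2 ^ n) * ennreal ((norm (Y (Suc n) - Y n))\<^sup>2) \<le> ennreal ((1/2) ^ n)"
      by (simp add: ennreal_mult[symmetric] ennreal_leI)
  qed
  also have "\<dots> < \<infinity>"
    by (subst suminf_ennreal_eq[OF _ geometric_sums[of "1/2"]]) auto
  finally have "AE x in lborel. (\<Sum>n. ennreal (2 ^ n * (cmod (F (Suc n) x - F n x))\<^sup>2)) \<noteq> \<infinity>"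
    by (intro nn_integral_noteq_infinite) auto
  then have conv: "AE x in lborel. convergent (\<lambda>n. F n x)"
  proof eventually_elim
    case (elim x)
    obtain C where C: "(\<Sum>n. ennreal (2 ^ n * (cmod (F (Suc n) x - F n x))\<^sup>2)) = ennreal C" "C \<ge> 0"
      using ennreal_finiteE[OF elim] by metis
    have "cmod (F (Suc n) x - F n x) \<le> sqrt C * (sqrt (1/2)) ^ n" for n
    proof -
      have "ennreal (2 ^ n * (cmod (F (Suc n) x - F n x))\<^sup>2) \<le> ennreal C"
        unfolding C(1)[symmetric] by (rule ennreal_le_suminf[of "\<lambda>n. ennreal (2 ^ n * (cmod (F (Suc n) x - F n x))\<^sup>2)"])
      then have "2 ^ n * (cmod (F (Suc n) x - F n x))\<^sup>2 \<le> C"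
        using C(2) ennreal_le_iff by blast
      then have "(cmod (F (Suc n) x - F n x))\<^sup>2 \<le> C * (1/2) ^ n"
        using mult_right_mono[of "2 ^ n * (cmod (F (Suc n) x - F n x))\<^sup>2" C "(1/2)^n"]
        by (simp add: power_one_over)
      then have "cmod (F (Suc n) x - F n x) \<le> sqrt (C * (1/2) ^ n)" by (rule real_le_rsqrt)
      then show ?thesis by (simp only: real_sqrt_mult real_sqrt_power)
    qed
    then have "summable (\<lambda>n. F (Suc n) x - F n x)"
      by (intro summable_norm_cancel[OF summable_comparison_test[OF _ summable_mult[OF summable_geometric]]])
        (auto intro!: exI[of _ 0] simp: real_sqrt_divide)
    then have "convergent (\<lambda>n. \<Sum>k<n. F (Suc k) x - F k x)" by (simp add: summable_iff_convergent)
    then have "convergent (\<lambda>n. F n x - F 0 x)" by (simp only: sum_lessThan_telescope[of "\<lambda>n. F n x"])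
    from convergent_add[OF this convergent_const[of "F 0 x"]] show ?case by simp
  qed
  define g where "g x = lim (\<lambda>n. F n x)" for x
  have [measurable]: "g \<in> borel_measurable lborel" unfolding g_def by measurable
  have conv: "AE x in lborel. (\<lambda>n. F n x) \<longlonglongrightarrow> g x"
    using conv by eventually_elim (auto simp: g_def convergent_LIMSEQ_iff)
  have fatou: "(\<integral>\<^sup>+ x. ennreal ((cmod (g x - F n x))\<^sup>2) \<partial>lborel) \<le> ennreal (((1/2)^n)\<^sup>2)" for n
  proof -
    have "(\<integral>\<^sup>+ x. ennreal ((cmod (g x - F n x))\<^sup>2) \<partial>lborel)
        = (\<integral>\<^sup>+ x. liminf (\<lambda>m. ennreal ((cmod (F m x - F n x))\<^sup>2)) \<partial>lborel)"
      using conv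
    proof (intro nn_integral_cong_AE, eventually_elim)
      case (elim x)
      then have "(\<lambda>m. ennreal ((cmod (F m x - F n x))\<^sup>2)) \<longlonglongrightarrow> ennreal ((cmod (g x - F n x))\<^sup>2)"
        by (intro tendsto_intros)
      then show ?case by (intro lim_imp_Liminf[symmetric]) auto
    qed
    also have "\<dots> \<le> liminf (\<lambda>m. \<integral>\<^sup>+ x. ennreal ((cmod (F m x - F n x))\<^sup>2) \<partial>lborel)"
      by (intro nn_integral_liminf) auto
    also have "\<dots> \<le> liminf (\<lambda>m::nat. ennreal (((1/2)^n)\<^sup>2))"
      unfolding nn
      by (intro Liminf_mono eventually_sequentiallyI[of n] ennreal_leI power_mono Y) auto
    finally show ?thesis by (simp add: Liminf_const)
  qed
  have sq: "square_integrable (\<lambda>x. g x - F n x)" for n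
    by (intro square_integrable_nnI le_less_trans[OF fatou]) simp_all
  have g: "square_integrable g"
    using square_integrable_add[OF sq[of 0] F(1)[of 0]] by simp
  have "norm (Y n - abs_L2 g) \<le> (1/2) ^ n" for n
  proof -
    have "ennreal ((norm (abs_L2 g - Y n))\<^sup>2) \<le> ennreal (((1/2)^n)\<^sup>2)"
      using fatou[of n] nn_integral_norm_abs_L2[OF sq[of n]] by (simp add: minus_abs_L2 F g)
    then have "(norm (abs_L2 g - Y n))\<^sup>2 \<le> ((1/2)^n)\<^sup>2" by (subst (asm) ennreal_le_iff) auto
    then show ?thesis by (metis norm_minus_commute power2_le_imp_le zero_le_power
          zero_le_divide_1_iff zero_le_numeral)
  qed
  then have "(\<lambda>n. Y n - abs_L2 g) \<longlonglongrightarrow> 0"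
    by (intro Lim_null_comparison[where g = "\<lambda>n. (1/2)^n" and f = "\<lambda>n. Y n - abs_L2 g"] LIMSEQ_power_zero) auto
  then have "(X \<circ> r) \<longlonglongrightarrow> abs_L2 g"
    by (simp add: LIM_zero_iff Y_def comp_def)
  then show ?thesis
    using Cauchy_converges_subseq[OF X \<open>strict_mono r\<close>] by (auto simp: convergent_def)
qed

instance L2 :: (euclidean_space) complete_space
  by intro_classes (rule L2_Cauchy_convergent)

instance L2 :: (euclidean_space) banach ..

lemma bounded_opD:
  assumes "bounded_op A"
  shows "bounded_linear A" "A (c *\<^sub>C \<psi>) = c *\<^sub>C A \<psi>" "A (\<psi> + \<phi>) = A \<psi> + A \<phi>"
    "A (\<psi> - \<phi>) = A \<psi> - A \<phi>" "A 0 = 0"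
  using assms unfolding bounded_op_def
  by (auto simp: linear_simps)

lemma Re_cinner_norm: "Re (cinner a a) = (norm a)\<^sup>2"
  by (simp add: cinner_self_norm)

lemma cinner_mult_cinner: "cinner a b * cinner b a = of_real ((cmod (cinner a b))\<^sup>2)"
  using cinner_commute[of b a] by (simp add: complex_norm_square[symmetric])

lemma norm_cinner_commute: "cmod (cinner a b) = cmod (cinner b a)"
  using cinner_commute[of b a] by simp

section \<open>Orthonormal systems\<close>

lemma norm_sum_orthonormal:
  assumes "orthonormal e" "finite F"
  shows "(norm (\<Sum>n\<in>F. c n *\<^sub>C e n))\<^sup>2 = (\<Sum>n\<in>F. (cmod (c n))\<^sup>2)"
proof -
  have "cinner (\<Sum>n\<in>F. c n *\<^sub>C e n) (\<Sum>n\<in>F. c n *\<^sub>C e n)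
      = (\<Sum>n\<in>F. \<Sum>m\<in>F. c n * cnj (c m) * cinner (e n) (e m))"
    by (simp add: cinner.sum_left cinner.sum_right cinner_scaleC_left cinner_scaleC_right
        sum_distrib_left mult.assoc) (subst sum.swap, simp add: mult.left_commute)
  also have "\<dots> = (\<Sum>n\<in>F. \<Sum>m\<in>F. if n = m then c n * cnj (c m) else 0)"
    using assms(1) by (intro sum.cong refl) (auto simp: orthonormal_def)
  also have "\<dots> = (\<Sum>n\<in>F. of_real ((cmod (c n))\<^sup>2))"
    using assms(2) by (intro sum.cong refl)
      (auto simp: sum.delta' complex_norm_square[symmetric] simp del: of_real_power)
  finally show ?thesis
    unfolding cinner_self_norm of_real_sum[symmetric] of_real_eq_iff .
qed

lemma bessel_finite:
  assumes "orthonormal e" "finite F"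
  shows "(\<Sum>n\<in>F. (cmod (cinner \<psi> (e n)))\<^sup>2) \<le> (norm \<psi>)\<^sup>2"
proof -
  let ?s = "\<Sum>n\<in>F. cinner \<psi> (e n) *\<^sub>C e n"
  let ?b = "\<Sum>n\<in>F. (cmod (cinner \<psi> (e n)))\<^sup>2"
  have 1: "Re (cinner \<psi> ?s) = ?b"
    by (simp add: cinner.sum_right cinner_scaleC_right complex_norm_square[symmetric] mult.commute
        flip: of_real_power)
  have "0 \<le> (norm (\<psi> - ?s))\<^sup>2" by simp
  also have "(norm (\<psi> - ?s))\<^sup>2 = (norm \<psi>)\<^sup>2 - 2 * Re (cinner \<psi> ?s) + (norm ?s)\<^sup>2"
    unfolding Re_cinner_norm[symmetric] cinner.diff_left cinner.diff_right
    using cinner_commute[of "?s" \<psi>] by simp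
  finally show ?thesis unfolding 1 norm_sum_orthonormal[OF assms] by simp
qed

lemma summable_bessel:
  assumes "orthonormal e"
  shows "summable (\<lambda>n. (cmod (cinner \<psi> (e n)))\<^sup>2)"
  by (intro bounded_imp_summable[where B = "(norm \<psi>)\<^sup>2"] bessel_finite assms) auto

lemma summable_orthonormal:
  assumes "orthonormal e" "summable (\<lambda>n. (cmod (c n))\<^sup>2)"
  shows "summable (\<lambda>n. c n *\<^sub>C e n)"
  unfolding summable_Cauchy
proof (intro allI impI)
  fix \<epsilon> :: real assume "0 < \<epsilon>"
  then obtain N where N: "\<And>m n. m \<ge> N \<Longrightarrow> norm (\<Sum>k=m..<n. (cmod (c k))\<^sup>2) < \<epsilon>\<^sup>2"
    using assms(2)[unfolded summable_Cauchy, rule_format, of "\<epsilon>\<^sup>2"] by auto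
  have "norm (\<Sum>k=m..<n. c k *\<^sub>C e k) < \<epsilon>" if "m \<ge> N" for m n
    using N[OF that, of n] \<open>0 < \<epsilon>\<close>
    by (intro power2_less_imp_less[of _ \<epsilon>]) (simp_all add: norm_sum_orthonormal[OF assms(1)])
  then show "\<exists>N. \<forall>m\<ge>N. \<forall>n. norm (\<Sum>k=m..<n. c k *\<^sub>C e k) < \<epsilon>" by blast
qed

lemma cinner_sums_orthonormal:
  assumes "orthonormal e" "(\<lambda>n. c n *\<^sub>C e n) sums \<psi>"
  shows "cinner \<psi> (e m) = c m"
proof -
  have "(\<lambda>n. cinner (c n *\<^sub>C e n) (e m)) sums cinner \<psi> (e m)"
    by (rule bounded_linear.sums[OF cinner.bounded_linear_left assms(2)])
  also have "(\<lambda>n. cinner (c n *\<^sub>C e n) (e m)) = (\<lambda>n. if n = m then c n else 0)"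
    using assms(1) by (auto simp: cinner_scaleC_left orthonormal_def)
  finally show ?thesis using sums_single[of m c] sums_unique2 by blast
qed

text \<open>Bessel and completeness give a limit of the series; it has the same coefficients as
  \<open>\<psi>\<close>, and totality identifies the two.\<close>

lemma orthonormal_basis_sums:
  assumes "orthonormal_basis e"
  shows "(\<lambda>n. cinner \<psi> (e n) *\<^sub>C e n) sums \<psi>"
proof -
  have e: "orthonormal e" using assms by (simp add: orthonormal_basis_def)
  obtain \<xi> where \<xi>: "(\<lambda>n. cinner \<psi> (e n) *\<^sub>C e n) sums \<xi>"
    using summable_orthonormal[OF e summable_bessel[OF e]] by (auto simp: summable_def)
  have "cinner (\<psi> - \<xi>) (e m) = 0" for m
    using cinner_sums_orthonormal[OF e \<xi>] by (simp add: cinner.diff_left)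
  then have "\<psi> - \<xi> = 0" using assms unfolding orthonormal_basis_def by blast
  with \<xi> show ?thesis by simp
qed

lemma parseval_cinner:
  assumes "orthonormal_basis e"
  shows "(\<lambda>n. cinner \<psi> (e n) * cinner (e n) \<phi>) sums cinner \<psi> \<phi>"
  using bounded_linear.sums[OF cinner.bounded_linear_left orthonormal_basis_sums[OF assms]]
  by (simp add: cinner_scaleC_left)

lemma parseval_norm:
  assumes "orthonormal_basis e"
  shows "(\<lambda>n. (cmod (cinner \<psi> (e n)))\<^sup>2) sums (norm \<psi>)\<^sup>2"
  using bounded_linear.sums[OF bounded_linear_Re parseval_cinner[OF assms, of \<psi> \<psi>]]
  by (simp add: cinner_mult_cinner Re_cinner_norm flip: of_real_power)

lemma parseval_ennreal:
  assumes "orthonormal_basis e"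
  shows "(\<Sum>n. ennreal ((cmod (cinner \<psi> (e n)))\<^sup>2)) = ennreal ((norm \<psi>)\<^sup>2)"
  by (intro suminf_ennreal_eq parseval_norm assms) simp

text \<open>The representing vector has the coefficients \<open>L (e n)\<close>; boundedness of
  \<open>L\<close> makes them square summable. Needed to show that the weak integral defining
  \<open>conv_fun_op\<close> exists.\<close>

lemma riesz_representation:
  fixes L :: "'a::euclidean_space L2 \<Rightarrow> complex" and e :: "nat \<Rightarrow> 'a L2"
  assumes e: "orthonormal_basis e" and L: "bounded_linear L"
    and conj: "\<And>c \<phi>. L (c *\<^sub>C \<phi>) = cnj c * L \<phi>"
  shows "\<exists>\<xi>. \<forall>\<phi>. L \<phi> = cinner \<xi> \<phi>"
proof -
  interpret bounded_linear L by (rule L)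
  have on: "orthonormal e" using e by (simp add: orthonormal_basis_def)
  obtain K where K: "\<And>\<phi>. cmod (L \<phi>) \<le> norm \<phi> * K" "K \<ge> 0" using nonneg_bounded by blast
  have "summable (\<lambda>n. (cmod (L (e n)))\<^sup>2)"
  proof (rule bounded_imp_summable[where B = "K\<^sup>2"])
    fix N
    define t where "t = (\<Sum>n\<le>N. (cmod (L (e n)))\<^sup>2)"
    \<comment> \<open>Testing \<open>L\<close> on its own truncated coefficients:
      \<open>L \<phi>\<close> and the squared norm of \<open>\<phi>\<close> both equal
      \<open>t\<close>, whence \<open>t \<le> sqrt t * K\<close>.\<close>
    define \<phi> where "\<phi> = (\<Sum>n\<le>N. L (e n) *\<^sub>C e n)"
    have t: "0 \<le> t" by (auto simp: t_def intro: sum_nonneg)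
    have "L \<phi> = (\<Sum>n\<le>N. of_real ((cmod (L (e n)))\<^sup>2))"
      unfolding \<phi>_def sum conj
      by (intro sum.cong refl) (simp add: complex_norm_square mult.commute del: of_real_power)
    then have "L \<phi> = of_real t" by (simp add: t_def)
    moreover have "(norm \<phi>)\<^sup>2 = t" unfolding \<phi>_def t_def by (rule norm_sum_orthonormal[OF on]) simp
    then have "norm \<phi> = sqrt t" using real_sqrt_unique by fastforce
    ultimately have "t \<le> sqrt t * K" using K(1)[of \<phi>] t by simp
    moreover have "t = sqrt t * sqrt t" using t by simp
    ultimately have "sqrt t * sqrt t \<le> sqrt t * K" by simp
    then have "sqrt t \<le> K"
      using K(2) t mult_left_le_imp_le[of "sqrt t" "sqrt t" K] by (cases "t = 0") auto
    then show "t \<le> K\<^sup>2" using t by (simp add: sqrt_le_D)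
  qed simp
  from summable_orthonormal[OF on this] obtain \<xi> where \<xi>: "(\<lambda>n. L (e n) *\<^sub>C e n) sums \<xi>"
    by (auto simp: summable_def)
  have "L \<phi> = cinner \<xi> \<phi>" for \<phi>
  proof -
    have "(\<lambda>n. L (cinner \<phi> (e n) *\<^sub>C e n)) sums L \<phi>"
      by (rule sums[OF orthonormal_basis_sums[OF e]])
    moreover have "L (cinner \<phi> (e n) *\<^sub>C e n) = cinner (L (e n) *\<^sub>C e n) \<phi>" for n
      using cinner_commute[of "e n" \<phi>] by (simp add: conj cinner_scaleC_left mult.commute)
    ultimately have "(\<lambda>n. cinner (L (e n) *\<^sub>C e n) \<phi>) sums L \<phi>" by simp
    moreover have "(\<lambda>n. cinner (L (e n) *\<^sub>C e n) \<phi>) sums cinner \<xi> \<phi>"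
      by (rule bounded_linear.sums[OF cinner.bounded_linear_left \<xi>])
    ultimately show ?thesis by (rule sums_unique2)
  qed
  then show ?thesis by blast
qed

section \<open>Positive operators and the Cholesky iteration\<close>

lemma positive_op_nonneg:
  assumes "positive_op T"
  shows "0 \<le> Re (cinner (T \<psi>) \<psi>)" "Im (cinner (T \<psi>) \<psi>) = 0"
  using assms by (auto simp: positive_op_def complex_nonneg_Reals_iff)

lemma positive_op_bounded: "positive_op T \<Longrightarrow> bounded_op T"
  by (simp add: positive_op_def)

text \<open>Polarisation: reality of the form at \<open>a + b\<close> compares the imaginary parts,
  reality at \<open>a + \<i> *\<^sub>C b\<close> the real parts.\<close>

lemma positive_op_selfadjoint:
  assumes T: "positive_op T"
  shows "cinner (T a) b = cinner a (T b)"
proof -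
  note lin = bounded_opD[OF positive_op_bounded[OF T]]
  have "Im (cinner (T a) b) = - Im (cinner (T b) a)"
    using positive_op_nonneg(2)[OF T, of "a + b"] positive_op_nonneg(2)[OF T, of a]
      positive_op_nonneg(2)[OF T, of b] by (simp add: lin cinner.add_left cinner.add_right)
  moreover have "Re (cinner (T a) b) = Re (cinner (T b) a)"
    using positive_op_nonneg(2)[OF T, of "a + \<i> *\<^sub>C b"] positive_op_nonneg(2)[OF T, of a]
      positive_op_nonneg(2)[OF T, of b]
    by (simp add: lin cinner.add_left cinner.add_right cinner_scaleC_left cinner_scaleC_right)
  ultimately have "cinner (T a) b = cnj (cinner (T b) a)" by (simp add: complex_eq_iff)
  then show ?thesis using cinner_commute[of a "T b"] by simp
qed

text \<open>The classical discriminant argument for the semi-definite form of \<open>T\<close>,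
  applied on the line through \<open>a\<close> in the direction
  \<open>x *\<^sub>C b\<close>.\<close>

lemma positive_op_cauchy_schwarz:
  assumes T: "positive_op T"
  shows "(cmod (cinner (T a) b))\<^sup>2 \<le> Re (cinner (T a) a) * Re (cinner (T b) b)"
proof -
  note lin = bounded_opD[OF positive_op_bounded[OF T]]
  define x where "x = cinner (T a) b"
  have x': "cinner (T b) a = cnj x"
    using positive_op_selfadjoint[OF T, of a b] cinner_commute[of "T b" a] by (simp add: x_def)
  have xx: "x * cnj x = of_real ((cmod x)\<^sup>2)" by (simp add: complex_norm_square del: of_real_power)
  have ineq: "0 \<le> Re (cinner (T a) a) - 2 * t * (cmod x)\<^sup>2 + t\<^sup>2 * (cmod x)\<^sup>2 * Re (cinner (T b) b)"
    for t :: real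
  proof -
    \<comment> \<open>The factor \<open>x\<close> aligns the phases, so that each cross term becomes
      \<open>t\<close> times the squared modulus of \<open>x\<close>.\<close>
    let ?c = "of_real t * x"
    have "cinner (T (a - ?c *\<^sub>C b)) (a - ?c *\<^sub>C b) = cinner (T a) a - of_real t * (x * cnj x)
        - of_real t * (x * cnj x) + of_real (t\<^sup>2) * (x * cnj x) * cinner (T b) b"
      by (simp add: lin cinner.diff_left cinner.diff_right cinner_scaleC_left cinner_scaleC_right
          x' x_def[symmetric] algebra_simps power2_eq_square)
    then show ?thesis using positive_op_nonneg(1)[OF T, of "a - ?c *\<^sub>C b"]
      unfolding xx by (simp flip: of_real_power of_real_mult)
  qed
  show ?thesis
  proof (cases "Re (cinner (T b) b) = 0")
    case True
    have "x = 0"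
    proof (rule ccontr)
      assume "x \<noteq> 0"
      then have "0 < (cmod x)\<^sup>2" by simp
      \<comment> \<open>Without a quadratic term the bound is affine in \<open>t\<close>; this
        \<open>t\<close> makes its value -1.\<close>
      then show False
        using ineq[of "(Re (cinner (T a) a) + 1) / (2 * (cmod x)\<^sup>2)"] True by (simp add: field_simps)
    qed
    then show ?thesis using True by (simp add: x_def)
  next
    case False
    then have "0 < Re (cinner (T b) b)" using positive_op_nonneg(1)[OF T, of b] by linarith
    \<comment> \<open>The chosen \<open>t\<close> minimises the quadratic polynomial.\<close>
    then show ?thesis
      using ineq[of "1 / Re (cinner (T b) b)"]
      by (simp add: x_def[symmetric] field_simps power2_eq_square)
  qed
qed

lemma positive_op_eq_0:
  assumes T: "positive_op T" and "Re (cinner (T b) b) = 0"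
  shows "T b = 0"
proof -
  have "(cmod (cinner (T b) (T b)))\<^sup>2 \<le> 0"
    using positive_op_cauchy_schwarz[OF T, of b "T b"] assms(2) by simp
  then show ?thesis using cinner_self[of "T b"] by simp
qed

text \<open>If \<open>cinner (T b) b = 0\<close>, then \<open>T b = 0\<close> and the factor \<open>1 / 0 = 0\<close> makes the step below trivial.\<close>

definition chol_vec :: "('a::euclidean_space L2 \<Rightarrow> 'a L2) \<Rightarrow> 'a L2 \<Rightarrow> 'a L2" where
  "chol_vec T b = complex_of_real (1 / sqrt (Re (cinner (T b) b))) *\<^sub>C T b"

text \<open>The Schur complement of \<open>T\<close> with respect to \<open>b\<close>: one
  elimination step of the Cholesky factorisation.\<close>

definition chol_step :: "('a::euclidean_space L2 \<Rightarrow> 'a L2) \<Rightarrow> 'a L2 \<Rightarrow> 'a L2 \<Rightarrow> 'a L2" where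
  "chol_step T b \<psi> = T \<psi> - cinner \<psi> (chol_vec T b) *\<^sub>C chol_vec T b"

lemma norm_cinner_chol_vec:
  assumes T: "positive_op T"
  shows "(cmod (cinner \<psi> (chol_vec T b)))\<^sup>2 = (cmod (cinner (T \<psi>) b))\<^sup>2 / Re (cinner (T b) b)"
  using positive_op_nonneg(1)[OF T, of b]
  by (simp add: chol_vec_def cinner_scaleC_right norm_mult norm_divide power_mult_distrib power_divide
      positive_op_selfadjoint[OF T] del: of_real_divide)

text \<open>By \<open>norm_cinner_chol_vec\<close>, positivity of the remainder is precisely the
  Cauchy-Schwarz inequality for the form of \<open>T\<close> at \<open>\<psi>\<close> and
  \<open>b\<close>.\<close>

lemma positive_op_chol_step:
  assumes T: "positive_op T"
  shows "positive_op (chol_step T b)"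
proof -
  note lin = bounded_opD[OF positive_op_bounded[OF T]]
  have bl: "bounded_linear (chol_step T b)"
    unfolding chol_step_def
    by (intro bounded_linear_sub lin(1)
        bounded_linear_compose[OF scaleC.bounded_linear_left cinner.bounded_linear_left])
  have sc: "chol_step T b (c *\<^sub>C \<psi>) = c *\<^sub>C chol_step T b \<psi>" for c \<psi>
    by (simp add: chol_step_def lin cinner_scaleC_left scaleC_scaleC scaleC.diff_right)
  have "cinner (chol_step T b \<psi>) \<psi>
      = cinner (T \<psi>) \<psi> - of_real ((cmod (cinner \<psi> (chol_vec T b)))\<^sup>2)" for \<psi>
    unfolding chol_step_def cinner.diff_left cinner_scaleC_left cinner_mult_cinner ..
  moreover have "(cmod (cinner \<psi> (chol_vec T b)))\<^sup>2 \<le> Re (cinner (T \<psi>) \<psi>)" for \<psi>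
  proof (cases "Re (cinner (T b) b) = 0")
    case True
    then show ?thesis using positive_op_nonneg(1)[OF T, of \<psi>] by (simp add: norm_cinner_chol_vec[OF T])
  next
    case False
    then have "0 < Re (cinner (T b) b)" using positive_op_nonneg(1)[OF T, of b] by linarith
    then show ?thesis
      unfolding norm_cinner_chol_vec[OF T]
      using positive_op_cauchy_schwarz[OF T, of \<psi> b] by (simp add: pos_divide_le_eq)
  qed
  ultimately show ?thesis
    using positive_op_nonneg[OF T] bl sc
    by (auto simp: positive_op_def bounded_op_def complex_nonneg_Reals_iff simp del: of_real_power)
qed

lemma chol_step_self:
  assumes T: "positive_op T"
  shows "chol_step T b b = 0"
proof (cases "Re (cinner (T b) b) = 0")
  case True
  then show ?thesis using positive_op_eq_0[OF T True] by (simp add: chol_step_def chol_vec_def scaleC.zero_right)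
next
  case False
  define a where "a = Re (cinner (T b) b)"
  have a: "0 < a" using False positive_op_nonneg(1)[OF T, of b] by (simp add: a_def)
  have "cinner b (T b) = of_real a"
    using positive_op_nonneg(2)[OF T, of b] positive_op_selfadjoint[OF T, of b b]
    by (simp add: a_def complex_eq_iff)
  moreover have "complex_of_real (sqrt a) * complex_of_real (sqrt a) = of_real a"
    using a by (simp flip: of_real_mult)
  ultimately have "cinner b (chol_vec T b) * complex_of_real (1 / sqrt a) = 1"
    using a by (simp add: chol_vec_def a_def[symmetric] cinner_scaleC_right)
  then show ?thesis
    by (simp add: chol_step_def chol_vec_def[of T b] a_def[symmetric] scaleC_scaleC cinner_scaleC_right)
qed

text \<open>The subtracted vector is a multiple of \<open>T b\<close>, which is orthogonal to the
  kernel of \<open>T\<close>; directions once eliminated therefore stay eliminated.\<close>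

lemma chol_step_zero:
  assumes T: "positive_op T" and c: "T c = 0"
  shows "chol_step T b c = 0"
proof -
  have "cinner c (T b) = 0" using positive_op_selfadjoint[OF T, of c b] c by (simp add: cinner.zero_left)
  then show ?thesis
    by (simp add: chol_step_def chol_vec_def c cinner_scaleC_right scaleC.zero_left)
qed

text \<open>Iterated Schur complements: the part of \<open>S\<close> that remains after eliminating
  \<open>v 0\<close> up to \<open>v (n - 1)\<close>.\<close>

primrec chol :: "('a::euclidean_space L2 \<Rightarrow> 'a L2) \<Rightarrow> (nat \<Rightarrow> 'a L2) \<Rightarrow> nat \<Rightarrow> 'a L2 \<Rightarrow> 'a L2" where
  "chol S v 0 = S"
| "chol S v (Suc n) = chol_step (chol S v n) (v n)"

lemma positive_op_chol: "positive_op S \<Longrightarrow> positive_op (chol S v n)"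
  by (induction n) (simp_all add: positive_op_chol_step)

lemma chol_eq:
  "chol S v n \<psi> = S \<psi> - (\<Sum>k<n. cinner \<psi> (chol_vec (chol S v k) (v k)) *\<^sub>C chol_vec (chol S v k) (v k))"
  by (induction n) (simp_all add: chol_step_def)

lemma chol_zero:
  assumes "positive_op S" "chol S v m c = 0" "m \<le> n"
  shows "chol S v n c = 0"
  using assms(3,2) by (induction n rule: dec_induct)
    (simp_all add: chol_step_zero positive_op_chol assms(1))

lemma chol_basis_zero: "positive_op S \<Longrightarrow> k < n \<Longrightarrow> chol S v n (v k) = 0"
  by (rule chol_zero[of _ _ "Suc k"]) (simp_all add: chol_step_self positive_op_chol)

lemma chol_le:
  "positive_op S \<Longrightarrow> Re (cinner (chol S v n \<psi>) \<psi>) \<le> Re (cinner (S \<psi>) \<psi>)"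
  by (simp add: chol_eq cinner.diff_left cinner.sum_left cinner_scaleC_left cinner_mult_cinner
      sum_nonneg flip: of_real_power)

text \<open>On the span of the basis the iteration reaches 0 after finitely many steps; since the forms
  decrease, the remainder tends to 0 everywhere.\<close>

lemma chol_tendsto_0:
  assumes S: "positive_op S" and e: "orthonormal_basis e"
  shows "(\<lambda>n. Re (cinner (chol S e n \<psi>) \<psi>)) \<longlonglongrightarrow> 0"
proof (rule LIMSEQ_I)
  fix \<epsilon> :: real assume "0 < \<epsilon>"
  define s where "s N = \<psi> - (\<Sum>k<N. cinner \<psi> (e k) *\<^sub>C e k)" for N
  have "(\<lambda>N. \<Sum>k<N. cinner \<psi> (e k) *\<^sub>C e k) \<longlonglongrightarrow> \<psi>"
    using orthonormal_basis_sums[OF e, of \<psi>] by (simp add: sums_def)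
  then have "s \<longlonglongrightarrow> 0" unfolding s_def using tendsto_diff[OF tendsto_const[of \<psi>]] by fastforce
  then have "(\<lambda>N. Re (cinner (S (s N)) (s N))) \<longlonglongrightarrow> Re (cinner (S 0) 0)"
    by (intro tendsto_Re cinner.tendsto bounded_linear.tendsto[OF bounded_opD(1)[OF positive_op_bounded[OF S]]])
  then obtain N where "norm (Re (cinner (S (s N)) (s N)) - 0) < \<epsilon>"
    using LIMSEQ_D[OF _ \<open>0 < \<epsilon>\<close>] by (fastforce simp: cinner.zero_right)
  then have N: "Re (cinner (S (s N)) (s N)) < \<epsilon>" by simp
  have "norm (Re (cinner (chol S e n \<psi>) \<psi>) - 0) < \<epsilon>" if "n \<ge> N" for n
  proof -
    note T = positive_op_chol[OF S, of e n]
    note lin = bounded_opD[OF positive_op_bounded[OF T]]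
    interpret T: bounded_linear "chol S e n" by (rule lin)
    \<comment> \<open>For \<open>n \<ge> N\<close> the truncated expansion of \<open>\<psi>\<close>
      is annihilated, so the form of the remainder sees only the tail \<open>s N\<close>, where it
      is dominated by the form of \<open>S\<close>.\<close>
    have 0: "chol S e n (\<Sum>k<N. cinner \<psi> (e k) *\<^sub>C e k) = 0"
      using that by (simp add: T.sum lin chol_basis_zero[OF S] scaleC.zero_right)
    then have eq: "chol S e n (s N) = chol S e n \<psi>" by (simp add: s_def T.diff)
    have "cinner (chol S e n \<psi>) \<psi> = cinner (chol S e n (s N)) (s N)"
      unfolding eq unfolding s_def cinner.diff_right positive_op_selfadjoint[OF T, of \<psi> "sum _ _"] 0
      by (simp add: cinner.zero_right)
    then show ?thesis
      using N chol_le[OF S, of e n "s N"] positive_op_nonneg(1)[OF T, of \<psi>] by simp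
  qed
  then show "\<exists>N. \<forall>n\<ge>N. norm (Re (cinner (chol S e n \<psi>) \<psi>) - 0) < \<epsilon>" by blast
qed

text \<open>The error of the \<open>n\<close>-th partial sum is the form of
  \<open>chol S e n\<close>; Cauchy-Schwarz bounds it off the diagonal by diagonal values, which
  tend to 0.\<close>

lemma cholesky_sums:
  assumes S: "positive_op S" and e: "orthonormal_basis e"
  defines "f \<equiv> \<lambda>k. chol_vec (chol S e k) (e k)"
  shows "(\<lambda>k. cinner \<psi> (f k) * cinner (f k) \<phi>) sums cinner (S \<psi>) \<phi>"
proof -
  have "(\<lambda>n. cinner (chol S e n \<psi>) \<phi>) \<longlonglongrightarrow> 0"
  proof (rule Lim_null_comparison)
    have "(\<lambda>n. sqrt (Re (cinner (chol S e n \<psi>) \<psi>) * Re (cinner (chol S e n \<phi>) \<phi>))) \<longlonglongrightarrow> sqrt (0 * 0)"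
      by (intro tendsto_intros chol_tendsto_0 S e)
    then show "(\<lambda>n. sqrt (Re (cinner (chol S e n \<psi>) \<psi>) * Re (cinner (chol S e n \<phi>) \<phi>))) \<longlonglongrightarrow> 0"
      by simp
    show "\<forall>\<^sub>F n in sequentially. cmod (cinner (chol S e n \<psi>) \<phi>)
        \<le> sqrt (Re (cinner (chol S e n \<psi>) \<psi>) * Re (cinner (chol S e n \<phi>) \<phi>))"
      by (intro always_eventually allI real_le_rsqrt positive_op_cauchy_schwarz positive_op_chol S)
  qed
  then have "(\<lambda>n. cinner (S \<psi>) \<phi> - (\<Sum>k<n. cinner \<psi> (f k) * cinner (f k) \<phi>)) \<longlonglongrightarrow> 0"
    by (simp add: chol_eq cinner.diff_left cinner.sum_left cinner_scaleC_left f_def)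
  from tendsto_diff[OF tendsto_const[of "cinner (S \<psi>) \<phi>"] this] show ?thesis by (simp add: sums_def)
qed

section \<open>Existence of an orthonormal basis\<close>

lemma positive_op_id: "positive_op (\<lambda>\<psi>. \<psi>)"
  using cinner_self by (auto simp: positive_op_def bounded_op_def complex_nonneg_Reals_iff)

text \<open>For an orthogonal projection \<open>T\<close>, \<open>chol_vec T b\<close> is the
  normalised image of \<open>b\<close>, or 0; the step removes its line from the range, so the
  remainder is again a projection.\<close>

lemma chol_step_projection:
  assumes T: "positive_op T" and idem: "\<And>\<psi>. T (T \<psi>) = T \<psi>"
  shows "T (chol_vec T b) = chol_vec T b"
    and "chol_vec T b = 0 \<or> cinner (chol_vec T b) (chol_vec T b) = 1"
    and "chol_step T b (chol_step T b \<psi>) = chol_step T b \<psi>"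
    and "chol_step T b (chol_vec T b) = 0"
proof -
  note lin = bounded_opD[OF positive_op_bounded[OF T]]
  let ?v = "chol_vec T b"
  show 1: "T ?v = ?v" by (simp add: chol_vec_def lin idem)
  show 2: "?v = 0 \<or> cinner ?v ?v = 1"
  proof (cases "Re (cinner (T b) b) = 0")
    case True
    then show ?thesis by (simp add: chol_vec_def scaleC.zero_left)
  next
    case False
    define a where "a = Re (cinner (T b) b)"
    have a: "0 < a" using False positive_op_nonneg(1)[OF T, of b] by (simp add: a_def)
    have "cinner (T b) (T b) = cinner (T b) b"
      using positive_op_selfadjoint[OF T, of "T b" b] by (simp add: idem)
    also have "\<dots> = of_real a"
      using positive_op_nonneg(2)[OF T, of b] by (simp add: a_def complex_eq_iff)
    finally have "cinner ?v ?v = of_real a / (of_real (sqrt a) * of_real (sqrt a))"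
      by (simp add: chol_vec_def a_def[symmetric] cinner_scaleC_left cinner_scaleC_right)
    also have "\<dots> = 1" using a by (simp flip: of_real_mult)
    finally show ?thesis by simp
  qed
  have 3: "cinner (T \<psi>) ?v = cinner \<psi> ?v" for \<psi>
    using positive_op_selfadjoint[OF T, of \<psi> ?v] by (simp add: 1)
  show "chol_step T b (chol_step T b \<psi>) = chol_step T b \<psi>"
    using 2 by (auto simp: chol_step_def lin idem 1 3 cinner.diff_left cinner_scaleC_left
        scaleC.zero_right scaleC.zero_left)
  show "chol_step T b ?v = 0"
    using 2 by (auto simp: chol_step_def 1 scaleC.zero_left cinner.zero_right)
qed

lemma chol_id_idem: "chol (\<lambda>\<psi>. \<psi>) v n (chol (\<lambda>\<psi>. \<psi>) v n \<psi>) = chol (\<lambda>\<psi>. \<psi>) v n \<psi>"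
  by (induction n arbitrary: \<psi>)
    (simp_all add: chol_step_projection(3)[OF positive_op_chol[OF positive_op_id]])

text \<open>Gram--Schmidt is the Cholesky iteration of the identity.\<close>

definition gram_schmidt :: "(nat \<Rightarrow> 'a::euclidean_space L2) \<Rightarrow> nat \<Rightarrow> 'a L2" where
  "gram_schmidt v n = chol_vec (chol (\<lambda>\<psi>. \<psi>) v n) (v n)"

text \<open>The value 0 occurs when \<open>v n\<close> depends linearly on its predecessors.\<close>

lemma gram_schmidt_norm:
  "gram_schmidt v n = 0 \<or> cinner (gram_schmidt v n) (gram_schmidt v n) = 1"
  unfolding gram_schmidt_def
  by (intro chol_step_projection(2) positive_op_chol positive_op_id chol_id_idem)

text \<open>The \<open>n\<close>-th remainder is self-adjoint, kills the earlier vector and fixes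
  the later one.\<close>

lemma gram_schmidt_orthogonal:
  assumes "m < n"
  shows "cinner (gram_schmidt v m) (gram_schmidt v n) = 0"
proof -
  let ?T = "chol (\<lambda>\<psi>. \<psi>) v"
  note T = positive_op_chol[OF positive_op_id, of v]
  have "?T n (gram_schmidt v m) = 0"
    by (rule chol_zero[OF positive_op_id, of _ "Suc m"])
      (use assms in \<open>auto simp: gram_schmidt_def chol_step_projection(4)[OF T chol_id_idem]\<close>)
  moreover have "?T n (gram_schmidt v n) = gram_schmidt v n"
    unfolding gram_schmidt_def by (rule chol_step_projection(1)[OF T chol_id_idem])
  ultimately show ?thesis
    using positive_op_selfadjoint[OF T, of n "gram_schmidt v m" "gram_schmidt v n"]
    by (simp add: cinner.zero_left)
qed

lemma chol_id_eq:
  "chol (\<lambda>\<psi>. \<psi>) v n \<psi> = \<psi> - (\<Sum>k<n. cinner \<psi> (gram_schmidt v k) *\<^sub>C gram_schmidt v k)"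
  by (simp add: chol_eq gram_schmidt_def)

text \<open>A vector orthogonal to all Gram--Schmidt vectors is fixed by every remainder, while the
  remainder \<open>Suc n\<close> kills \<open>v n\<close>; self-adjointness then makes it orthogonal
  to \<open>v n\<close>.\<close>

lemma gram_schmidt_total:
  assumes total: "\<forall>\<psi>. (\<forall>n. cinner \<psi> (v n) = 0) \<longrightarrow> \<psi> = 0"
    and z: "\<And>n. cinner \<psi> (gram_schmidt v n) = 0"
  shows "\<psi> = 0"
proof (rule total[rule_format])
  fix n
  have "chol (\<lambda>\<psi>. \<psi>) v (Suc n) \<psi> = \<psi>" unfolding chol_id_eq by (simp add: z scaleC.zero_left)
  then show "cinner \<psi> (v n) = 0"
    using positive_op_selfadjoint[OF positive_op_chol[OF positive_op_id], of v "Suc n" \<psi> "v n"]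
      chol_basis_zero[OF positive_op_id, of n "Suc n" v] by (simp add: cinner.zero_right del: chol.simps)
qed

text \<open>Any property closed under linear combinations survives orthonormalisation; it is used to
  carry continuity under translations from box indicators to a basis.\<close>

lemma gram_schmidt_in:
  assumes add: "\<And>a b. P a \<Longrightarrow> P b \<Longrightarrow> P (a + b)" and scale: "\<And>c a. P a \<Longrightarrow> P (c *\<^sub>C a)"
    and v: "\<And>n. P (v n)"
  shows "P (gram_schmidt v n)"
proof (induction n rule: less_induct)
  case (less n)
  have sum: "P (\<Sum>k<m. cinner (v n) (gram_schmidt v k) *\<^sub>C gram_schmidt v k)" if "m \<le> n" for m
    using that
  proof (induction m)
    case 0
    show ?case using scale[OF v[of n], of 0] by (simp add: scaleC.zero_left)
  qed (use less in \<open>auto intro!: add scale\<close>)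
  have "P (chol (\<lambda>\<psi>. \<psi>) v n (v n))"
    unfolding chol_id_eq
    using add[OF v[of n] scale[OF sum[OF order_refl], of "- 1"]] by (simp add: scaleC.minus_left)
  then show ?case unfolding gram_schmidt_def[of v n] chol_vec_def by (rule scale)
qed

text \<open>A dimension count by double summation: if all vectors from index \<open>N\<close> on
  vanished, \<open>Suc N\<close> orthonormal vectors would be expanded in \<open>N\<close> vectors
  of norm at most 1, and Parseval against Bessel would give \<open>Suc N \<le> N\<close>.\<close>

lemma infinite_gram_schmidt:
  fixes v b :: "nat \<Rightarrow> 'a::euclidean_space L2"
  assumes total: "\<forall>\<psi>. (\<forall>n. cinner \<psi> (v n) = 0) \<longrightarrow> \<psi> = 0" and b: "orthonormal b"
  shows "infinite {n. gram_schmidt v n \<noteq> 0}"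
proof
  assume "finite {n. gram_schmidt v n \<noteq> 0}"
  then obtain N where N: "\<And>n. n \<ge> N \<Longrightarrow> gram_schmidt v n = 0"
    unfolding finite_nat_iff_bounded by (auto simp: subset_iff not_less[symmetric])
  define T where "T = chol (\<lambda>\<psi>. \<psi>) v N"
  have T: "positive_op T" unfolding T_def by (rule positive_op_chol[OF positive_op_id])
  have "T (v k) = 0" for k
  proof (cases "k < N")
    case True
    then show ?thesis unfolding T_def by (rule chol_basis_zero[OF positive_op_id])
  next
    case False
    have "T (v k) = chol (\<lambda>\<psi>. \<psi>) v (Suc k) (v k)"
      unfolding T_def chol_id_eq using False N
      by (intro arg_cong2[of _ _ _ _ minus] refl sum.mono_neutral_left)
        (auto simp: scaleC.zero_right simp del: sum.lessThan_Suc)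
    then show ?thesis using chol_basis_zero[OF positive_op_id, of k "Suc k" v] by simp
  qed
  then have "T \<psi> = 0" for \<psi>
    using positive_op_selfadjoint[OF T, of \<psi>] by (intro total[rule_format]) (simp add: cinner.zero_right)
  then have exp: "\<psi> = (\<Sum>k<N. cinner \<psi> (gram_schmidt v k) *\<^sub>C gram_schmidt v k)" for \<psi>
    unfolding T_def chol_id_eq by simp
  have "(\<Sum>k<N. (cmod (cinner (gram_schmidt v k) (b j)))\<^sup>2) = 1" for j
  proof -
    have "of_real 1 = cinner (b j) (b j)" using b by (simp add: orthonormal_def)
    also have "\<dots> = (\<Sum>k<N. cinner (b j) (gram_schmidt v k) * cinner (gram_schmidt v k) (b j))"
      by (subst (1) exp[of "b j"]) (simp add: cinner.sum_left cinner_scaleC_left)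
    finally show ?thesis
      unfolding cinner_mult_cinner of_real_sum[symmetric] of_real_eq_iff
      by (simp add: norm_cinner_commute)
  qed
  then have "real (Suc N) = (\<Sum>j<Suc N. \<Sum>k<N. (cmod (cinner (gram_schmidt v k) (b j)))\<^sup>2)"
    by simp
  also have "\<dots> = (\<Sum>k<N. \<Sum>j<Suc N. (cmod (cinner (gram_schmidt v k) (b j)))\<^sup>2)"
    by (rule sum.swap)
  also have "\<dots> \<le> (\<Sum>k<N. (norm (gram_schmidt v k))\<^sup>2)"
    by (intro sum_mono bessel_finite b) simp
  also have "\<dots> \<le> (\<Sum>k<N. 1)"
  proof (intro sum_mono)
    fix k
    show "(norm (gram_schmidt v k))\<^sup>2 \<le> 1"
      using gram_schmidt_norm[of v k] by (auto simp: cinner_self_norm simp flip: of_real_power)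
  qed
  finally show False by simp
qed

text \<open>The sequence \<open>b\<close> witnesses infinite dimension, so that the nonzero
  Gram--Schmidt vectors can be enumerated by all of \<open>nat\<close>.\<close>

lemma ex_orthonormal_basis_in:
  fixes v b :: "nat \<Rightarrow> 'a::euclidean_space L2"
  assumes total: "\<forall>\<psi>. (\<forall>n. cinner \<psi> (v n) = 0) \<longrightarrow> \<psi> = 0" and b: "orthonormal b"
    and P: "\<And>a b. P a \<Longrightarrow> P b \<Longrightarrow> P (a + b)" "\<And>c a. P a \<Longrightarrow> P (c *\<^sub>C a)" "\<And>n. P (v n)"
  shows "\<exists>e. orthonormal_basis e \<and> (\<forall>n. P (e n))"
proof -
  let ?I = "{n. gram_schmidt v n \<noteq> 0}"
  note inf = infinite_gram_schmidt[OF total b]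
  define e where "e n = gram_schmidt v (enumerate ?I n)" for n
  have on: "orthonormal e"
    unfolding orthonormal_def
  proof (intro allI)
    fix m n
    have "cinner (e m) (e n) = 0" if "m < n" for m n
      unfolding e_def using enumerate_mono[OF that inf] by (rule gram_schmidt_orthogonal)
    moreover have "cinner (e m) (e m) = 1"
      using gram_schmidt_norm[of v "enumerate ?I m"] enumerate_in_set[OF inf, of m] by (simp add: e_def)
    ultimately show "cinner (e m) (e n) = (if m = n then 1 else 0)"
      using cinner_commute[of "e m" "e n"] by (cases rule: linorder_cases[of m n]) auto
  qed
  have "\<psi> = 0" if z: "\<forall>n. cinner \<psi> (e n) = 0" for \<psi>
  proof (rule gram_schmidt_total[OF total])
    fix n
    show "cinner \<psi> (gram_schmidt v n) = 0"
    proof (cases "n \<in> ?I")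
      case True
      then obtain k where "enumerate ?I k = n" using enumerate_Ex[OF inf True] by blast
      then show ?thesis using spec[OF z, of k] by (simp add: e_def)
    next
      case False
      then show ?thesis by (simp add: cinner.zero_right)
    qed
  qed
  then have "orthonormal_basis e" using on by (simp add: orthonormal_basis_def)
  moreover have "P (e n)" for n unfolding e_def by (rule gram_schmidt_in[where P = P]) (fact P)+
  ultimately show ?thesis by blast
qed

section \<open>Time-frequency shifts and parity\<close>

lemma cis_measurable [measurable]: "(\<lambda>t. cis (f t)) \<in> borel_measurable M"
  if "f \<in> borel_measurable M"
proof -
  have "cis \<in> borel_measurable borel" by (intro borel_measurable_continuous_onI continuous_intros)
  from measurable_compose[OF that this] show ?thesis .
qed

lemma square_integrable_tf_shift:
  assumes "square_integrable f"
  shows "square_integrable (\<lambda>t. cis (2 * pi * (w \<bullet> t)) * f (t - x))"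
  using L2_rel_shift[of f f w x] assms by simp

lemma square_integrable_parity:
  assumes "square_integrable f"
  shows "square_integrable (\<lambda>t. f (- t))"
  using L2_rel_parity[of f f] assms by simp

lemma tf_shift_abs:
  "square_integrable f \<Longrightarrow>
    tf_shift (x, w) (abs_L2 f) = abs_L2 (\<lambda>t. cis (2 * pi * (w \<bullet> t)) * f (t - x))"
  by (simp add: tf_shift.abs_eq)

lemma parity_abs: "square_integrable f \<Longrightarrow> parity (abs_L2 f) = abs_L2 (\<lambda>t. f (- t))"
  by (simp add: parity.abs_eq)

lemma tf_shift_add: "tf_shift z (a + b) = tf_shift z a + tf_shift z b"
proof (cases z, rule abs_L2_cases[of a], rule abs_L2_cases[of b])
  fix x w f g assume "z = (x, w)" "square_integrable f" "a = abs_L2 f" "square_integrable g" "b = abs_L2 g"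
  then show ?thesis
    by (simp add: tf_shift_abs plus_abs_L2 square_integrable_tf_shift square_integrable_add ring_distribs)
qed

lemma tf_shift_scaleC: "tf_shift z (c *\<^sub>C a) = c *\<^sub>C tf_shift z a"
proof (cases z, rule abs_L2_cases[of a])
  fix x w f assume "z = (x, w)" "square_integrable f" "a = abs_L2 f"
  then show ?thesis
    by (simp add: tf_shift_abs scaleC_abs_L2 square_integrable_tf_shift square_integrable_scale
        mult.left_commute)
qed

lemma integral_lborel_shift:
  fixes f :: "'a::euclidean_space \<Rightarrow> 'b::{banach, second_countable_topology}"
  assumes "f \<in> borel_measurable borel"
  shows "(LINT t|lborel. f (t - x)) = (LINT t|lborel. f t)"
  using integral_distr[of "\<lambda>t. t - x" lborel borel f] assms by (simp add: distr_lborel_shift)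

lemma integral_lborel_uminus:
  fixes f :: "'a::euclidean_space \<Rightarrow> 'b::{banach, second_countable_topology}"
  assumes "f \<in> borel_measurable borel"
  shows "(LINT t|lborel. f (- t)) = (LINT t|lborel. f t)"
  using integral_distr[of uminus lborel borel f] assms by (simp add: distr_lborel_uminus)

lemma cnj_measurable [measurable]: "(\<lambda>t. cnj (f t)) \<in> borel_measurable M"
  if "f \<in> borel_measurable M"
proof -
  have "cnj \<in> borel_measurable borel" by (intro borel_measurable_continuous_onI continuous_intros)
  from measurable_compose[OF that this] show ?thesis .
qed

lemma cinner_tf_shift: "cinner (tf_shift z a) (tf_shift z b) = cinner a b"
proof (cases z, rule abs_L2_cases[of a], rule abs_L2_cases[of b])
  fix x w f g
  assume z: "z = (x, w)" and f: "square_integrable f" "a = abs_L2 f" and g: "square_integrable g" "b = abs_L2 g"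
  note [measurable] = square_integrable_measurable[OF f(1)] square_integrable_measurable[OF g(1)]
  have "cinner (tf_shift z a) (tf_shift z b)
      = (LINT t|lborel. cis (2 * pi * (w \<bullet> t)) * f (t - x) * cnj (cis (2 * pi * (w \<bullet> t)) * g (t - x)))"
    using z f g by (simp add: tf_shift_abs cinner_abs_L2 square_integrable_tf_shift)
  also have "\<dots> = (LINT t|lborel. f (t - x) * cnj (g (t - x)))"
    by (intro Bochner_Integration.integral_cong refl) (simp add: cis_cnj cis_mult mult.left_commute flip: mult.assoc)
  also have "\<dots> = (LINT t|lborel. f t * cnj (g t))"
    using integral_lborel_shift[of "\<lambda>t. f t * cnj (g t)" x] by simp
  finally show ?thesis using f g by (simp add: cinner_abs_L2)
qed

lemma norm_tf_shift: "norm (tf_shift z a) = norm a"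
  using cinner_tf_shift[of z a a] by (simp add: norm_eq_sqrt_inner inner_L2_def)

lemma bounded_op_tf_shift: "bounded_op (tf_shift z)"
  unfolding bounded_op_def
  by (auto intro!: bounded_linear_intro[where K = 1]
      simp: tf_shift_add tf_shift_scaleC norm_tf_shift scaleR_L2_def)

lemma tf_shift_tf_shift_uminus:
  "tf_shift (- z) (tf_shift z \<psi>) = cis (2 * pi * (snd z \<bullet> fst z)) *\<^sub>C \<psi>"
proof (cases z, rule abs_L2_cases[of \<psi>])
  fix x w f assume "z = (x, w)" "square_integrable f" "\<psi> = abs_L2 f"
  then show ?thesis
    by (simp add: tf_shift_abs scaleC_abs_L2 square_integrable_tf_shift cis_mult
        inner_add_right ring_distribs flip: mult.assoc)
qed

text \<open>The phase undoes the commutation of translation and modulation in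
  \<open>tf_shift (- z) \<circ> tf_shift z\<close>; this gives the inverse of the unitary
  \<open>tf_shift z\<close> in closed form.\<close>

definition tf_adj :: "'a::euclidean_space \<times> 'a \<Rightarrow> 'a L2 \<Rightarrow> 'a L2" where
  "tf_adj z \<phi> = cis (- 2 * pi * (snd z \<bullet> fst z)) *\<^sub>C tf_shift (- z) \<phi>"

lemma cinner_tf_adj: "cinner (tf_shift z \<psi>) \<phi> = cinner \<psi> (tf_adj z \<phi>)"
proof -
  have "cinner (tf_shift z \<psi>) \<phi> = cinner (tf_shift (- z) (tf_shift z \<psi>)) (tf_shift (- z) \<phi>)"
    by (simp add: cinner_tf_shift)
  then show ?thesis
    by (simp add: tf_shift_tf_shift_uminus cinner_scaleC_left cinner_scaleC_right tf_adj_def cis_cnj)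
qed

lemma adjI:
  assumes "\<And>\<psi> \<phi>. cinner (A \<psi>) \<phi> = cinner \<psi> (B \<phi>)"
  shows "adj A = B"
  unfolding adj_def
proof (rule the_equality)
  fix C assume C: "\<forall>\<psi> \<phi>. cinner (A \<psi>) \<phi> = cinner \<psi> (C \<phi>)"
  show "C = B" by (intro ext cinner_ext_right) (metis C assms)
qed (use assms in blast)

lemma adj_tf_shift: "adj (tf_shift z) = tf_adj z"
  by (rule adjI) (rule cinner_tf_adj)

lemma norm_tf_adj: "norm (tf_adj z \<psi>) = norm \<psi>"
  by (simp add: tf_adj_def norm_scaleC norm_tf_shift)

lemma parity_parity: "parity (parity \<psi>) = \<psi>"
  by (rule abs_L2_cases[of \<psi>]) (simp add: parity_abs square_integrable_parity)

lemma parity_scaleC: "parity (c *\<^sub>C a) = c *\<^sub>C parity a"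
  by (rule abs_L2_cases[of a])
    (simp add: parity_abs scaleC_abs_L2 square_integrable_parity square_integrable_scale)

lemma cinner_parity: "cinner (parity a) (parity b) = cinner a b"
proof (rule abs_L2_cases[of a], rule abs_L2_cases[of b])
  fix f g
  assume f: "square_integrable f" "a = abs_L2 f" and g: "square_integrable g" "b = abs_L2 g"
  note [measurable] = square_integrable_measurable[OF f(1)] square_integrable_measurable[OF g(1)]
  show ?thesis
    using f g integral_lborel_uminus[of "\<lambda>t. f t * cnj (g t)"]
    by (simp add: parity_abs cinner_abs_L2 square_integrable_parity)
qed

lemma norm_parity: "norm (parity a) = norm a"
  using cinner_parity[of a a] by (simp add: norm_eq_sqrt_inner inner_L2_def)

lemma cinner_parity_left: "cinner (parity a) b = cinner a (parity b)"
  by (metis cinner_parity parity_parity)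

lemma parity_tf_shift_parity: "parity (tf_shift z (parity \<psi>)) = tf_shift (- z) \<psi>"
proof (cases z, rule abs_L2_cases[of \<psi>])
  fix x w f assume "z = (x, w)" "square_integrable f" "\<psi> = abs_L2 f"
  then show ?thesis
    using parity_abs[OF square_integrable_tf_shift[OF square_integrable_parity], of f w x]
    by (simp add: tf_shift_abs parity_abs square_integrable_parity add.commute)
qed

section \<open>A total sequence of box indicators\<close>

definition rat_points :: "'a::euclidean_space set" where
  "rat_points = {x. \<forall>i\<in>Basis. x \<bullet> i \<in> \<rat>}"

definition rat_boxes :: "'a::euclidean_space set set" where
  "rat_boxes = (\<lambda>(a, b). box a b) ` (rat_points \<times> rat_points)"

lemma countable_rat_points: "countable (rat_points :: 'a::euclidean_space set)"
proof (rule countable_subset)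
  show "rat_points \<subseteq> (\<lambda>f. \<Sum>i\<in>(Basis::'a set). f i *\<^sub>R i) ` (Basis \<rightarrow>\<^sub>E \<rat>)"
  proof
    fix x :: 'a assume "x \<in> rat_points"
    then have "restrict (\<lambda>i. x \<bullet> i) Basis \<in> Basis \<rightarrow>\<^sub>E \<rat>" by (auto simp: rat_points_def)
    moreover have "x = (\<Sum>i\<in>Basis. restrict (\<lambda>i. x \<bullet> i) Basis i *\<^sub>R i)"
      by (simp add: euclidean_representation)
    ultimately show "x \<in> (\<lambda>f. \<Sum>i\<in>(Basis::'a set). f i *\<^sub>R i) ` (Basis \<rightarrow>\<^sub>E \<rat>)" by blast
  qed
  show "countable ((\<lambda>f. \<Sum>i\<in>(Basis::'a set). f i *\<^sub>R i) ` (Basis \<rightarrow>\<^sub>E \<rat>))"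
    by (intro countable_image countable_PiE) (auto simp: countable_rat)
qed

lemma countable_rat_boxes: "countable rat_boxes"
  unfolding rat_boxes_def by (intro countable_image countable_SIGMA countable_rat_points)

lemma sum_Basis_rat_points:
  "(\<And>i. i \<in> Basis \<Longrightarrow> f i \<in> \<rat>) \<Longrightarrow> (\<Sum>i\<in>Basis. f i *\<^sub>R i) \<in> rat_points"
  by (simp add: rat_points_def)

lemma rat_boxes_Int:
  fixes A :: "'a::euclidean_space set"
  shows "A \<in> rat_boxes \<Longrightarrow> B \<in> rat_boxes \<Longrightarrow> A \<inter> B \<in> rat_boxes"
proof -
  assume "A \<in> rat_boxes" "B \<in> rat_boxes"
  then obtain a b c d :: 'a where ab: "A = box a b" "B = box c d"
    and r: "a \<in> rat_points" "b \<in> rat_points" "c \<in> rat_points" "d \<in> rat_points"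
    by (auto simp: rat_boxes_def)
  have "(\<Sum>i\<in>Basis. max (a \<bullet> i) (c \<bullet> i) *\<^sub>R i) \<in> rat_points"
    "(\<Sum>i\<in>Basis. min (b \<bullet> i) (d \<bullet> i) *\<^sub>R i) \<in> rat_points"
    using r by (auto intro!: sum_Basis_rat_points simp: rat_points_def max_def min_def)
  then show ?thesis unfolding ab box_Int_box rat_boxes_def by blast
qed

lemma borel_eq_rat_boxes: "borel = sigma UNIV (rat_boxes :: 'a::euclidean_space set set)"
  unfolding rat_boxes_def
proof (rule borel_eq_sigmaI1[OF borel_def])
  fix M :: "'a set" assume "M \<in> {S. open S}"
  then have "open M" by simp
  let ?S = "sigma UNIV ((\<lambda>(a::'a, b). box a b) ` (rat_points \<times> rat_points))"
  have "box (\<Sum>i\<in>Basis. fst (f i) *\<^sub>R i) (\<Sum>i\<in>Basis. snd (f i) *\<^sub>R i) \<in> sets ?S"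
    if "f \<in> Basis \<rightarrow>\<^sub>E \<rat> \<times> \<rat>" for f :: "'a \<Rightarrow> real \<times> real"
  proof -
    have "fst (f i) \<in> \<rat> \<and> snd (f i) \<in> \<rat>" if "i \<in> Basis" for i
      using PiE_mem[OF \<open>f \<in> _\<close> that] by (auto simp: mem_Times_iff)
    then show ?thesis by (auto intro!: sum_Basis_rat_points image_eqI[where x = "(_, _)"])
  qed
  then show "M \<in> sets ?S"
    by (subst open_UNION_box[OF \<open>open M\<close>])
      (safe intro!: sets.countable_UN' countable_PiE countable_Collect, auto intro: countable_rat)
qed (auto simp: box_def)

text \<open>Dynkin's theorem: the sets over which \<open>g\<close> integrates to 0 are closed under
  disjoint unions and, as the total integral vanishes, under complements.\<close>

lemma AE_zero_of_boxes:
  fixes g :: "'a::euclidean_space \<Rightarrow> real"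
  assumes g: "integrable lborel g" and UNIV: "(LINT x|lborel. g x) = 0"
    and box: "\<And>B. B \<in> rat_boxes \<Longrightarrow> (LINT x:B|lborel. g x) = 0"
  shows "AE x in lborel. g x = 0"
proof (rule density_unique_real[OF g])
  fix A :: "'a set"
  assume "A \<in> sets lborel"
  then have A: "A \<in> sigma_sets UNIV rat_boxes" by (simp add: borel_eq_rat_boxes)
  have si: "set_integrable lborel B g" if "B \<in> sigma_sets UNIV rat_boxes" for B
    using integrable_mult_indicator[of B lborel g] that g
    by (simp add: set_integrable_def borel_eq_rat_boxes)
  have "Int_stable (rat_boxes :: 'a set set)" by (simp add: Int_stable_def rat_boxes_Int)
  moreover have "rat_boxes \<subseteq> Pow (UNIV :: 'a set)" by simp
  ultimately have "(LINT x:A|lborel. g x) = 0" using A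
  proof (induction rule: sigma_sets_induct_disjoint)
    case (compl A)
    have "(LINT x:A \<union> (UNIV - A)|lborel. g x) = (LINT x:A|lborel. g x) + (LINT x:UNIV - A|lborel. g x)"
      using compl(1) by (intro set_integral_Un si sigma_sets.Compl) auto
    then show ?case using compl(2) UNIV by (simp add: set_lebesgue_integral_def)
  next
    case (union A)
    have "(LINT x:(\<Union>i. A i)|lborel. g x) = (\<Sum>i. (LINT x:(A i)|lborel. g x))"
      using union(1,2)
      by (intro lebesgue_integral_countable_add si sigma_sets.Union)
        (auto simp: disjoint_family_on_def borel_eq_rat_boxes)
    then show ?case using union by simp
  next
    case (basic A)
    then show ?case by (rule box)
  next
    case empty
    show ?case by (simp add: set_lebesgue_integral_def)
  qed
  then show "(LINT x:A|lborel. g x) = (LINT x:A|lborel. 0)" by simp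
qed simp

lemma square_integrable_indicator:
  "A \<in> sets borel \<Longrightarrow> emeasure lborel A < \<infinity> \<Longrightarrow> square_integrable (indicator A)"
proof (rule square_integrable_nnI)
  assume A: "A \<in> sets borel" "emeasure lborel A < \<infinity>"
  then show "indicator A \<in> borel_measurable lborel" by simp
  have "(\<integral>\<^sup>+ x. ennreal ((cmod (indicator A x))\<^sup>2) \<partial>lborel) = (\<integral>\<^sup>+ x. indicator A x \<partial>lborel)"
    by (intro nn_integral_cong) (simp split: split_indicator)
  then show "(\<integral>\<^sup>+ x. ennreal ((cmod (indicator A x))\<^sup>2) \<partial>lborel) < \<infinity>" using A by simp
qed

lemma square_integrable_box: "square_integrable (indicator (box a b))"
  by (intro square_integrable_indicator emeasure_lborel_box_finite) simp

lemma cnj_indicator: "cnj (indicator A x) = indicator A x"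
  by (simp split: split_indicator)

lemma rat_boxes_total:
  assumes z: "\<And>B. B \<in> rat_boxes \<Longrightarrow> cinner \<psi> (abs_L2 (indicator B)) = 0"
  shows "\<psi> = (0 :: 'a::euclidean_space L2)"
proof (rule abs_L2_cases[of \<psi>])
  fix f assume f: "square_integrable f" "\<psi> = abs_L2 f"
  note [measurable] = square_integrable_measurable[OF f(1)]
  have sq: "square_integrable (indicator B :: 'a \<Rightarrow> complex)" if "B \<in> rat_boxes" for B
    using that by (auto simp: rat_boxes_def square_integrable_box)
  have int: "integrable lborel (\<lambda>x. f x * indicator B x)" if "B \<in> rat_boxes" for B
    using integrable_square_integrable_mult[OF f(1) sq[OF that]]
    by (simp add: cnj_indicator)
  have zero: "(LINT x|lborel. f x * indicator B x) = 0" if "B \<in> rat_boxes" for B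
    using z[OF that] f sq[OF that]
    by (simp add: cinner_abs_L2 cnj_indicator)
  \<comment> \<open>A square integrable \<open>f\<close> need not be integrable on the whole space,
    so it is cut off by a box \<open>Q\<close>; testing the cut-off function on \<open>B\<close>
    amounts to testing \<open>f\<close> on the rational box \<open>Q \<inter> B\<close>.\<close>
  have ae: "AE x in lborel. x \<in> Q \<longrightarrow> f x = 0" if Q: "Q \<in> rat_boxes" for Q
  proof -
    have aux: "AE x in lborel. h (f x * indicator Q x) = 0"
      if h: "bounded_linear h" for h :: "complex \<Rightarrow> real"
    proof (rule AE_zero_of_boxes)
      show "integrable lborel (\<lambda>x. h (f x * indicator Q x))"
        by (rule integrable_bounded_linear[OF h int[OF Q]])
      show "(LINT x|lborel. h (f x * indicator Q x)) = 0"
        using integral_bounded_linear[OF h int[OF Q]] zero[OF Q] linear_simps(3)[OF h] by simp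
      fix B :: "'a set" assume "B \<in> rat_boxes"
      then have BQ: "Q \<inter> B \<in> rat_boxes" using Q by (simp add: rat_boxes_Int)
      have "(LINT x:B|lborel. h (f x * indicator Q x)) = (LINT x|lborel. h (f x * indicator (Q \<inter> B) x))"
        unfolding set_lebesgue_integral_def
        using linear_simps(3)[OF h]
        by (intro Bochner_Integration.integral_cong refl) (simp split: split_indicator)
      then show "(LINT x:B|lborel. h (f x * indicator Q x)) = 0"
        using integral_bounded_linear[OF h int[OF BQ]] zero[OF BQ] linear_simps(3)[OF h] by simp
    qed
    from aux[OF bounded_linear_Re] aux[OF bounded_linear_Im] show ?thesis
      by eventually_elim (auto simp: complex_eq_iff split: split_indicator_asm)
  qed
  define Q :: "nat \<Rightarrow> 'a set" where "Q n = box (- real n *\<^sub>R One) (real n *\<^sub>R One)" for n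
  have "Q n \<in> rat_boxes" for n
    unfolding Q_def rat_boxes_def
    by (intro image_eqI[where x = "(_, _)"]) (auto simp: rat_points_def)
  then have "AE x in lborel. \<forall>n. x \<in> Q n \<longrightarrow> f x = 0"
    unfolding AE_all_countable using ae by blast
  moreover have "\<exists>n. x \<in> Q n" for x
    using UN_box_eq_UNIV[where 'a = 'a] by (simp add: set_eq_iff Q_def)
  ultimately have "AE x in lborel. f x = 0" by auto
  then have "L2_rel f (\<lambda>_. 0)" using f by (simp add: L2_rel_def)
  then show "\<psi> = 0" unfolding f zero_L2_def
    by (rule Quotient3_rel_abs[OF Quotient3_L2])
qed

lemma cinner_indicator:
  assumes "square_integrable (indicator A)" "square_integrable (indicator B)"
    "A \<in> sets borel" "B \<in> sets borel"
  shows "cinner (abs_L2 (indicator A)) (abs_L2 (indicator B)) = of_real (measure lborel (A \<inter> B))"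
proof -
  have "cinner (abs_L2 (indicator A)) (abs_L2 (indicator B))
      = (LINT x|lborel. complex_of_real (indicator (A \<inter> B) x))"
    unfolding cinner_abs_L2[OF assms(1,2)]
    by (intro Bochner_Integration.integral_cong refl) (simp split: split_indicator)
  then show ?thesis using assms(3,4) by simp
qed

text \<open>Disjoint cubes along the diagonal: an explicit infinite orthonormal sequence for the
  dimension count.\<close>

definition unit_cube :: "nat \<Rightarrow> 'a::euclidean_space set" where
  "unit_cube j = box (real j *\<^sub>R One) (real (Suc j) *\<^sub>R One)"

lemma orthonormal_cubes: "orthonormal (\<lambda>j. abs_L2 (indicator (unit_cube j :: 'a::euclidean_space set)))"
  unfolding orthonormal_def
proof (intro allI)
  fix j k
  have m: "measure lborel (unit_cube j :: 'a set) = 1" for j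
    by (simp add: unit_cube_def measure_lborel_box_eq algebra_simps)
  have d: "unit_cube j \<inter> unit_cube k = ({} :: 'a set)" if jk: "j < k" for j k
  proof -
    obtain i :: 'a where i: "i \<in> Basis" using nonempty_Basis by blast
    have "False" if "x \<in> unit_cube j" "x \<in> unit_cube k" for x :: 'a
    proof -
      have "x \<bullet> i < real (Suc j)" "real k < x \<bullet> i"
        using that i by (auto simp: unit_cube_def mem_box)
      then show False using jk by simp
    qed
    then show ?thesis by blast
  qed
  show "cinner (abs_L2 (indicator (unit_cube j))) (abs_L2 (indicator (unit_cube k :: 'a set)))
      = (if j = k then 1 else 0)"
  proof -
    have "square_integrable (indicator (unit_cube j :: 'a set))" "unit_cube j \<in> sets (borel :: 'a measure)" for j
      by (simp_all add: unit_cube_def square_integrable_box)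
    then show ?thesis
      using m[of j] d[of j k] d[of k j]
      by (cases rule: linorder_cases[of j k]) (simp_all add: cinner_indicator Int_commute)
  qed
qed

section \<open>Continuity of translations\<close>

text \<open>Strong continuity of translations at 0, stated vector by vector so that it can spread
  from box indicators by linearity and norm limits.\<close>

definition translation_continuous :: "'a::euclidean_space L2 \<Rightarrow> bool" where
  "translation_continuous \<psi> \<longleftrightarrow>
    (\<forall>u. u \<longlonglongrightarrow> 0 \<longrightarrow> (\<lambda>n. tf_shift (u n, 0) \<psi>) \<longlonglongrightarrow> \<psi>)"

text \<open>Dominated convergence: off the boundary of the box, a null set, the shifted indicator is
  eventually equal to the original one, and boundedness of \<open>u\<close> keeps all supports in
  one ball.\<close>

lemma translation_continuous_box: "translation_continuous (abs_L2 (indicator (box a b)))"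
  unfolding translation_continuous_def
proof (intro allI impI)
  fix u :: "nat \<Rightarrow> 'a" assume u: "u \<longlonglongrightarrow> 0"
  let ?f = "indicator (box a b) :: 'a \<Rightarrow> complex"
  obtain K where K: "\<And>x. x \<in> box a b \<Longrightarrow> norm x \<le> K"
    using bounded_box bounded_iff by metis
  obtain M where M: "\<And>n. norm (u n) \<le> M"
    using convergent_imp_bounded[OF u] by (auto simp: bounded_iff)
  have M0: "0 \<le> M" using M[of 0] norm_ge_zero order_trans by blast
  have [measurable]: "(\<lambda>x. ?f (x - y)) \<in> borel_measurable borel" for y by measurable
  have sq: "square_integrable (\<lambda>t. ?f (t - x))" for x
    using square_integrable_tf_shift[OF square_integrable_box, of 0 a b x] by simp
  have "(norm (tf_shift (u n, 0) (abs_L2 ?f) - abs_L2 ?f))\<^sup>2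
      = (LINT x|lborel. (cmod (?f (x - u n) - ?f x))\<^sup>2)" for n
    using norm_abs_L2[OF square_integrable_diff[OF sq square_integrable_box]]
    by (simp add: tf_shift_abs square_integrable_box sq minus_abs_L2)
  moreover have "(\<lambda>n. LINT x|lborel. (cmod (?f (x - u n) - ?f x))\<^sup>2) \<longlonglongrightarrow> (LINT x|(lborel :: 'a measure). 0 :: real)"
  proof (rule integral_dominated_convergence[where M = lborel and f = "\<lambda>_. 0"
        and s = "\<lambda>n x. (cmod (?f (x - u n) - ?f x))\<^sup>2"
        and w = "\<lambda>x. indicator (cball 0 (K + M)) x"])
    show "integrable lborel (\<lambda>x. indicator (cball (0::'a) (K + M)) x :: real)"
      by (rule integrable_real_indicator[OF _ emeasure_lborel_cball_finite]) simp
    show "AE x in lborel. norm ((cmod (?f (x - u n) - ?f x))\<^sup>2) \<le> indicator (cball 0 (K + M)) x" for n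
    proof (intro AE_I2)
      fix x
      have "x - u n \<in> box a b \<Longrightarrow> norm x \<le> K + M"
        using K[of "x - u n"] M[of n] norm_triangle_sub[of x "u n"] by linarith
      moreover have "x \<in> box a b \<Longrightarrow> norm x \<le> K + M" using K[of x] M0 by linarith
      ultimately show "norm ((cmod (?f (x - u n) - ?f x))\<^sup>2) \<le> indicator (cball 0 (K + M)) x"
        by (auto split: split_indicator)
    qed
    have "AE x in lborel. x \<notin> cbox a b - box a b" by (intro AE_not_in null_sets_cbox_Diff_box)
    then show "AE x in lborel. (\<lambda>n. (cmod (?f (x - u n) - ?f x))\<^sup>2) \<longlonglongrightarrow> 0"
    proof eventually_elim
      case (elim x)
      have lim: "(\<lambda>n. x - u n) \<longlonglongrightarrow> x" using tendsto_diff[OF tendsto_const[of x] u] by simp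
      from elim have "x \<in> box a b \<or> x \<in> - cbox a b" by blast
      then have "eventually (\<lambda>n. ?f (x - u n) = ?f x) sequentially"
      proof
        assume x: "x \<in> box a b"
        have "eventually (\<lambda>n. x - u n \<in> box a b) sequentially"
          by (rule topological_tendstoD[OF lim open_box x])
        then show ?thesis by eventually_elim (use x in simp)
      next
        assume x: "x \<in> - cbox a b"
        have "eventually (\<lambda>n. x - u n \<in> - cbox a b) sequentially"
          by (rule topological_tendstoD[OF lim _ x]) (simp add: open_Compl closed_cbox)
        then show ?thesis
          by eventually_elim (use x box_subset_cbox[of a b] in \<open>auto split: split_indicator\<close>)
      qed
      then have "eventually (\<lambda>n. (cmod (?f (x - u n) - ?f x))\<^sup>2 = 0) sequentially"
        by eventually_elim simp
      then show ?case by (rule tendsto_eventually)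
    qed
  qed measurable
  ultimately have "(\<lambda>n. (norm (tf_shift (u n, 0) (abs_L2 ?f) - abs_L2 ?f))\<^sup>2) \<longlonglongrightarrow> 0" by simp
  from tendsto_real_sqrt[OF this]
  show "(\<lambda>n. tf_shift (u n, 0) (abs_L2 ?f)) \<longlonglongrightarrow> abs_L2 ?f"
    by (simp add: tendsto_norm_zero_iff LIM_zero_iff)
qed

lemma ex_orthonormal_basis_translation:
  "\<exists>e :: nat \<Rightarrow> 'a::euclidean_space L2. orthonormal_basis e \<and> (\<forall>n. translation_continuous (e n))"
proof (rule ex_orthonormal_basis_in[OF _ orthonormal_cubes])
  let ?v = "\<lambda>n. abs_L2 (indicator (from_nat_into (rat_boxes :: 'a set set) n))"
  have ne: "(rat_boxes :: 'a set set) \<noteq> {}"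
  proof -
    have "(0::'a) \<in> rat_points" by (simp add: rat_points_def)
    then show ?thesis by (auto simp: rat_boxes_def)
  qed
  show "\<forall>\<psi>. (\<forall>n. cinner \<psi> (?v n) = 0) \<longrightarrow> \<psi> = 0"
  proof (intro allI impI rat_boxes_total)
    fix \<psi> and B :: "'a set"
    assume "\<forall>n. cinner \<psi> (?v n) = 0" "B \<in> rat_boxes"
    then show "cinner \<psi> (abs_L2 (indicator B)) = 0"
      using from_nat_into_surj[OF countable_rat_boxes, of B] by auto
  qed
  show "translation_continuous (?v n)" for n
    using from_nat_into[OF ne, of n] translation_continuous_box by (auto simp: rat_boxes_def)
  show "translation_continuous (\<psi> + \<phi>)"
    if "translation_continuous \<psi>" "translation_continuous \<phi>" for \<psi> \<phi> :: "'a L2"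
    using that unfolding translation_continuous_def tf_shift_add by (auto intro!: tendsto_add)
  show "translation_continuous (c *\<^sub>C \<psi>)" if "translation_continuous \<psi>" for c and \<psi> :: "'a L2"
    using that unfolding translation_continuous_def tf_shift_scaleC
    by (auto intro!: scaleC.tendsto tendsto_const)
qed

text \<open>Existence makes the choice in \<open>some_basis\<close> meaningful, so that
  \<open>tr\<close> may be expanded by Parseval.\<close>

lemma orthonormal_basis_some_basis: "orthonormal_basis some_basis"
proof -
  obtain e :: "nat \<Rightarrow> 'a::euclidean_space L2" where "orthonormal_basis e"
    using ex_orthonormal_basis_translation by blast
  then show "orthonormal_basis (some_basis :: nat \<Rightarrow> 'a L2)"
    unfolding some_basis_def by (rule someI[of orthonormal_basis])
qed

lemma translation_continuous_closed:
  assumes "\<And>N. translation_continuous (s N)" "s \<longlonglongrightarrow> \<psi>"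
  shows "translation_continuous \<psi>"
  unfolding translation_continuous_def
proof (intro allI impI LIMSEQ_I)
  fix u :: "nat \<Rightarrow> 'a" and \<epsilon> :: real assume u: "u \<longlonglongrightarrow> 0" and "0 < \<epsilon>"
  then obtain N where N: "norm (s N - \<psi>) < \<epsilon> / 3"
    using LIMSEQ_D[OF assms(2), of "\<epsilon> / 3"] by auto
  obtain n0 where n0: "\<And>n. n \<ge> n0 \<Longrightarrow> norm (tf_shift (u n, 0) (s N) - s N) < \<epsilon> / 3"
    using LIMSEQ_D[of "\<lambda>n. tf_shift (u n, 0) (s N)" "s N" "\<epsilon> / 3"] assms(1)[of N] u \<open>0 < \<epsilon>\<close>
    unfolding translation_continuous_def by auto
  have "norm (tf_shift (u n, 0) \<psi> - \<psi>) < \<epsilon>" if "n \<ge> n0" for n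
  proof -
    note lin = bounded_opD[OF bounded_op_tf_shift[of "(u n, 0)"]]
    have "tf_shift (u n, 0) \<psi> - \<psi> = tf_shift (u n, 0) (\<psi> - s N)
        + (tf_shift (u n, 0) (s N) - s N) + (s N - \<psi>)" by (simp add: lin)
    also have "norm \<dots> \<le> norm (tf_shift (u n, 0) (\<psi> - s N))
        + norm (tf_shift (u n, 0) (s N) - s N) + norm (s N - \<psi>)"
      by (intro norm_triangle_le add_right_mono norm_triangle_ineq)
    also have "\<dots> < \<epsilon> / 3 + \<epsilon> / 3 + \<epsilon> / 3"
      using N n0[OF that] by (simp add: norm_tf_shift norm_minus_commute)
    finally show ?thesis by simp
  qed
  then show "\<exists>n0. \<forall>n\<ge>n0. norm (tf_shift (u n, 0) \<psi> - \<psi>) < \<epsilon>" by blast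
qed

lemma translation_continuous: "translation_continuous (\<psi> :: 'a::euclidean_space L2)"
proof -
  obtain e :: "nat \<Rightarrow> 'a L2" where e: "orthonormal_basis e" "\<And>n. translation_continuous (e n)"
    using ex_orthonormal_basis_translation by blast
  have "translation_continuous (\<Sum>n<N. cinner \<psi> (e n) *\<^sub>C e n)" for N
  proof (induction N)
    case 0
    then show ?case by (simp add: translation_continuous_def bounded_opD(5)[OF bounded_op_tf_shift])
  next
    case (Suc N)
    then show ?case using e(2)[of N]
      unfolding translation_continuous_def sum.lessThan_Suc tf_shift_add tf_shift_scaleC
      by (auto intro!: tendsto_add scaleC.tendsto tendsto_const)
  qed
  then show ?thesis
    by (rule translation_continuous_closed) (use orthonormal_basis_sums[OF e(1)] in \<open>simp add: sums_def\<close>)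
qed

section \<open>Moyal's identity\<close>

lemma integral_lborel_scale:
  fixes f :: "'a::euclidean_space \<Rightarrow> 'b::{banach, second_countable_topology}"
  assumes c: "c \<noteq> 0" and [measurable]: "f \<in> borel_measurable borel"
  shows "(LINT x|lborel. f x) = \<bar>c\<bar> ^ DIM('a) *\<^sub>R (LINT x|lborel. f (c *\<^sub>R x))"
proof -
  have "(LINT x|lborel. f x)
      = (LINT x|density (distr lborel borel (\<lambda>x. 0 + c *\<^sub>R x)) (\<lambda>_. ennreal (\<bar>c\<bar> ^ DIM('a))). f x)"
    using lborel_affine[OF c, of "0::'a"] by (simp add: ennreal_power)
  also have "\<dots> = (LINT x|distr lborel borel (\<lambda>x. 0 + c *\<^sub>R x). \<bar>c\<bar> ^ DIM('a) *\<^sub>R f x)"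
    by (rule integral_density) auto
  also have "\<dots> = (LINT x|lborel. \<bar>c\<bar> ^ DIM('a) *\<^sub>R f (c *\<^sub>R x))"
    by (subst integral_distr) auto
  finally show ?thesis by simp
qed

text \<open>The frequency cutoff for Moyal's identity; with this scaling it is its own Fourier
  transform up to a constant.\<close>

definition gauss :: "'a::euclidean_space \<Rightarrow> real" where
  "gauss y = exp (- (norm y)\<^sup>2 / 2)"

lemma gauss_measurable [measurable]: "gauss \<in> borel_measurable borel"
  unfolding gauss_def by measurable

lemma gauss_nonneg [simp]: "0 \<le> gauss y" by (simp add: gauss_def)

lemma gauss_fourier_1:
  fixes t :: real
  shows "integrable lborel (\<lambda>x::real. complex_of_real (exp (- x\<^sup>2 / 2)) * cis (t * x))"
    and "(LINT x|lborel. complex_of_real (exp (- x\<^sup>2 / 2)) * cis (t * x))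
      = of_real (sqrt (2 * pi) * exp (- t\<^sup>2 / 2))"
proof -
  have eq: "complex_of_real (std_normal_density x) * cis (t * x)
      = of_real (1 / sqrt (2 * pi)) * (complex_of_real (exp (- x\<^sup>2 / 2)) * cis (t * x))" for x
    by (simp add: std_normal_density_def)
  have "of_real (exp (- t\<^sup>2 / 2)) = (LINT x|std_normal_distribution. cis (t * x))"
    using fun_cong[OF char_std_normal_distribution, of t] by (simp add: char_def cis_conv_exp)
  also have "\<dots> = (LINT x|lborel. complex_of_real (std_normal_density x) * cis (t * x))"
    by (subst integral_density) (auto simp: scaleR_conv_of_real)
  also have "\<dots> = of_real (1 / sqrt (2 * pi)) * (LINT x|lborel. complex_of_real (exp (- x\<^sup>2 / 2)) * cis (t * x))"
    unfolding eq by simp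
  finally show 2: "(LINT x|lborel. complex_of_real (exp (- x\<^sup>2 / 2)) * cis (t * x))
      = of_real (sqrt (2 * pi) * exp (- t\<^sup>2 / 2))"
    by (simp add: field_simps)
  \<comment> \<open>The Bochner integral of a non-integrable function is 0, so the nonzero value
    just found certifies integrability. The same device recurs for \<open>gauss\<close>
    below.\<close>
  then show "integrable lborel (\<lambda>x::real. complex_of_real (exp (- x\<^sup>2 / 2)) * cis (t * x))"
    using not_integrable_integral_eq[of lborel "\<lambda>x::real. complex_of_real (exp (- x\<^sup>2 / 2)) * cis (t * x)"]
    by (fastforce simp del: of_real_mult of_real_exp)
qed

interpretation lborel_product: product_sigma_finite "\<lambda>_::'a::euclidean_space. lborel::real measure"
  by unfold_locales

text \<open>Both factors split over the coordinates, which reduces the claim to the characteristic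
  function of the standard normal distribution.\<close>

lemma gauss_fourier:
  fixes y :: "'a::euclidean_space"
  shows "(LINT v|lborel. complex_of_real (gauss v) * cis (y \<bullet> v))
    = of_real (sqrt (2 * pi) ^ DIM('a) * gauss y)"
proof -
  have g: "gauss v = (\<Prod>b\<in>Basis. exp (- (v \<bullet> b)\<^sup>2 / 2))" for v :: 'a
    unfolding gauss_def power2_norm_eq_inner euclidean_inner[of v v]
    by (simp add: exp_sum[symmetric] sum_negf sum_divide_distrib power2_eq_square)
  have c: "cis (y \<bullet> v) = (\<Prod>b\<in>Basis. cis ((y \<bullet> b) * (v \<bullet> b)))" for v :: 'a
    unfolding euclidean_inner[of y v] cis_conv_exp by (simp add: exp_sum[symmetric] sum_distrib_left)
  let ?h = "\<lambda>b r. complex_of_real (exp (- r\<^sup>2 / 2)) * cis ((y \<bullet> b) * r)"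
  have "(LINT v|lborel. complex_of_real (gauss v) * cis (y \<bullet> v))
      = (LINT v|distr (\<Pi>\<^sub>M b\<in>Basis. lborel) borel (\<lambda>f. \<Sum>b\<in>Basis. f b *\<^sub>R b).
          (\<Prod>b\<in>Basis. ?h b (v \<bullet> b)))"
    unfolding g c of_real_prod prod.distrib[symmetric] by (subst lborel_eq) (rule refl)
  also have "\<dots> = (LINT f|(\<Pi>\<^sub>M b\<in>(Basis::'a set). lborel). (\<Prod>b\<in>Basis. ?h b (f b)))"
    by (subst integral_distr) (auto intro!: Bochner_Integration.integral_cong prod.cong)
  also have "\<dots> = (\<Prod>b\<in>Basis. (LINT r|lborel. ?h b r))"
    by (rule lborel_product.product_integral_prod) (rule finite_Basis, rule gauss_fourier_1)
  also have "\<dots> = of_real (\<Prod>b\<in>Basis. (sqrt (2 * pi) * exp (- (y \<bullet> b)\<^sup>2 / 2)))"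
    unfolding gauss_fourier_1 of_real_prod ..
  also have "(\<Prod>b\<in>Basis. (sqrt (2 * pi) * exp (- (y \<bullet> b)\<^sup>2 / 2))) = sqrt (2 * pi) ^ DIM('a) * gauss y"
    unfolding g prod.distrib by simp
  finally show ?thesis .
qed

lemma integral_gauss: "(LINT v|lborel. gauss (v::'a::euclidean_space)) = sqrt (2 * pi) ^ DIM('a)"
proof -
  have "complex_of_real (LINT v|lborel. gauss (v::'a)) = of_real (sqrt (2 * pi) ^ DIM('a))"
    using gauss_fourier[of "0::'a"] by (simp add: gauss_def)
  then show ?thesis using of_real_eq_iff by blast
qed

lemma integrable_gauss: "integrable lborel (gauss :: 'a::euclidean_space \<Rightarrow> real)"
proof (rule ccontr)
  assume "\<not> integrable lborel (gauss :: 'a \<Rightarrow> real)"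
  then have "(LINT v|lborel. gauss (v::'a)) = 0" by (rule not_integrable_integral_eq)
  then show False by (simp add: integral_gauss)
qed

lemma integrable_gauss_scale:
  assumes "c \<noteq> 0"
  shows "integrable lborel (\<lambda>y::'a::euclidean_space. gauss (c *\<^sub>R y))"
proof (rule ccontr)
  assume "\<not> integrable lborel (\<lambda>y::'a. gauss (c *\<^sub>R y))"
  then have "(LINT v|lborel. gauss (c *\<^sub>R (v::'a))) = 0" by (rule not_integrable_integral_eq)
  then show False using integral_lborel_scale[of c "gauss :: 'a \<Rightarrow> real"] assms by (simp add: integral_gauss)
qed

text \<open>A cutoff of width of order \<open>1 / \<epsilon>\<close> in frequency becomes a bump of
  width \<open>\<epsilon>\<close> in the dual variable.\<close>

lemma gauss_fourier_scale:
  fixes u :: "'a::euclidean_space"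
  assumes \<epsilon>: "\<epsilon> > 0"
  shows "(LINT v|lborel. complex_of_real (gauss ((2 * pi * \<epsilon>) *\<^sub>R v)) * cnj (cis (2 * pi * (v \<bullet> u))))
    = of_real ((sqrt (2 * pi) / (2 * pi * \<epsilon>)) ^ DIM('a) * gauss (u /\<^sub>R \<epsilon>))"
proof -
  have eq: "2 * pi * \<epsilon> * (inverse \<epsilon> * c) = 2 * pi * c" for c using \<epsilon> by simp
  have "of_real (sqrt (2 * pi) ^ DIM('a) * gauss (- u /\<^sub>R \<epsilon>))
      = (LINT v|lborel. complex_of_real (gauss (v::'a)) * cis ((- u /\<^sub>R \<epsilon>) \<bullet> v))"
    by (rule gauss_fourier[symmetric])
  also have "\<dots> = (2 * pi * \<epsilon>) ^ DIM('a) *\<^sub>R (LINT v|lborel. complex_of_real (gauss ((2 * pi * \<epsilon>) *\<^sub>R v))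
      * cnj (cis (2 * pi * (v \<bullet> u))))"
    using \<epsilon> by (subst integral_lborel_scale[of "2 * pi * \<epsilon>"])
      (auto simp: cis_cnj inner_commute eq)
  finally show ?thesis using \<epsilon>
    by (simp add: gauss_def scaleR_conv_of_real field_simps)
qed

section \<open>Translation invariance and convolution integrals\<close>

lemma nn_integral_lborel_shift:
  fixes f :: "'a::euclidean_space \<Rightarrow> ennreal"
  assumes "f \<in> borel_measurable borel"
  shows "(\<integral>\<^sup>+t. f (t - x) \<partial>lborel) = (\<integral>\<^sup>+t. f t \<partial>lborel)"
  using nn_integral_distr[of "\<lambda>t. t - x" lborel borel f] assms by (simp add: distr_lborel_shift)

lemma nn_integral_lborel_uminus:
  fixes f :: "'a::euclidean_space \<Rightarrow> ennreal"
  assumes "f \<in> borel_measurable borel"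
  shows "(\<integral>\<^sup>+t. f (- t) \<partial>lborel) = (\<integral>\<^sup>+t. f t \<partial>lborel)"
  using nn_integral_distr[of uminus lborel borel f] assms by (simp add: distr_lborel_uminus)

lemma nn_integral_lborel_reflect:
  fixes f :: "'a::euclidean_space \<Rightarrow> ennreal"
  assumes [measurable]: "f \<in> borel_measurable borel"
  shows "(\<integral>\<^sup>+t. f (x - t) \<partial>lborel) = (\<integral>\<^sup>+t. f t \<partial>lborel)"
  using nn_integral_lborel_shift[of "\<lambda>t. f (- t)" x] nn_integral_lborel_uminus[of f] by simp

lemma integral_lborel_reflect:
  fixes f :: "'a::euclidean_space \<Rightarrow> 'b::{banach, second_countable_topology}"
  assumes [measurable]: "f \<in> borel_measurable borel"
  shows "(LINT t|lborel. f (x - t)) = (LINT t|lborel. f t)"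
  using integral_lborel_shift[of "\<lambda>t. f (- t)" x] integral_lborel_uminus[of f] by simp

lemma nn_integral_convolution:
  fixes p q :: "'a::euclidean_space \<Rightarrow> ennreal"
  assumes [measurable]: "p \<in> borel_measurable borel" "q \<in> borel_measurable borel"
  shows "(\<integral>\<^sup>+x. \<integral>\<^sup>+s. p s * q (s - x) \<partial>lborel \<partial>lborel) = (\<integral>\<^sup>+s. p s \<partial>lborel) * (\<integral>\<^sup>+s. q s \<partial>lborel)"
proof -
  have "(\<integral>\<^sup>+x. \<integral>\<^sup>+s. p s * q (s - x) \<partial>lborel \<partial>lborel) = (\<integral>\<^sup>+s. \<integral>\<^sup>+x. p s * q (s - x) \<partial>lborel \<partial>lborel)"
    by (intro lborel_pair.Fubini') measurable
  also have "\<dots> = (\<integral>\<^sup>+s. p s * (\<integral>\<^sup>+x. q x \<partial>lborel) \<partial>lborel)"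
    by (intro nn_integral_cong) (simp add: nn_integral_cmult nn_integral_lborel_reflect)
  finally show ?thesis by (simp add: nn_integral_multc)
qed

lemma integrable_convolution:
  fixes p q :: "'a::euclidean_space \<Rightarrow> complex"
  assumes p: "integrable lborel p" and q: "integrable lborel q"
  shows "integrable (lborel \<Otimes>\<^sub>M lborel) (\<lambda>(s, x). p s * q (s - x))"
proof (rule integrableI_bounded)
  have [measurable]: "p \<in> borel_measurable borel" "q \<in> borel_measurable borel" using p q by auto
  show "(\<lambda>(s, x). p s * q (s - x)) \<in> borel_measurable (lborel \<Otimes>\<^sub>M lborel)" by measurable
  have "(\<integral>\<^sup>+z. ennreal (norm (case z of (s, x) \<Rightarrow> p s * q (s - x))) \<partial>(lborel \<Otimes>\<^sub>M lborel))
      = (\<integral>\<^sup>+x. \<integral>\<^sup>+s. ennreal (cmod (p s)) * ennreal (cmod (q (s - x))) \<partial>lborel \<partial>lborel)"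
    by (subst lborel_pair.nn_integral_snd[symmetric]) (auto simp: norm_mult ennreal_mult)
  also have "\<dots> = (\<integral>\<^sup>+s. ennreal (cmod (p s)) \<partial>lborel) * (\<integral>\<^sup>+s. ennreal (cmod (q s)) \<partial>lborel)"
    by (rule nn_integral_convolution) auto
  also have "\<dots> < \<infinity>"
    using p q by (auto simp: integrable_iff_bounded ennreal_mult_less_top)
  finally show "(\<integral>\<^sup>+z. ennreal (norm (case z of (s, x) \<Rightarrow> p s * q (s - x))) \<partial>(lborel \<Otimes>\<^sub>M lborel)) < \<infinity>" .
qed

lemma integral_convolution:
  fixes p q :: "'a::euclidean_space \<Rightarrow> complex"
  assumes p: "integrable lborel p" and q: "integrable lborel q"
  shows "(LINT x|lborel. LINT s|lborel. p s * q (s - x)) = (LINT s|lborel. p s) * (LINT s|lborel. q s)"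
proof -
  have [measurable]: "p \<in> borel_measurable borel" "q \<in> borel_measurable borel" using p q by auto
  have "(LINT x|lborel. LINT s|lborel. p s * q (s - x)) = (LINT s|lborel. LINT x|lborel. p s * q (s - x))"
    by (rule lborel_pair.Fubini_integral) (rule integrable_convolution[OF p q])
  then show ?thesis by (simp add: integral_lborel_reflect)
qed

lemma integrable_pair_mult:
  fixes p q :: "'a::euclidean_space \<Rightarrow> complex"
  assumes p: "integrable lborel p" and q: "integrable lborel q"
  shows "integrable (lborel \<Otimes>\<^sub>M lborel) (\<lambda>(s, x). p s * q x)"
proof (rule integrableI_bounded)
  have [measurable]: "p \<in> borel_measurable borel" "q \<in> borel_measurable borel" using p q by auto
  show "(\<lambda>(s, x). p s * q x) \<in> borel_measurable (lborel \<Otimes>\<^sub>M lborel)" by measurable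
  have "(\<integral>\<^sup>+z. ennreal (norm (case z of (s, x) \<Rightarrow> p s * q x)) \<partial>(lborel \<Otimes>\<^sub>M lborel))
      = (\<integral>\<^sup>+s. ennreal (cmod (p s)) \<partial>lborel) * (\<integral>\<^sup>+s. ennreal (cmod (q s)) \<partial>lborel)"
    by (subst lborel_pair.nn_integral_snd[symmetric])
      (auto simp: norm_mult ennreal_mult nn_integral_multc nn_integral_cmult)
  also have "\<dots> < \<infinity>"
    using p q by (auto simp: integrable_iff_bounded ennreal_mult_less_top)
  finally show "(\<integral>\<^sup>+z. ennreal (norm (case z of (s, x) \<Rightarrow> p s * q x)) \<partial>(lborel \<Otimes>\<^sub>M lborel)) < \<infinity>" .
qed

section \<open>Fourier transforms and autocorrelations\<close>

definition fourier :: "('a::euclidean_space \<Rightarrow> complex) \<Rightarrow> 'a \<Rightarrow> complex" where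
  "fourier F w = (LINT t|lborel. F t * cnj (cis (2 * pi * (w \<bullet> t))))"

definition autocorr :: "('a::euclidean_space \<Rightarrow> complex) \<Rightarrow> 'a \<Rightarrow> complex" where
  "autocorr F u = (LINT s|lborel. F s * cnj (F (s - u)))"

lemma integrable_autocorr:
  assumes F: "integrable lborel F"
  shows "integrable lborel (autocorr F)"
proof -
  have "integrable (lborel \<Otimes>\<^sub>M lborel) (\<lambda>(s, x). F s * cnj (F (s - x)))"
    using integrable_convolution[OF F integrable_cnj[OF F]] by simp
  from lborel_pair.integrable_snd[OF this] show ?thesis by (simp add: autocorr_def[abs_def])
qed

text \<open>Wiener--Khinchin: with the modulation moved into \<open>p\<close>, the product of the
  two integrals is the integral of a convolution, and the modulations of its two factors combine to
  one depending on \<open>u\<close> alone.\<close>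

lemma fourier_autocorr:
  assumes F: "integrable lborel F"
  shows "fourier F w * cnj (fourier F w) = (LINT u|lborel. cnj (cis (2 * pi * (w \<bullet> u))) * autocorr F u)"
proof -
  have [measurable]: "F \<in> borel_measurable borel" using F by auto
  define p where "p s = F s * cnj (cis (2 * pi * (w \<bullet> s)))" for s
  define q where "q s = cnj (p s)" for s
  have p: "integrable lborel p"
    unfolding p_def by (rule Bochner_Integration.integrable_bound[OF F]) (auto simp: norm_mult)
  then have q: "integrable lborel q" unfolding q_def by (rule integrable_cnj)
  have "fourier F w * cnj (fourier F w) = (LINT s|lborel. p s) * (LINT s|lborel. q s)"
    by (simp add: fourier_def p_def[symmetric] q_def integral_cnj)
  also have "\<dots> = (LINT u|lborel. LINT s|lborel. p s * q (s - u))"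
    by (rule integral_convolution[OF p q, symmetric])
  also have "\<dots> = (LINT u|lborel. LINT s|lborel. cnj (cis (2 * pi * (w \<bullet> u))) * (F s * cnj (F (s - u))))"
  proof (intro Bochner_Integration.integral_cong refl)
    fix u s
    have "cnj (cis (2 * pi * (w \<bullet> s))) * cis (2 * pi * (w \<bullet> (s - u))) = cnj (cis (2 * pi * (w \<bullet> u)))"
      by (simp add: cis_cnj cis_mult inner_diff_right algebra_simps)
    then show "p s * q (s - u) = cnj (cis (2 * pi * (w \<bullet> u))) * (F s * cnj (F (s - u)))"
      by (simp add: p_def q_def mult_ac)
  qed
  finally show ?thesis by (simp add: autocorr_def)
qed

lemma norm_fourier_le: "cmod (fourier F w) \<le> (LINT t|lborel. cmod (F t))"
proof -
  have "cmod (fourier F w) \<le> (LINT t|lborel. cmod (F t * cnj (cis (2 * pi * (w \<bullet> t)))))"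
    unfolding fourier_def by (rule integral_norm_bound)
  then show ?thesis by (simp add: norm_mult)
qed

lemma fourier_measurable [measurable]:
  assumes [measurable]: "F \<in> borel_measurable borel"
  shows "fourier F \<in> borel_measurable borel"
proof -
  have "(\<lambda>w. LINT t|lborel. F t * cnj (cis (2 * pi * (w \<bullet> t)))) \<in> borel_measurable borel"
    by measurable
  then show ?thesis by (simp add: fourier_def[abs_def])
qed

text \<open>The Gaussian makes the double integral over \<open>w\<close> and \<open>u\<close>
  absolutely convergent; after the exchange the frequency integral is the one in
  \<open>gauss_fourier_scale\<close>.\<close>

lemma gauss_fourier_autocorr:
  fixes F :: "'a::euclidean_space \<Rightarrow> complex"
  assumes F: "integrable lborel F" and \<epsilon>: "\<epsilon> > 0"
  defines "K \<equiv> (sqrt (2 * pi) / (2 * pi * \<epsilon>)) ^ DIM('a)"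
  shows "integrable lborel (\<lambda>w. gauss ((2 * pi * \<epsilon>) *\<^sub>R w) * (cmod (fourier F w))\<^sup>2)"
    and "complex_of_real (LINT w|lborel. gauss ((2 * pi * \<epsilon>) *\<^sub>R w) * (cmod (fourier F w))\<^sup>2)
      = (LINT u|lborel. of_real (K * gauss (u /\<^sub>R \<epsilon>)) * autocorr F u)"
proof -
  have [measurable]: "F \<in> borel_measurable borel" using F by auto
  have [measurable]: "autocorr F \<in> borel_measurable borel" using integrable_autocorr[OF F] by auto
  let ?g = "\<lambda>w::'a. gauss ((2 * pi * \<epsilon>) *\<^sub>R w)"
  have g: "integrable lborel ?g" using \<epsilon> by (intro integrable_gauss_scale) simp
  show "integrable lborel (\<lambda>w. ?g w * (cmod (fourier F w))\<^sup>2)"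
  proof (rule Bochner_Integration.integrable_bound)
    show "integrable lborel (\<lambda>w. ?g w * (LINT t|lborel. cmod (F t))\<^sup>2)" using g by simp
    show "AE w in lborel. norm (?g w * (cmod (fourier F w))\<^sup>2) \<le> norm (?g w * (LINT t|lborel. cmod (F t))\<^sup>2)"
      by (intro AE_I2) (simp add: abs_mult mult_left_mono power_mono norm_fourier_le)
  qed measurable
  have pair: "integrable (lborel \<Otimes>\<^sub>M lborel)
      (\<lambda>(w, u). complex_of_real (?g w) * (cnj (cis (2 * pi * (w \<bullet> u))) * autocorr F u))"
  proof (rule Bochner_Integration.integrable_bound)
    show "integrable (lborel \<Otimes>\<^sub>M lborel) (\<lambda>(w, u). complex_of_real (?g w) * autocorr F u)"
      using g by (intro integrable_pair_mult integrable_autocorr F) simp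
  qed (auto simp: norm_mult)
  have "complex_of_real (LINT w|lborel. ?g w * (cmod (fourier F w))\<^sup>2)
      = (LINT w|lborel. complex_of_real (?g w * (cmod (fourier F w))\<^sup>2))"
    by (rule integral_complex_of_real[symmetric])
  also have "\<dots> = (LINT w|lborel. LINT u|lborel. complex_of_real (?g w) * (cnj (cis (2 * pi * (w \<bullet> u))) * autocorr F u))"
    by (intro Bochner_Integration.integral_cong refl)
      (simp add: fourier_autocorr[OF F, symmetric] complex_norm_square del: of_real_power)
  also have "\<dots> = (LINT u|lborel. LINT w|lborel. complex_of_real (?g w) * (cnj (cis (2 * pi * (w \<bullet> u))) * autocorr F u))"
    by (rule lborel_pair.Fubini_integral[symmetric]) (rule pair)
  also have "\<dots> = (LINT u|lborel. (LINT w|lborel. complex_of_real (?g w) * cnj (cis (2 * pi * (w \<bullet> u)))) * autocorr F u)"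
    unfolding mult.assoc[symmetric] by simp
  also have "\<dots> = (LINT u|lborel. of_real (K * gauss (u /\<^sub>R \<epsilon>)) * autocorr F u)"
    unfolding gauss_fourier_scale[OF \<epsilon>] K_def ..
  finally show "complex_of_real (LINT w|lborel. ?g w * (cmod (fourier F w))\<^sup>2)
      = (LINT u|lborel. of_real (K * gauss (u /\<^sub>R \<epsilon>)) * autocorr F u)" .
qed

lemma autocorr_cinner:
  assumes "square_integrable f"
  shows "autocorr f u = cinner (abs_L2 f) (tf_shift (u, 0) (abs_L2 f))"
proof -
  have "square_integrable (\<lambda>t. f (t - u))"
    using square_integrable_tf_shift[OF assms, of 0 u] by simp
  then show ?thesis using assms by (simp add: tf_shift_abs cinner_abs_L2 autocorr_def)
qed

text \<open>Its Fourier transform in \<open>t\<close> is the short-time Fourier transform of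
  \<open>f\<close> with window \<open>g\<close>; see \<open>cinner_tf_shift_fourier\<close>.\<close>

definition shifted_product ::
  "('a::euclidean_space \<Rightarrow> complex) \<Rightarrow> ('a \<Rightarrow> complex) \<Rightarrow> 'a \<Rightarrow> 'a \<Rightarrow> complex" where
  "shifted_product f g x t = f t * cnj (g (t - x))"

lemma integrable_shifted_product:
  assumes "square_integrable f" "square_integrable g"
  shows "integrable lborel (shifted_product f g x)"
proof -
  have "square_integrable (\<lambda>t. g (t - x))"
    using square_integrable_tf_shift[OF assms(2), of 0 x] by simp
  from integrable_square_integrable_mult[OF assms(1) this] show ?thesis
    by (simp add: shifted_product_def[abs_def])
qed

lemma cinner_tf_shift_fourier:
  assumes "square_integrable f" "square_integrable g"
  shows "cinner (abs_L2 f) (tf_shift z (abs_L2 g)) = fourier (shifted_product f g (fst z)) (snd z)"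
  using assms
  by (cases z) (simp add: tf_shift_abs cinner_abs_L2 square_integrable_tf_shift fourier_def
      shifted_product_def, simp add: mult_ac)

lemma shifted_product_measurable [measurable]:
  assumes [measurable]: "f \<in> borel_measurable borel" "g \<in> borel_measurable borel"
    "a \<in> borel_measurable M" "b \<in> borel_measurable M"
  shows "(\<lambda>y. shifted_product f g (a y) (b y)) \<in> borel_measurable M"
  unfolding shifted_product_def by measurable

lemma cinner_tf_shift_measurable [measurable]:
  "(\<lambda>z. cinner \<psi> (tf_shift z \<phi>)) \<in> borel_measurable (borel :: ('a::euclidean_space \<times> 'a) measure)"
proof (rule abs_L2_cases[of \<psi>], rule abs_L2_cases[of \<phi>])
  fix f g assume f: "square_integrable f" "\<psi> = abs_L2 f" and g: "square_integrable g" "\<phi> = abs_L2 g"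
  note [measurable] = square_integrable_measurable[OF f(1)] square_integrable_measurable[OF g(1)]
  have "(\<lambda>z. LINT t|lborel. shifted_product f g (fst z) t * cnj (cis (2 * pi * (snd z \<bullet> t))))
      \<in> borel_measurable (borel \<Otimes>\<^sub>M borel)"
    by measurable
  then show ?thesis
    by (simp add: f g cinner_tf_shift_fourier fourier_def borel_prod)
qed

text \<open>Regrouping the four factors by function instead of by shift separates \<open>f\<close>
  from \<open>g\<close>; integration over \<open>x\<close> then factorises.\<close>

lemma autocorr_shifted_product:
  "autocorr (shifted_product f g x) u
    = (LINT s|lborel. shifted_product f f u s * cnj (shifted_product g g u (s - x)))"
  by (simp add: autocorr_def shifted_product_def mult_ac diff_diff_eq add.commute)

lemma integral_autocorr_shifted_product:
  assumes "square_integrable f" "square_integrable g"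
  shows "(LINT x|lborel. autocorr (shifted_product f g x) u) = autocorr f u * cnj (autocorr g u)"
proof -
  have "(LINT x|lborel. autocorr (shifted_product f g x) u)
      = (LINT s|lborel. shifted_product f f u s) * (LINT s|lborel. cnj (shifted_product g g u s))"
    unfolding autocorr_shifted_product
    by (rule integral_convolution[of "shifted_product f f u" "\<lambda>s. cnj (shifted_product g g u s)"])
      (intro integrable_cnj integrable_shifted_product assms)+
  then show ?thesis
    unfolding Bochner_Integration.integral_cnj by (simp only: autocorr_def shifted_product_def)
qed

text \<open>A crude bound by the sum of two squares; its use is finiteness uniformly in
  \<open>u\<close>, for Fubini.\<close>

lemma nn_integral_shifted_product_self:
  assumes f: "square_integrable f"
  shows "(\<integral>\<^sup>+s. ennreal (cmod (shifted_product f f u s)) \<partial>lborel)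
    \<le> 2 * (\<integral>\<^sup>+s. ennreal ((cmod (f s))\<^sup>2) \<partial>lborel)"
proof -
  note [measurable] = square_integrable_measurable[OF f]
  have "(\<integral>\<^sup>+s. ennreal (cmod (shifted_product f f u s)) \<partial>lborel)
      \<le> (\<integral>\<^sup>+s. ennreal ((cmod (f s))\<^sup>2) + ennreal ((cmod (f (s - u)))\<^sup>2) \<partial>lborel)"
  proof (intro nn_integral_mono)
    fix s
    have "0 \<le> cmod (f s) * cmod (f (s - u))" by simp
    then have "cmod (f s) * cmod (f (s - u)) \<le> (cmod (f s))\<^sup>2 + (cmod (f (s - u)))\<^sup>2"
      using sum_squares_bound[of "cmod (f s)" "cmod (f (s - u))"] by linarith
    then show "ennreal (cmod (shifted_product f f u s)) \<le> ennreal ((cmod (f s))\<^sup>2) + ennreal ((cmod (f (s - u)))\<^sup>2)"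
      by (simp add: shifted_product_def norm_mult flip: ennreal_plus)
  qed
  also have "\<dots> = (\<integral>\<^sup>+s. ennreal ((cmod (f s))\<^sup>2) \<partial>lborel) + (\<integral>\<^sup>+s. ennreal ((cmod (f (s - u)))\<^sup>2) \<partial>lborel)"
    by (intro nn_integral_add) auto
  also have "\<dots> = 2 * (\<integral>\<^sup>+s. ennreal ((cmod (f s))\<^sup>2) \<partial>lborel)"
    using nn_integral_lborel_shift[of "\<lambda>s. ennreal ((cmod (f s))\<^sup>2)" u] by (simp add: mult_2)
  finally show ?thesis .
qed

text \<open>For a non-integrable function the Bochner integral is 0 and the bound is
  trivial.\<close>

lemma norm_integral_le_nn_integral: "ennreal (norm (integral\<^sup>L M f)) \<le> (\<integral>\<^sup>+x. ennreal (norm (f x)) \<partial>M)"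
  by (cases "integrable M f") (auto simp: integral_norm_bound_ennreal not_integrable_integral_eq)

lemma nn_integral_autocorr_shifted_product:
  assumes f: "square_integrable f" and g: "square_integrable g"
  shows "(\<integral>\<^sup>+x. ennreal (cmod (autocorr (shifted_product f g x) u)) \<partial>lborel)
    \<le> (2 * (\<integral>\<^sup>+s. ennreal ((cmod (f s))\<^sup>2) \<partial>lborel)) * (2 * (\<integral>\<^sup>+s. ennreal ((cmod (g s))\<^sup>2) \<partial>lborel))"
proof -
  note [measurable] = square_integrable_measurable[OF f] square_integrable_measurable[OF g]
  have "(\<integral>\<^sup>+x. ennreal (cmod (autocorr (shifted_product f g x) u)) \<partial>lborel)
      \<le> (\<integral>\<^sup>+x. \<integral>\<^sup>+s. ennreal (cmod (shifted_product f f u s)) * ennreal (cmod (shifted_product g g u (s - x))) \<partial>lborel \<partial>lborel)"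
    unfolding autocorr_shifted_product
    by (intro nn_integral_mono order_trans[OF norm_integral_le_nn_integral])
      (auto simp: norm_mult ennreal_mult)
  also have "\<dots> = (\<integral>\<^sup>+s. ennreal (cmod (shifted_product f f u s)) \<partial>lborel)
      * (\<integral>\<^sup>+s. ennreal (cmod (shifted_product g g u s)) \<partial>lborel)"
    by (rule nn_integral_convolution) auto
  also have "\<dots> \<le> (2 * (\<integral>\<^sup>+s. ennreal ((cmod (f s))\<^sup>2) \<partial>lborel)) * (2 * (\<integral>\<^sup>+s. ennreal ((cmod (g s))\<^sup>2) \<partial>lborel))"
    by (intro mult_mono nn_integral_shifted_product_self f g) auto
  finally show ?thesis .
qed

lemma autocorr_measurable:
  assumes [measurable]: "f \<in> borel_measurable borel" "g \<in> borel_measurable borel"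
  shows "(\<lambda>(x, u). autocorr (shifted_product f g x) u) \<in> borel_measurable (borel \<Otimes>\<^sub>M borel)"
  unfolding autocorr_def by measurable

text \<open>The Gaussian factor in the frequency variable makes every integrand absolutely integrable, so that
  Fubini turns the integral into a Gaussian average of autocorrelations near 0.\<close>

lemma moyal_gauss:
  fixes f g :: "'a::euclidean_space \<Rightarrow> complex"
  assumes f: "square_integrable f" and g: "square_integrable g" and \<epsilon>: "\<epsilon> > 0"
  shows "(\<integral>\<^sup>+z. ennreal (gauss ((2 * pi * \<epsilon>) *\<^sub>R snd z) * (cmod (fourier (shifted_product f g (fst z)) (snd z)))\<^sup>2) \<partial>lborel)
    = ennreal (Re ((LINT v|lborel. of_real (gauss v) * (autocorr f (\<epsilon> *\<^sub>R v) * cnj (autocorr g (\<epsilon> *\<^sub>R v))))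
        / of_real (sqrt (2 * pi) ^ DIM('a))))"
proof -
  note [measurable] = square_integrable_measurable[OF f] square_integrable_measurable[OF g]
  note [measurable] = autocorr_measurable
  define K where "K = (sqrt (2 * pi) / (2 * pi * \<epsilon>)) ^ DIM('a)"
  have K: "K \<ge> 0" using \<epsilon> by (simp add: K_def)
  let ?J = "\<lambda>x. LINT w|lborel. gauss ((2 * pi * \<epsilon>) *\<^sub>R w) * (cmod (fourier (shifted_product f g x) w))\<^sup>2"
  let ?h = "\<lambda>x u. complex_of_real (K * gauss (u /\<^sub>R \<epsilon>)) * autocorr (shifted_product f g x) u"
  have J: "complex_of_real (?J x) = (LINT u|lborel. ?h x u)" for x
    unfolding K_def by (rule gauss_fourier_autocorr(2)[OF integrable_shifted_product[OF f g] \<epsilon>])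
  define N where "N = (2 * (\<integral>\<^sup>+s. ennreal ((cmod (f s))\<^sup>2) \<partial>lborel)) * (2 * (\<integral>\<^sup>+s. ennreal ((cmod (g s))\<^sup>2) \<partial>lborel))"
  have N: "N < \<infinity>" using f g by (simp add: N_def nn_integral_norm_abs_L2 ennreal_mult_less_top)
  \<comment> \<open>The inner integral over \<open>x\<close> is bounded by \<open>N\<close> for
    every \<open>u\<close>, and the Gaussian bump in \<open>u\<close> is integrable.\<close>
  have pair: "integrable (lborel \<Otimes>\<^sub>M lborel) (\<lambda>(x, u). ?h x u)"
  proof (rule integrableI_bounded)
    have "(\<integral>\<^sup>+z. ennreal (norm (case z of (x, u) \<Rightarrow> ?h x u)) \<partial>(lborel \<Otimes>\<^sub>M lborel))
        = (\<integral>\<^sup>+u. \<integral>\<^sup>+x. ennreal (norm (?h x u)) \<partial>lborel \<partial>lborel)"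
      by (subst lborel_pair.nn_integral_snd[symmetric]) auto
    also have "\<dots> = (\<integral>\<^sup>+u. ennreal (K * gauss (u /\<^sub>R \<epsilon>))
        * (\<integral>\<^sup>+x. ennreal (cmod (autocorr (shifted_product f g x) u)) \<partial>lborel) \<partial>lborel)"
      using K by (simp add: norm_mult ennreal_mult abs_mult flip: nn_integral_cmult)
    also have "\<dots> \<le> (\<integral>\<^sup>+u. ennreal (K * gauss ((u::'a) /\<^sub>R \<epsilon>)) * N \<partial>lborel)"
      unfolding N_def
      by (intro nn_integral_mono mult_left_mono nn_integral_autocorr_shifted_product f g) auto
    also have "\<dots> = (\<integral>\<^sup>+u. ennreal (K * gauss ((u::'a) /\<^sub>R \<epsilon>)) \<partial>lborel) * N"
      by (rule nn_integral_multc) auto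
    also have "\<dots> < \<infinity>"
      using integrable_gauss_scale[of "inverse \<epsilon>", where 'a = 'a] \<epsilon> N K
      by (auto simp: ennreal_mult_less_top nn_integral_eq_integral)
    finally show "(\<integral>\<^sup>+z. ennreal (norm (case z of (x, u) \<Rightarrow> ?h x u)) \<partial>(lborel \<Otimes>\<^sub>M lborel)) < \<infinity>" .
  qed measurable
  have J_int: "integrable lborel ?J"
  proof -
    have "integrable lborel (\<lambda>x. LINT u|lborel. ?h x u)"
      using lborel_pair.integrable_fst[OF pair] by simp
    then have "integrable lborel (\<lambda>x. complex_of_real (?J x))" unfolding J .
    from integrable_Re[OF this] show ?thesis by simp
  qed
  have "complex_of_real (LINT x|lborel. ?J x) = (LINT x|lborel. LINT u|lborel. ?h x u)"
    unfolding J[symmetric] by simp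
  also have "\<dots> = (LINT u|lborel. LINT x|lborel. ?h x u)"
    by (rule lborel_pair.Fubini_integral[symmetric]) (rule pair)
  also have "\<dots> = (LINT u|lborel. of_real (K * gauss (u /\<^sub>R \<epsilon>)) * (autocorr f u * cnj (autocorr g u)))"
    by (simp add: integral_autocorr_shifted_product f g)
  also have "\<dots> = \<epsilon> ^ DIM('a) *\<^sub>R (LINT v|lborel. of_real (K * gauss v) * (autocorr f (\<epsilon> *\<^sub>R v) * cnj (autocorr g (\<epsilon> *\<^sub>R v))))"
  proof -
    have [measurable]: "autocorr f \<in> borel_measurable borel" "autocorr g \<in> borel_measurable borel"
      unfolding autocorr_def[abs_def] by measurable
    show ?thesis using \<epsilon> by (subst integral_lborel_scale[of \<epsilon>]) auto
  qed
  also have "\<dots> = of_real (\<epsilon> ^ DIM('a) * K) * (LINT v|lborel. of_real (gauss v) * (autocorr f (\<epsilon> *\<^sub>R v) * cnj (autocorr g (\<epsilon> *\<^sub>R v))))"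
    by (simp add: scaleR_conv_of_real mult.assoc)
  \<comment> \<open>The Jacobian of \<open>u = \<epsilon> v\<close> cancels the height of the bump;
    what remains is the normalising constant of \<open>gauss\<close>.\<close>
  also have "\<epsilon> ^ DIM('a) * K = 1 / sqrt (2 * pi) ^ DIM('a)"
  proof -
    have "\<epsilon> * (sqrt (2 * pi) / (2 * pi * \<epsilon>)) = 1 / sqrt (2 * pi)"
      using \<epsilon> real_sqrt_mult_self[of "2 * pi"] by (simp add: field_simps)
    then show ?thesis unfolding K_def power_mult_distrib[symmetric] by (simp add: power_one_over)
  qed
  finally have total: "complex_of_real (LINT x|lborel. ?J x)
    = (LINT v|lborel. of_real (gauss v) * (autocorr f (\<epsilon> *\<^sub>R v) * cnj (autocorr g (\<epsilon> *\<^sub>R v))))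
        / of_real (sqrt (2 * pi) ^ DIM('a))" by simp
  have V [measurable]: "(\<lambda>z. fourier (shifted_product f g (fst z)) (snd z)) \<in> borel_measurable (lborel \<Otimes>\<^sub>M lborel)"
    unfolding fourier_def by measurable
  have "(\<integral>\<^sup>+z. ennreal (gauss ((2 * pi * \<epsilon>) *\<^sub>R snd z) * (cmod (fourier (shifted_product f g (fst z)) (snd z)))\<^sup>2) \<partial>lborel)
      = (\<integral>\<^sup>+x. \<integral>\<^sup>+w. ennreal (gauss ((2 * pi * \<epsilon>) *\<^sub>R w) * (cmod (fourier (shifted_product f g x) w))\<^sup>2) \<partial>lborel \<partial>lborel)"
    unfolding lborel_prod[symmetric]
    by (subst lborel.nn_integral_fst[symmetric]) auto
  also have "\<dots> = (\<integral>\<^sup>+x. ennreal (?J x) \<partial>lborel)"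
    by (intro nn_integral_cong nn_integral_eq_integral gauss_fourier_autocorr(1)
        integrable_shifted_product f g \<epsilon>) auto
  also have "\<dots> = ennreal (LINT x|lborel. ?J x)"
    by (intro nn_integral_eq_integral J_int) auto
  also have "(LINT x|lborel. ?J x) = Re (complex_of_real (LINT x|lborel. ?J x))" by simp
  finally show ?thesis unfolding total .
qed

lemma autocorr_tendsto:
  assumes f: "square_integrable f" and u: "u \<longlonglongrightarrow> 0"
  shows "(\<lambda>n. autocorr f (u n)) \<longlonglongrightarrow> of_real ((norm (abs_L2 f))\<^sup>2)"
proof -
  have "(\<lambda>n. cinner (abs_L2 f) (tf_shift (u n, 0) (abs_L2 f))) \<longlonglongrightarrow> cinner (abs_L2 f) (abs_L2 f)"
    using translation_continuous[of "abs_L2 f"] u unfolding translation_continuous_def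
    by (intro cinner.tendsto tendsto_const) blast
  then show ?thesis by (simp add: autocorr_cinner f cinner_self_norm)
qed

lemma norm_autocorr_le: "square_integrable f \<Longrightarrow> cmod (autocorr f u) \<le> (norm (abs_L2 f))\<^sup>2"
  using cinner_cauchy_schwarz[of "abs_L2 f" "tf_shift (u, 0) (abs_L2 f)"]
  by (simp add: autocorr_cinner norm_tf_shift power2_eq_square)

text \<open>Letting \<open>\<epsilon>\<close> tend to 0 in \<open>moyal_gauss\<close>, the left side
  converges monotonically as the cutoff rises to 1; on the right, dominated convergence applies and
  continuity of translations evaluates both autocorrelations at 0.\<close>

theorem moyal:
  fixes \<psi> \<phi> :: "'a::euclidean_space L2"
  shows "(\<integral>\<^sup>+z. ennreal ((cmod (cinner \<psi> (tf_shift z \<phi>)))\<^sup>2) \<partial>lborel) = ennreal ((norm \<psi>)\<^sup>2 * (norm \<phi>)\<^sup>2)"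
proof (rule abs_L2_cases[of \<psi>], rule abs_L2_cases[of \<phi>])
  fix f g assume f: "square_integrable f" "\<psi> = abs_L2 f" and g: "square_integrable g" "\<phi> = abs_L2 g"
  note [measurable] = square_integrable_measurable[OF f(1)] square_integrable_measurable[OF g(1)]
  define V where "V z = cinner \<psi> (tf_shift z \<phi>)" for z
  have V: "V z = fourier (shifted_product f g (fst z)) (snd z)" for z
    by (simp add: V_def f g cinner_tf_shift_fourier)
  have [measurable]: "V \<in> borel_measurable borel" unfolding V_def by measurable
  have [measurable]: "(snd :: 'a \<times> 'a \<Rightarrow> 'a) \<in> borel_measurable borel"
    by (intro borel_measurable_continuous_onI continuous_intros)
  define \<epsilon> :: "nat \<Rightarrow> real" where "\<epsilon> n = 1 / real (Suc n)" for n
  have \<epsilon>: "\<epsilon> n > 0" for n by (simp add: \<epsilon>_def)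
  have \<epsilon>0: "\<epsilon> \<longlonglongrightarrow> 0" unfolding \<epsilon>_def[abs_def] by (rule LIMSEQ_Suc[OF lim_1_over_n])
  have \<epsilon>_anti: "\<epsilon> n \<le> \<epsilon> m" if "m \<le> n" for m n using that by (simp add: \<epsilon>_def frac_le)
  let ?I = "\<lambda>n. \<integral>\<^sup>+z. ennreal (gauss ((2 * pi * \<epsilon> n) *\<^sub>R snd z) * (cmod (V z))\<^sup>2) \<partial>lborel"
  have "?I \<longlonglongrightarrow> (\<integral>\<^sup>+z. ennreal ((cmod (V z))\<^sup>2) \<partial>lborel)"
  proof (rule nn_integral_LIMSEQ)
    have "gauss ((2 * pi * \<epsilon> m) *\<^sub>R w) \<le> gauss ((2 * pi * \<epsilon> n) *\<^sub>R w)" if "m \<le> n" for m n and w :: 'a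
    proof -
      have "norm ((2 * pi * \<epsilon> n) *\<^sub>R w) \<le> norm ((2 * pi * \<epsilon> m) *\<^sub>R w)"
        using \<epsilon>[of n] \<epsilon>[of m] \<epsilon>_anti[OF that] by (simp add: abs_mult mult_right_mono)
      then have "(norm ((2 * pi * \<epsilon> n) *\<^sub>R w))\<^sup>2 \<le> (norm ((2 * pi * \<epsilon> m) *\<^sub>R w))\<^sup>2"
        by (intro power_mono) auto
      then show ?thesis unfolding gauss_def by simp
    qed
    then show "incseq (\<lambda>n z. ennreal (gauss ((2 * pi * \<epsilon> n) *\<^sub>R snd z) * (cmod (V z))\<^sup>2))"
      by (auto simp: incseq_def le_fun_def intro!: ennreal_leI mult_right_mono)
    fix z :: "'a \<times> 'a"
    have "(\<lambda>n. gauss ((2 * pi * \<epsilon> n) *\<^sub>R snd z) * (cmod (V z))\<^sup>2)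
        \<longlonglongrightarrow> exp (- (norm ((2 * pi * 0) *\<^sub>R snd z))\<^sup>2 / 2) * (cmod (V z))\<^sup>2"
      unfolding gauss_def by (intro tendsto_intros \<epsilon>0) simp
    then show "(\<lambda>n. ennreal (gauss ((2 * pi * \<epsilon> n) *\<^sub>R snd z) * (cmod (V z))\<^sup>2)) \<longlonglongrightarrow> ennreal ((cmod (V z))\<^sup>2)"
      by (intro tendsto_ennrealI) simp
  qed measurable
  moreover have "?I \<longlonglongrightarrow> ennreal ((norm \<psi>)\<^sup>2 * (norm \<phi>)\<^sup>2)"
  proof -
    let ?H = "\<lambda>u. autocorr f u * cnj (autocorr g u)"
    let ?c = "complex_of_real (sqrt (2 * pi) ^ DIM('a))"
    have [measurable]: "autocorr f \<in> borel_measurable borel" "autocorr g \<in> borel_measurable borel"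
      unfolding autocorr_def[abs_def] by measurable
    have "(\<lambda>n. LINT v|lborel. of_real (gauss v) * ?H (\<epsilon> n *\<^sub>R v))
        \<longlonglongrightarrow> (LINT v|(lborel :: 'a measure). of_real (gauss v) * of_real ((norm \<psi>)\<^sup>2 * (norm \<phi>)\<^sup>2))"
    proof (rule integral_dominated_convergence[where M = lborel
          and s = "\<lambda>n v. of_real (gauss v) * ?H (\<epsilon> n *\<^sub>R v)"
          and f = "\<lambda>v. of_real (gauss v) * of_real ((norm \<psi>)\<^sup>2 * (norm \<phi>)\<^sup>2)"
          and w = "\<lambda>v. gauss v * ((norm \<psi>)\<^sup>2 * (norm \<phi>)\<^sup>2)"])
      show "integrable lborel (\<lambda>v::'a. gauss v * ((norm \<psi>)\<^sup>2 * (norm \<phi>)\<^sup>2))"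
        using integrable_gauss[where 'a = 'a] by simp
      show "AE v in lborel. norm (of_real (gauss v) * ?H (\<epsilon> n *\<^sub>R v)) \<le> gauss v * ((norm \<psi>)\<^sup>2 * (norm \<phi>)\<^sup>2)" for n
        using norm_autocorr_le[OF f(1)] norm_autocorr_le[OF g(1)]
        by (intro AE_I2) (auto simp: norm_mult f g intro!: mult_left_mono mult_mono)
      have "(\<lambda>n. \<epsilon> n *\<^sub>R v) \<longlonglongrightarrow> 0" for v :: 'a using tendsto_scaleR[OF \<epsilon>0 tendsto_const[of v]] by simp
      from autocorr_tendsto[OF f(1) this] tendsto_cnj[OF autocorr_tendsto[OF g(1) this]]
      show "AE v in lborel. (\<lambda>n. of_real (gauss v) * ?H (\<epsilon> n *\<^sub>R v)) \<longlonglongrightarrow> of_real (gauss v) * of_real ((norm \<psi>)\<^sup>2 * (norm \<phi>)\<^sup>2)"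
        by (intro AE_I2 tendsto_mult tendsto_const) (simp add: f g tendsto_mult)
    qed measurable
    also have "(LINT v|(lborel :: 'a measure). of_real (gauss v) * complex_of_real ((norm \<psi>)\<^sup>2 * (norm \<phi>)\<^sup>2))
        = ?c * of_real ((norm \<psi>)\<^sup>2 * (norm \<phi>)\<^sup>2)"
      by (simp add: integral_gauss)
    finally have "(\<lambda>n. (LINT v|lborel. of_real (gauss v) * ?H (\<epsilon> n *\<^sub>R v)) / ?c)
        \<longlonglongrightarrow> ?c * of_real ((norm \<psi>)\<^sup>2 * (norm \<phi>)\<^sup>2) / ?c"
      by (intro tendsto_divide tendsto_const) simp_all
    then have "(\<lambda>n. ennreal (Re ((LINT v|lborel. of_real (gauss v) * ?H (\<epsilon> n *\<^sub>R v)) / ?c)))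
        \<longlonglongrightarrow> ennreal (Re (?c * of_real ((norm \<psi>)\<^sup>2 * (norm \<phi>)\<^sup>2) / ?c))"
      by (intro tendsto_ennrealI tendsto_Re)
    also have "?c * of_real ((norm \<psi>)\<^sup>2 * (norm \<phi>)\<^sup>2) / ?c = of_real ((norm \<psi>)\<^sup>2 * (norm \<phi>)\<^sup>2)" by simp
    finally show ?thesis unfolding V moyal_gauss[OF f(1) g(1) \<epsilon>] by simp
  qed
  ultimately show ?thesis unfolding V_def by (rule LIMSEQ_unique)
qed

section \<open>Rank-one decompositions of density operators\<close>

lemma suminf_ennreal_swap:
  fixes a :: "nat \<Rightarrow> nat \<Rightarrow> ennreal"
  shows "(\<Sum>i. \<Sum>j. a i j) = (\<Sum>j. \<Sum>i. a i j)"
  using nn_integral_suminf[of a "count_space UNIV"]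
  by (simp add: nn_integral_count_space_nat)

lemma infsum_nat_eq:
  fixes g :: "nat \<Rightarrow> 'a::banach"
  assumes "summable (\<lambda>n. norm (g n))" "g sums s"
  shows "infsum g UNIV = s"
  using norm_summable_imp_has_sum[OF assms] by (rule infsumI)

text \<open>A weak expansion of \<open>S\<close> into rank-one operators. The second clause is the
  trace condition in terms of the vectors.\<close>

definition op_decomp :: "('a::euclidean_space L2 \<Rightarrow> 'a L2) \<Rightarrow> (nat \<Rightarrow> 'a L2) \<Rightarrow> bool" where
  "op_decomp S f \<longleftrightarrow> (\<forall>\<psi> \<phi>. (\<lambda>k. cinner \<psi> (f k) * cinner (f k) \<phi>) sums cinner (S \<psi>) \<phi>) \<and>
     (\<lambda>k. (norm (f k))\<^sup>2) sums 1"

lemma op_decomp_sums: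
  "op_decomp S f \<Longrightarrow> (\<lambda>k. cinner \<psi> (f k) * cinner (f k) \<phi>) sums cinner (S \<psi>) \<phi>"
  by (simp add: op_decomp_def)

lemma op_decomp_sums_self:
  assumes "op_decomp S f"
  shows "(\<lambda>k. (cmod (cinner \<psi> (f k)))\<^sup>2) sums Re (cinner (S \<psi>) \<psi>)"
  using bounded_linear.sums[OF bounded_linear_Re op_decomp_sums[OF assms, of \<psi> \<psi>]]
  by (simp add: cinner_mult_cinner del: of_real_power)

lemma op_decomp_summable: "op_decomp S f \<Longrightarrow> summable (\<lambda>k. (norm (f k))\<^sup>2)"
  by (auto simp: op_decomp_def sums_iff)

lemma op_decomp_total: "op_decomp S f \<Longrightarrow> (\<Sum>k. ennreal ((norm (f k))\<^sup>2)) = 1"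
  unfolding op_decomp_def ennreal_1[symmetric] by (intro suminf_ennreal_eq) auto

lemma density_op_decomp:
  assumes "density_op S"
  shows "\<exists>f. op_decomp S f"
proof -
  have S: "positive_op S" and tr: "tr S = 1" using assms by (auto simp: density_op_def)
  note e = orthonormal_basis_some_basis[where 'a = 'a]
  define f where "f k = chol_vec (chol S some_basis k) (some_basis k)" for k
  have f: "(\<lambda>k. cinner \<psi> (f k) * cinner (f k) \<phi>) sums cinner (S \<psi>) \<phi>" for \<psi> \<phi>
    unfolding f_def by (rule cholesky_sums[OF S e])
  let ?r = "\<lambda>n. Re (cinner (S (some_basis n)) (some_basis n))"
  have r: "cinner (S (some_basis n)) (some_basis n) = of_real (?r n)" for n
    using positive_op_nonneg(2)[OF S] by (simp add: complex_eq_iff)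
  \<comment> \<open>\<open>infsum\<close> is 0 on a family that is not summable, so
    \<open>tr S = 1\<close> forces summability.\<close>
  have "(\<lambda>n. cinner (S (some_basis n)) (some_basis n)) summable_on UNIV"
    using tr infsum_not_exists unfolding tr_def by fastforce
  then have "(\<lambda>n. cinner (S (some_basis n)) (some_basis n)) sums 1"
    using has_sum_imp_sums[OF has_sum_infsum] tr unfolding tr_def by fastforce
  from bounded_linear.sums[OF bounded_linear_Re this] have r1: "?r sums 1" by simp
  have "(\<Sum>k. ennreal ((norm (f k))\<^sup>2)) = (\<Sum>k. \<Sum>n. ennreal ((cmod (cinner (f k) (some_basis n)))\<^sup>2))"
    by (simp add: parseval_ennreal[OF e])
  also have "\<dots> = (\<Sum>n. \<Sum>k. ennreal ((cmod (cinner (some_basis n) (f k)))\<^sup>2))"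
    by (subst suminf_ennreal_swap) (simp add: norm_cinner_commute)
  also have "\<dots> = (\<Sum>n. ennreal (?r n))"
  proof (intro suminf_cong suminf_ennreal_eq)
    fix n
    show "(\<lambda>k. (cmod (cinner (some_basis n) (f k)))\<^sup>2) sums ?r n"
      using bounded_linear.sums[OF bounded_linear_Re f[of "some_basis n" "some_basis n"]]
      by (simp add: cinner_mult_cinner del: of_real_power)
  qed simp
  also have "\<dots> = ennreal 1"
    by (intro suminf_ennreal_eq r1 positive_op_nonneg(1)[OF S])
  finally have t: "(\<Sum>k. ennreal ((norm (f k))\<^sup>2)) = ennreal 1" .
  then have "summable (\<lambda>k. (norm (f k))\<^sup>2)" by (intro summable_suminf_not_top) auto
  moreover from suminf_ennreal2[OF _ this] t have "(\<Sum>k. (norm (f k))\<^sup>2) = 1"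
    by (metis ennreal_inj suminf_nonneg calculation zero_le_one zero_le_power2)
  ultimately have "op_decomp S f" using f by (simp add: op_decomp_def sums_iff)
  then show ?thesis by blast
qed

text \<open>In the fixed basis the trace is a double series over \<open>k\<close> and
  \<open>n\<close>. It converges absolutely, as the squared norms of the \<open>f k\<close> are
  summable and \<open>B\<close>, the adjoint of \<open>A\<close>, is bounded; after the exchange
  Parseval in \<open>n\<close> leaves a single series.\<close>

lemma tr_comp_sums:
  assumes S: "op_decomp S f" and B: "\<And>\<psi> \<phi>. cinner (A \<psi>) \<phi> = cinner \<psi> (B \<phi>)"
    and C: "\<And>\<phi>. norm (B \<phi>) \<le> C * norm \<phi>"
  shows "(\<lambda>k. cinner (A (f k)) (f k)) sums tr (S \<circ> A)"
proof -
  note e = orthonormal_basis_some_basis[where 'a = 'a]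
  have on: "norm (some_basis n :: 'a L2) = 1" for n
    using e by (simp add: orthonormal_basis_def orthonormal_def norm_eq_sqrt_inner inner_L2_def)
  define a where "a k n = cinner (A (some_basis n)) (f k) * cinner (f k) (some_basis n)" for k n
  have a: "a k n = cinner (f k) (some_basis n) * cinner (some_basis n) (B (f k))" for k n
    by (simp add: a_def B)
  have C2: "norm (cinner (f k) (B (f k))) \<le> C * (norm (f k))\<^sup>2" for k
    using order_trans[OF cinner_cauchy_schwarz mult_left_mono[OF C]]
    by (fastforce simp: power2_eq_square mult_ac)
  \<comment> \<open>This bound gives summability in \<open>k\<close> for fixed \<open>n\<close>; the
    later bound \<open>ab\<close> gives summability in \<open>n\<close> for fixed
    \<open>k\<close>.\<close>
  have aC: "norm (a k n) \<le> C * (norm (f k))\<^sup>2" for k n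
  proof -
    have "norm (a k n) \<le> (norm (f k) * norm (some_basis n :: 'a L2)) * (norm (some_basis n :: 'a L2) * norm (B (f k)))"
      unfolding a norm_mult by (intro mult_mono cinner_cauchy_schwarz) auto
    also have "\<dots> \<le> norm (f k) * (C * norm (f k))" unfolding on by (simp add: mult_left_mono C)
    finally show ?thesis by (simp add: power2_eq_square mult_ac)
  qed
  let ?b = "\<lambda>k n. (cmod (cinner (f k) (some_basis n)))\<^sup>2 + (cmod (cinner (B (f k)) (some_basis n)))\<^sup>2"
  have b: "?b k sums ((norm (f k))\<^sup>2 + (norm (B (f k)))\<^sup>2)" for k
    by (intro sums_add parseval_norm e)
  have ab: "norm (a k n) \<le> ?b k n" for k n
    using sum_squares_bound[of "cmod (cinner (f k) (some_basis n))" "cmod (cinner (B (f k)) (some_basis n))"]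
      mult_nonneg_nonneg[of "cmod (cinner (f k) (some_basis n))" "cmod (cinner (B (f k)) (some_basis n))"]
    by (simp add: a norm_mult norm_cinner_commute[of "some_basis n" "B (f k)"] del: mult_nonneg_nonneg)
  have sa: "summable (\<lambda>n. norm (a k n))" for k
    by (rule summable_comparison_test'[OF sums_summable[OF b[of k]], of 0]) (use ab in auto)
  have sa': "summable (\<lambda>k. norm (a k n))" for n
    by (rule summable_comparison_test'[OF summable_mult[OF op_decomp_summable[OF S]], of 0 _ C]) (use aC in auto)
  have inf_le: "infsum (\<lambda>n. norm (a k n)) UNIV \<le> (1 + C\<^sup>2) * (norm (f k))\<^sup>2" for k
  proof -
    have "infsum (\<lambda>n. norm (a k n)) UNIV = (\<Sum>n. norm (a k n))"
      by (rule infsum_nat_eq) (use sa in \<open>auto simp: summable_sums\<close>)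
    also have "\<dots> \<le> (\<Sum>n. ?b k n)"
      by (intro suminf_le ab sa sums_summable[OF b])
    also have "\<dots> = (norm (f k))\<^sup>2 + (norm (B (f k)))\<^sup>2" by (rule sums_unique[OF b, symmetric])
    also have "\<dots> \<le> (norm (f k))\<^sup>2 + (C * norm (f k))\<^sup>2"
      by (intro add_left_mono power_mono C) auto
    finally show ?thesis by (simp add: power_mult_distrib algebra_simps)
  qed
  have "(\<lambda>k. infsum (\<lambda>n. norm (a k n)) UNIV) summable_on UNIV"
    by (rule norm_summable_imp_summable_on,
        rule summable_comparison_test'[OF summable_mult[OF op_decomp_summable[OF S]], of 0 _ "1 + C\<^sup>2"])
      (use inf_le in \<open>auto simp: infsum_nonneg\<close>)
  then have "(\<lambda>p. norm (case p of (k, n) \<Rightarrow> a k n)) summable_on UNIV \<times> UNIV"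
    unfolding Infinite_Sum.abs_summable_on_Sigma_iff using sa
    by (auto simp: infsum_nonneg norm_summable_imp_summable_on)
  then have "(\<lambda>(k, n). a k n) summable_on UNIV \<times> UNIV" by (rule Infinite_Sum.abs_summable_summable)
  note swap = infsum_swap_banach[OF this]
  have "infsum (\<lambda>k. a k n) UNIV = cinner (S (A (some_basis n))) (some_basis n)" for n
    unfolding a_def by (rule infsum_nat_eq)
      (use sa' op_decomp_sums[OF S] in \<open>auto simp: a_def\<close>)
  then have "tr (S \<circ> A) = infsum (\<lambda>k. infsum (\<lambda>n. a k n) UNIV) UNIV"
    unfolding swap by (simp add: tr_def)
  also have "\<dots> = infsum (\<lambda>k. cinner (f k) (B (f k))) UNIV"
  proof (intro infsum_cong infsum_nat_eq sa)
    show "(\<lambda>n. a k n) sums cinner (f k) (B (f k))" for k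
      unfolding a by (rule parseval_cinner[OF e])
  qed
  finally have tr: "tr (S \<circ> A) = infsum (\<lambda>k. cinner (f k) (B (f k))) UNIV" .
  have s: "summable (\<lambda>k. norm (cinner (f k) (B (f k))))"
    by (rule summable_comparison_test'[OF summable_mult[OF op_decomp_summable[OF S]], of 0 _ C])
      (use C2 in auto)
  then have "(\<lambda>k. cinner (f k) (B (f k))) sums tr (S \<circ> A)"
    unfolding tr by (subst infsum_nat_eq[OF s summable_sums[OF summable_norm_cancel[OF s]]])
      (rule summable_sums[OF summable_norm_cancel[OF s]])
  then show ?thesis by (simp add: B)
qed

section \<open>Convolutions in terms of the decomposition\<close>

lemma cinner_tf_adj_left: "cinner (tf_adj z \<psi>) \<phi> = cinner \<psi> (tf_shift z \<phi>)"
  using cinner_tf_adj[of z \<phi> \<psi>] cinner_commute[of "tf_adj z \<psi>" \<phi>] cinner_commute[of \<psi> "tf_shift z \<phi>"]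
  by simp

lemma op_shift_eq: "op_shift z A \<psi> = tf_shift z (A (tf_adj z \<psi>))"
  by (simp add: op_shift_def adj_tf_shift)

lemma op_decomp_op_shift:
  assumes "op_decomp S f"
  shows "op_decomp (op_shift z S) (\<lambda>k. tf_shift z (f k))"
  using assms op_decomp_sums[OF assms, of "tf_adj z _" "tf_adj z _"]
  unfolding op_decomp_def
  by (simp add: op_shift_eq cinner_tf_adj cinner_tf_adj_left norm_tf_shift)

lemma op_decomp_op_check:
  assumes "op_decomp S f"
  shows "op_decomp (op_check S) (\<lambda>k. parity (f k))"
  using assms op_decomp_sums[OF assms, of "parity _" "parity _"]
  unfolding op_decomp_def op_check_def
  by (simp add: cinner_parity_left norm_parity)

lemma cmod_cinner_tf_shift_uminus:
  "cmod (cinner \<phi> (tf_shift (- z) \<psi>)) = cmod (cinner \<psi> (tf_shift z \<phi>))"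
proof -
  have "cmod (cinner \<phi> (tf_adj z \<psi>)) = cmod (cinner \<phi> (tf_shift (- z) \<psi>))"
    by (simp add: tf_adj_def cinner_scaleC_right norm_mult)
  then show ?thesis using cinner_tf_adj[of z \<phi> \<psi>] norm_cinner_commute[of \<psi> "tf_shift z \<phi>"] by simp
qed

text \<open>Reflecting and shifting a rank-one operator gives the rank-one operator of
  \<open>\<eta>\<close>. The reflection of \<open>S\<close> meets that of \<open>\<psi>\<close>, so
  only the sign of \<open>z\<close> changes, and \<open>cmod_cinner_tf_shift_uminus\<close> restores
  it up to a phase.\<close>

lemma cohen_sums:
  assumes S: "op_decomp S f"
  shows "(\<lambda>k. complex_of_real ((cmod (cinner \<psi> (tf_shift z (f k))))\<^sup>2)) sums cohen S \<psi> z"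
proof -
  define \<eta> where "\<eta> = tf_shift z (parity \<psi>)"
  have A: "op_shift z (op_check (rank_one \<psi> \<psi>)) \<xi> = rank_one \<eta> \<eta> \<xi>" for \<xi>
    by (simp add: op_shift_eq op_check_def rank_one_def \<eta>_def parity_scaleC tf_shift_scaleC
        cinner_parity_left cinner_tf_adj_left)
  have "(\<lambda>k. cinner (op_shift z (op_check (rank_one \<psi> \<psi>)) (parity (f k))) (parity (f k)))
      sums tr (op_check S \<circ> op_shift z (op_check (rank_one \<psi> \<psi>)))"
  proof (rule tr_comp_sums[OF op_decomp_op_check[OF S], where B = "rank_one \<eta> \<eta>" and C = "norm \<eta> * norm \<eta>"])
    show "cinner (op_shift z (op_check (rank_one \<psi> \<psi>)) \<xi>) \<phi> = cinner \<xi> (rank_one \<eta> \<eta> \<phi>)" for \<xi> \<phi>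
      unfolding A unfolding rank_one_def cinner_scaleC_left cinner_scaleC_right
      by (simp add: cinner_commute[symmetric] mult.commute)
    show "norm (rank_one \<eta> \<eta> \<phi>) \<le> norm \<eta> * norm \<eta> * norm \<phi>" for \<phi>
      using mult_right_mono[OF cinner_cauchy_schwarz[of \<phi> \<eta>], of "norm \<eta>"]
      by (simp add: rank_one_def norm_scaleC mult_ac)
  qed
  moreover have "cinner (op_shift z (op_check (rank_one \<psi> \<psi>)) (parity (f k))) (parity (f k))
      = complex_of_real ((cmod (cinner \<psi> (tf_shift z (f k))))\<^sup>2)" for k
  proof -
    have "cinner (parity (f k)) \<eta> = cinner (f k) (tf_shift (- z) \<psi>)"
      by (simp add: cinner_parity_left \<eta>_def parity_tf_shift_parity)
    then have "cmod (cinner (parity (f k)) \<eta>) = cmod (cinner \<psi> (tf_shift z (f k)))"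
      by (simp add: cmod_cinner_tf_shift_uminus)
    then show ?thesis
      unfolding A unfolding rank_one_def cinner_scaleC_left cinner_mult_cinner by simp
  qed
  ultimately show ?thesis by (simp add: cohen_def conv_op_op_def)
qed

lemma op_check_op_check: "op_check (op_check S) = S"
  by (auto simp: op_check_def parity_parity)

lemma bounded_op_bound:
  assumes "bounded_op A"
  obtains C where "C \<ge> 0" "\<And>\<psi>. norm (A \<psi>) \<le> C * norm \<psi>"
  using bounded_linear.nonneg_bounded[OF bounded_opD(1)[OF assms]] by (auto simp: mult.commute)

text \<open>The two reflections cancel, so \<open>op_shift z S\<close> plays the part of
  \<open>A\<close> in \<open>tr_comp_sums\<close>; it is self-adjoint and hence its own
  \<open>B\<close>.\<close>

lemma autoconv_sums:
  assumes S: "positive_op S" and f: "op_decomp S f"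
  shows "(\<lambda>k. cinner (op_shift z S (f k)) (f k)) sums autoconv S z"
proof -
  obtain C where C: "\<And>\<psi>. norm (S \<psi>) \<le> C * norm \<psi>"
    using bounded_op_bound[OF positive_op_bounded[OF S]] by blast
  show ?thesis
    unfolding autoconv_def conv_op_op_def op_check_op_check
  proof (rule tr_comp_sums[OF f, where B = "op_shift z S" and C = C])
    show "cinner (op_shift z S \<psi>) \<phi> = cinner \<psi> (op_shift z S \<phi>)" for \<psi> \<phi>
      by (simp add: op_shift_eq cinner_tf_adj cinner_tf_adj_left[symmetric] positive_op_selfadjoint[OF S])
    show "norm (op_shift z S \<phi>) \<le> C * norm \<phi>" for \<phi>
      using C[of "tf_adj z \<phi>"] by (simp add: op_shift_eq norm_tf_shift norm_tf_adj)
  qed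
qed

lemma tf_shift_comp:
  "tf_shift z1 (tf_shift z2 \<psi>) = cis (- 2 * pi * (snd z2 \<bullet> fst z1)) *\<^sub>C tf_shift (z1 + z2) \<psi>"
proof (cases z1, cases z2, rule abs_L2_cases[of \<psi>])
  fix x1 w1 x2 w2 f assume "z1 = (x1, w1)" "z2 = (x2, w2)" "square_integrable f" "\<psi> = abs_L2 f"
  moreover have "cis (2 * pi * (w1 \<bullet> t)) * cis (2 * pi * (w2 \<bullet> (t - x1)))
      = cis (- 2 * pi * (w2 \<bullet> x1)) * cis (2 * pi * ((w1 + w2) \<bullet> t))" for t
    unfolding cis_mult by (rule arg_cong[of _ _ cis]) (simp add: algebra_simps inner_add_left inner_diff_right)
  moreover have "f (t - x1 - x2) = f (t - (x1 + x2))" for t by (simp add: diff_diff_eq)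
  ultimately show ?thesis
    by (simp add: tf_shift_abs scaleC_abs_L2 square_integrable_tf_shift del: minus_mult_minus
        flip: mult.assoc)
qed

lemma cmod_cinner_tf_shift_diff:
  "cmod (cinner (tf_shift z a) (tf_shift z' b)) = cmod (cinner a (tf_shift (z' - z) b))"
  by (simp add: cinner_tf_adj tf_adj_def tf_shift_comp cinner_scaleC_right norm_mult scaleC_scaleC)

section \<open>Nonnegative densities on phase space\<close>

text \<open>The Cohen distribution as an extended nonnegative series, open to Tonelli;
  \<open>cohen_husimi\<close> links it to \<open>cohen\<close>. With a single nonzero
  \<open>f k\<close> it is a spectrogram.\<close>

definition husimi :: "(nat \<Rightarrow> 'a::euclidean_space L2) \<Rightarrow> 'a L2 \<Rightarrow> 'a \<times> 'a \<Rightarrow> ennreal" where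
  "husimi f \<psi> z = (\<Sum>k. ennreal ((cmod (cinner \<psi> (tf_shift z (f k))))\<^sup>2))"

lemma husimi_measurable [measurable]: "husimi f \<psi> \<in> borel_measurable borel"
  unfolding husimi_def[abs_def] by measurable

lemma husimi_eq:
  assumes "op_decomp S f"
  shows "husimi f \<psi> z = ennreal (Re (cinner (op_shift z S \<psi>) \<psi>))"
  unfolding husimi_def
  by (intro suminf_ennreal_eq op_decomp_sums_self op_decomp_op_shift assms) simp

lemma cohen_husimi:
  assumes "op_decomp S f"
  shows "cohen S \<psi> z = of_real (enn2real (husimi f \<psi> z))"
proof -
  let ?c = "\<lambda>k. (cmod (cinner \<psi> (tf_shift z (f k))))\<^sup>2"
  have s: "?c sums Re (cohen S \<psi> z)"
    using bounded_linear.sums[OF bounded_linear_Re cohen_sums[OF assms]] by (simp del: of_real_power)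
  have "husimi f \<psi> z = ennreal (Re (cohen S \<psi> z))"
    unfolding husimi_def by (intro suminf_ennreal_eq s) simp
  moreover have "0 \<le> Re (cohen S \<psi> z)" using s by (intro sums_le[OF _ sums_zero s]) simp
  moreover have "Im (cohen S \<psi> z) = 0"
    using bounded_linear.sums[OF bounded_linear_Im cohen_sums[OF assms, of \<psi> z]] sums_zero[where 'a = real]
    by (auto dest: sums_unique2 simp del: of_real_power)
  ultimately show ?thesis by (simp add: complex_eq_iff)
qed

text \<open>Moyal's identity termwise; the weights add up to the trace 1.\<close>

lemma nn_integral_husimi:
  assumes "op_decomp S f"
  shows "(\<integral>\<^sup>+z. husimi f \<psi> z \<partial>lborel) = ennreal ((norm \<psi>)\<^sup>2)"
proof -
  have "(\<integral>\<^sup>+z. husimi f \<psi> z \<partial>lborel) = (\<Sum>k. ennreal ((norm \<psi>)\<^sup>2) * ennreal ((norm (f k))\<^sup>2))"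
    unfolding husimi_def by (subst nn_integral_suminf) (auto simp: moyal ennreal_mult)
  then show ?thesis using op_decomp_total[OF assms] by simp
qed

text \<open>Exchanging the sums leaves Parseval for each vector
  \<open>tf_shift z (f k)\<close>.\<close>

lemma sum_husimi_basis:
  assumes f: "op_decomp S f" and e: "orthonormal_basis e"
  shows "(\<Sum>n. husimi f (e n) z) = 1"
proof -
  have "(\<Sum>n. husimi f (e n) z) = (\<Sum>k. \<Sum>n. ennreal ((cmod (cinner (tf_shift z (f k)) (e n)))\<^sup>2))"
    unfolding husimi_def by (subst suminf_ennreal_swap) (simp add: norm_cinner_commute[of "e _"])
  then show ?thesis by (simp add: parseval_ennreal[OF e] norm_tf_shift op_decomp_total[OF f])
qed

text \<open>Bessel in place of Parseval; this keeps the accumulated distribution below 1.\<close>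

lemma sum_husimi_orthonormal_le:
  assumes f: "op_decomp S f" and h: "orthonormal h"
  shows "(\<Sum>k<N. husimi f (h k) z) \<le> 1"
proof -
  have "(\<Sum>k<N. husimi f (h k) z) = (\<Sum>j. \<Sum>k<N. ennreal ((cmod (cinner (h k) (tf_shift z (f j))))\<^sup>2))"
    unfolding husimi_def by (intro suminf_sum[symmetric] summableI)
  also have "\<dots> \<le> (\<Sum>j. ennreal ((norm (f j))\<^sup>2))"
  proof (intro suminf_le summableI)
    fix j
    have "(\<Sum>k<N. (cmod (cinner (tf_shift z (f j)) (h k)))\<^sup>2) \<le> (norm (tf_shift z (f j)))\<^sup>2"
      by (intro bessel_finite h) simp
    then show "(\<Sum>k<N. ennreal ((cmod (cinner (h k) (tf_shift z (f j))))\<^sup>2)) \<le> ennreal ((norm (f j))\<^sup>2)"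
      by (simp add: norm_tf_shift norm_cinner_commute[of "h _"] ennreal_leI)
  qed
  finally show ?thesis by (simp add: op_decomp_total[OF f])
qed

text \<open>The function \<open>G\<close> of the overview, with values in
  \<open>ennreal\<close>.\<close>

definition autoconv_nn :: "(nat \<Rightarrow> 'a::euclidean_space L2) \<Rightarrow> 'a \<times> 'a \<Rightarrow> ennreal" where
  "autoconv_nn f z = (\<Sum>j. husimi f (f j) z)"

lemma autoconv_nn_measurable [measurable]: "autoconv_nn f \<in> borel_measurable borel"
  unfolding autoconv_nn_def[abs_def] by measurable

text \<open>Positivity makes every term real and nonnegative, so \<open>cmod\<close> loses nothing;
  membership in \<open>M_op_star\<close> thereby becomes a finite first moment of
  \<open>autoconv_nn f\<close>.\<close>

lemma autoconv_nn_eq: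
  assumes S: "positive_op S" and f: "op_decomp S f"
  shows "ennreal (cmod (autoconv S z)) = autoconv_nn f z"
proof -
  let ?r = "\<lambda>k. Re (cinner (op_shift z S (f k)) (f k))"
  have eq: "cinner (op_shift z S (f k)) (f k) = of_real (?r k)" and nn: "0 \<le> ?r k" for k
    using positive_op_nonneg[OF S, of "tf_adj z (f k)"]
    by (auto simp: op_shift_eq cinner_tf_adj complex_eq_iff)
  have s: "?r sums Re (autoconv S z)"
    by (rule bounded_linear.sums[OF bounded_linear_Re autoconv_sums[OF S f]])
  have "(\<lambda>k. complex_of_real (?r k)) sums autoconv S z"
    using autoconv_sums[OF S f, of z] by (simp add: eq[symmetric])
  moreover have "(\<lambda>k. complex_of_real (?r k)) sums of_real (Re (autoconv S z))"
    using s by (rule sums_of_real)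
  ultimately have "autoconv S z = of_real (Re (autoconv S z))" by (rule sums_unique2)
  moreover have "0 \<le> Re (autoconv S z)" by (rule sums_le[OF _ sums_zero s]) (rule nn)
  ultimately have "cmod (autoconv S z) = Re (autoconv S z)" by (metis abs_of_nonneg norm_of_real)
  then show ?thesis
    unfolding autoconv_nn_def husimi_eq[OF f] using suminf_ennreal_eq[OF nn s] by simp
qed

lemma nn_integral_autoconv_nn:
  assumes "op_decomp S f"
  shows "(\<integral>\<^sup>+z. autoconv_nn f z \<partial>lborel) = 1"
  unfolding autoconv_nn_def
  by (subst nn_integral_suminf) (auto simp: nn_integral_husimi[OF assms] op_decomp_total[OF assms])

lemma sum_husimi_tf_shift:
  "(\<Sum>j. husimi f (tf_shift z (f j)) z') = autoconv_nn f (z' - z)"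
  unfolding husimi_def autoconv_nn_def cmod_cinner_tf_shift_diff ..

section \<open>Localization operators\<close>

lemma cinner_op_shift_measurable [measurable]:
  assumes "op_decomp S f"
  shows "(\<lambda>z. cinner (op_shift z S \<psi>) \<phi>) \<in> borel_measurable borel"
proof -
  have "cinner (op_shift z S \<psi>) \<phi>
      = (\<Sum>k. cinner \<psi> (tf_shift z (f k)) * cnj (cinner \<phi> (tf_shift z (f k))))" for z
    using sums_unique[OF op_decomp_sums[OF op_decomp_op_shift[OF assms]]]
    by (simp flip: cinner_commute)
  then show ?thesis by (simp cong: measurable_cong)
qed

text \<open>Discharges the definite description in \<open>conv_fun_op\<close>: for fixed
  \<open>\<psi>\<close> the integral is a bounded conjugate linear functional of
  \<open>\<phi>\<close>, so Riesz yields the value at \<open>\<psi>\<close>, and inner products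
  determine it.\<close>

lemma conv_fun_op_indicator:
  fixes S :: "'a::euclidean_space L2 \<Rightarrow> 'a L2"
  assumes S: "positive_op S" and f: "op_decomp S f"
    and \<Omega>: "\<Omega> \<in> sets borel" "emeasure lborel \<Omega> < \<infinity>"
  shows "cinner (conv_fun_op (indicator \<Omega>) S \<psi>) \<phi>
    = (LINT z|lborel. indicator \<Omega> z * cinner (op_shift z S \<psi>) \<phi>)"
proof -
  note [measurable] = cinner_op_shift_measurable[OF f] \<Omega>(1)
  obtain C where C: "\<And>\<psi>. norm (S \<psi>) \<le> C * norm \<psi>"
    using bounded_op_bound[OF positive_op_bounded[OF S]] by blast
  have bound: "cmod (cinner (op_shift z S \<psi>) \<phi>) \<le> C * norm \<psi> * norm \<phi>" for z \<psi> \<phi>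
    using order_trans[OF cinner_cauchy_schwarz[of "S (tf_adj z \<psi>)" "tf_adj z \<phi>"] mult_right_mono[OF C]]
    by (simp add: op_shift_eq cinner_tf_adj norm_tf_adj)
  have ind: "integrable lborel (\<lambda>z. indicator \<Omega> z :: real)"
    by (rule integrable_real_indicator) (use \<Omega> in auto)
  have int: "integrable lborel (\<lambda>z. indicator \<Omega> z * cinner (op_shift z S \<psi>) \<phi>)" for \<psi> \<phi>
  proof (rule Bochner_Integration.integrable_bound)
    show "integrable lborel (\<lambda>z. indicator \<Omega> z * (C * norm \<psi> * norm \<phi>))" using ind by simp
    show "AE z in lborel. norm (indicator \<Omega> z * cinner (op_shift z S \<psi>) \<phi>)
        \<le> norm (indicator \<Omega> z * (C * norm \<psi> * norm \<phi>))"
      by (intro AE_I2) (auto split: split_indicator intro: order_trans[OF bound])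
  qed measurable
  have ex: "\<exists>\<xi>. \<forall>\<phi>. (LINT z|lborel. indicator \<Omega> z * cinner (op_shift z S \<psi>) \<phi>) = cinner \<xi> \<phi>" for \<psi>
  proof (rule riesz_representation[OF orthonormal_basis_some_basis])
    show "bounded_linear (\<lambda>\<phi>. LINT z|lborel. indicator \<Omega> z * cinner (op_shift z S \<psi>) \<phi>)"
    proof (rule bounded_linear_intro)
      show "(LINT z|lborel. indicator \<Omega> z * cinner (op_shift z S \<psi>) (\<phi> + \<phi>'))
          = (LINT z|lborel. indicator \<Omega> z * cinner (op_shift z S \<psi>) \<phi>)
          + (LINT z|lborel. indicator \<Omega> z * cinner (op_shift z S \<psi>) \<phi>')" for \<phi> \<phi>'
        unfolding cinner.add_right distrib_left by (intro Bochner_Integration.integral_add int)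
      show "(LINT z|lborel. indicator \<Omega> z * cinner (op_shift z S \<psi>) (r *\<^sub>R \<phi>))
          = r *\<^sub>R (LINT z|lborel. indicator \<Omega> z * cinner (op_shift z S \<psi>) \<phi>)" for r \<phi>
        by (simp add: cinner.scaleR_right)
      show "norm (LINT z|lborel. indicator \<Omega> z * cinner (op_shift z S \<psi>) \<phi>)
          \<le> norm \<phi> * (C * norm \<psi> * measure lborel \<Omega>)" for \<phi>
      proof -
        have "norm (LINT z|lborel. indicator \<Omega> z * cinner (op_shift z S \<psi>) \<phi>)
            \<le> (LINT z|lborel. norm (indicator \<Omega> z * cinner (op_shift z S \<psi>) \<phi>))"
          by (rule integral_norm_bound)
        also have "\<dots> \<le> (LINT z|lborel. indicator \<Omega> z * (C * norm \<psi> * norm \<phi>))"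
          by (intro integral_mono integrable_norm int)
            (use ind in \<open>auto split: split_indicator simp: bound\<close>)
        also have "\<dots> = norm \<phi> * (C * norm \<psi> * measure lborel \<Omega>)" by simp
        finally show ?thesis .
      qed
    qed
    show "(LINT z|lborel. indicator \<Omega> z * cinner (op_shift z S \<psi>) (c *\<^sub>C \<phi>))
        = cnj c * (LINT z|lborel. indicator \<Omega> z * cinner (op_shift z S \<psi>) \<phi>)" for c \<phi>
      by (simp add: cinner_scaleC_right mult.left_commute)
  qed
  then obtain T where T: "\<And>\<psi> \<phi>. (LINT z|lborel. indicator \<Omega> z * cinner (op_shift z S \<psi>) \<phi>) = cinner (T \<psi>) \<phi>"
    by metis
  have "conv_fun_op (indicator \<Omega>) S = T"
    unfolding conv_fun_op_def T
  proof (rule the_equality)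
    fix U assume "\<forall>\<psi> \<phi>. cinner (U \<psi>) \<phi> = cinner (T \<psi>) \<phi>"
    then show "U = T" by (intro ext cinner_ext_left) blast
  qed simp
  then show ?thesis by (simp add: T)
qed

lemma conv_fun_op_husimi:
  assumes S: "positive_op S" and f: "op_decomp S f"
    and \<Omega>: "\<Omega> \<in> sets borel" "emeasure lborel \<Omega> < \<infinity>"
  shows "ennreal (Re (cinner (conv_fun_op (indicator \<Omega>) S \<psi>) \<psi>)) = (\<integral>\<^sup>+z. indicator \<Omega> z * husimi f \<psi> z \<partial>lborel)"
    and "0 \<le> Re (cinner (conv_fun_op (indicator \<Omega>) S \<psi>) \<psi>)"
proof -
  note [measurable] = cinner_op_shift_measurable[OF f] \<Omega>(1)
  let ?r = "\<lambda>z. Re (cinner (op_shift z S \<psi>) \<psi>)"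
  have eq: "cinner (op_shift z S \<psi>) \<psi> = of_real (?r z)" and nn: "0 \<le> ?r z" for z
    using positive_op_nonneg[OF S, of "tf_adj z \<psi>"]
    by (auto simp: op_shift_eq cinner_tf_adj complex_eq_iff)
  have nneq: "(\<integral>\<^sup>+z. indicator \<Omega> z * husimi f \<psi> z \<partial>lborel) = (\<integral>\<^sup>+z. ennreal (indicator \<Omega> z * ?r z) \<partial>lborel)"
    by (intro nn_integral_cong) (auto simp: husimi_eq[OF f] split: split_indicator)
  have "(\<integral>\<^sup>+z. ennreal (indicator \<Omega> z * ?r z) \<partial>lborel) \<le> (\<integral>\<^sup>+z. husimi f \<psi> z \<partial>lborel)"
    unfolding nneq[symmetric] by (intro nn_integral_mono) (auto split: split_indicator)
  then have fin: "(\<integral>\<^sup>+z. ennreal (indicator \<Omega> z * ?r z) \<partial>lborel) < \<infinity>"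
    using le_less_trans[of _ "ennreal ((norm \<psi>)\<^sup>2)" \<infinity>] by (simp add: nn_integral_husimi[OF f])
  have int: "integrable lborel (\<lambda>z. indicator \<Omega> z * ?r z)"
    using fin nn by (intro integrableI_nonneg) auto
  have "cinner (conv_fun_op (indicator \<Omega>) S \<psi>) \<psi> = (LINT z|lborel. complex_of_real (indicator \<Omega> z * ?r z))"
    unfolding conv_fun_op_indicator[OF S f \<Omega>]
    by (intro Bochner_Integration.integral_cong refl) (auto simp: eq[symmetric] split: split_indicator)
  then have c: "Re (cinner (conv_fun_op (indicator \<Omega>) S \<psi>) \<psi>) = (LINT z|lborel. indicator \<Omega> z * ?r z)"
    unfolding integral_complex_of_real by simp
  show "ennreal (Re (cinner (conv_fun_op (indicator \<Omega>) S \<psi>) \<psi>)) = (\<integral>\<^sup>+z. indicator \<Omega> z * husimi f \<psi> z \<partial>lborel)"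
    unfolding c nneq by (rule nn_integral_eq_integral[symmetric, OF int]) (use nn in auto)
  show "0 \<le> Re (cinner (conv_fun_op (indicator \<Omega>) S \<psi>) \<psi>)"
    unfolding c using nn by (intro Bochner_Integration.integral_nonneg) simp
qed

section \<open>An inequality for decreasing sequences in the unit interval\<close>

text \<open>The middle quantity is the sum of \<open>1 - lam k\<close> over \<open>k < N\<close>
  plus the sum of \<open>lam k\<close> over \<open>k \<ge> N\<close>. Each term dominates
  \<open>lam k * (1 - lam k)\<close>; conversely, monotonicity lets \<open>lam N\<close> act as a
  threshold between head and tail.\<close>

lemma eigenvalue_sequence_bounds:
  fixes lam :: "nat \<Rightarrow> real"
  assumes dec: "decseq lam" and nn: "\<And>k. 0 \<le> lam k" and le1: "\<And>k. lam k \<le> 1"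
    and V: "lam sums V" and Q: "(\<lambda>k. (lam k)\<^sup>2) sums Q"
  defines "N \<equiv> nat \<lceil>V\<rceil>"
  shows "V - Q \<le> V + real N - 2 * (\<Sum>k<N. lam k)"
    and "V + real N - 2 * (\<Sum>k<N. lam k) \<le> 1 + 2 * (V - Q)"
proof -
  define H where "H = (\<Sum>k<N. lam k)"
  define H1 where "H1 = (\<Sum>k<N. lam k * (1 - lam k))"
  have "(\<lambda>k. lam k - (lam k)\<^sup>2) sums (V - Q)" by (rule sums_diff[OF V Q])
  then have E: "(\<lambda>k. lam k * (1 - lam k)) sums (V - Q)"
    by (simp add: power2_eq_square algebra_simps)
  have tail: "(\<lambda>k. lam (k + N)) sums (V - H)"
    unfolding H_def by (rule sums_split_initial_segment[OF V])
  have tailE: "(\<lambda>k. lam (k + N) * (1 - lam (k + N))) sums (V - Q - H1)"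
    unfolding H1_def by (rule sums_split_initial_segment[OF E])
  have "V - Q - H1 \<le> V - H"
    by (rule sums_le[OF _ tailE tail]) (use nn in \<open>simp add: mult_left_le\<close>)
  moreover have "H1 \<le> (\<Sum>k<N. 1 - lam k)"
    unfolding H1_def using nn le1 by (intro sum_mono) (simp add: mult_left_le_one_le)
  ultimately show "V - Q \<le> V + real N - 2 * (\<Sum>k<N. lam k)"
    by (simp add: sum_subtractf H_def)
  have V0: "0 \<le> V" by (rule sums_le[OF nn sums_zero V])
  then have N: "V \<le> real N" "real N \<le> V + 1" unfolding N_def by linarith+
  \<comment> \<open>In the tail \<open>1 - lam k\<close> is at least \<open>1 - lam N\<close>; in
    the head, treated next, \<open>lam k\<close> is at least \<open>lam N\<close>.\<close>
  have "(1 - lam N) * (V - H) \<le> V - Q - H1"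
  proof (rule sums_le[OF _ sums_mult[OF tail] tailE])
    fix k
    have "lam (k + N) \<le> lam N" using dec by (simp add: decseq_def)
    then show "(1 - lam N) * lam (k + N) \<le> lam (k + N) * (1 - lam (k + N))"
      using nn[of "k + N"] by (subst mult.commute) (intro mult_left_mono, auto)
  qed
  moreover have "(\<Sum>k<N. lam N * (1 - lam k)) \<le> H1"
    unfolding H1_def using dec le1 by (intro sum_mono mult_right_mono) (auto simp: decseq_def)
  then have "lam N * (real N - H) \<le> H1"
    unfolding sum_distrib_left[symmetric] by (simp add: sum_subtractf H_def)
  ultimately have "(1 - lam N) * (V - H) + lam N * (real N - H) \<le> V - Q" by simp
  \<comment> \<open>The weights add up to 1, and rounding up gives \<open>V \<le> real N\<close>, so
    the weighted sum is at least \<open>V - H\<close>.\<close>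
  moreover have "(1 - lam N) * (V - H) + lam N * (real N - H) = (V - H) + lam N * (real N - V)"
    by (simp add: algebra_simps)
  moreover have "0 \<le> lam N * (real N - V)" using nn N by simp
  ultimately have "V - H \<le> V - Q" by linarith
  \<comment> \<open>The quantity equals \<open>2 * (V - H) + (real N - V)\<close>; the last bracket
    is the rounding error, at most 1.\<close>
  then show "V + real N - 2 * (\<Sum>k<N. lam k) \<le> 1 + 2 * (V - Q)"
    using N by (simp add: H_def)
qed

section \<open>Volume lost by a set under translation\<close>

text \<open>Written as the integral of a product of indicators, so that Tonelli against
  \<open>autoconv_nn\<close> applies directly.\<close>

definition exit_measure :: "'a::euclidean_space set \<Rightarrow> 'a \<Rightarrow> ennreal" where
  "exit_measure \<Omega> w = (\<integral>\<^sup>+z. indicator \<Omega> z * indicator (- \<Omega>) (z + w) \<partial>lborel)"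

lemma exit_measure_measurable [measurable]:
  assumes [measurable]: "\<Omega> \<in> sets borel"
  shows "exit_measure \<Omega> \<in> borel_measurable borel"
  unfolding exit_measure_def[abs_def] by measurable

lemma exit_measure_le: "exit_measure \<Omega> w \<le> emeasure lborel \<Omega>" if [measurable]: "\<Omega> \<in> sets borel"
proof -
  have "exit_measure \<Omega> w \<le> (\<integral>\<^sup>+z. indicator \<Omega> z \<partial>lborel)"
    unfolding exit_measure_def by (intro nn_integral_mono) (auto split: split_indicator)
  then show ?thesis by simp
qed

text \<open>A point that leaves \<Omega> under \<open>v + w\<close> is outside already after
  \<open>v\<close>, or is still inside then and leaves under \<open>w\<close>; translation
  invariance measures the second case.\<close>

lemma exit_measure_add:
  assumes [measurable]: "\<Omega> \<in> sets borel"
  shows "exit_measure \<Omega> (v + w) \<le> exit_measure \<Omega> v + exit_measure \<Omega> w"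
proof -
  have "exit_measure \<Omega> (v + w)
      \<le> (\<integral>\<^sup>+z. indicator \<Omega> z * indicator (- \<Omega>) (z + v)
        + indicator \<Omega> (z + v) * indicator (- \<Omega>) (z + v + w) \<partial>lborel)"
    unfolding exit_measure_def by (intro nn_integral_mono) (auto simp: add.assoc split: split_indicator)
  also have "\<dots> = exit_measure \<Omega> v
      + (\<integral>\<^sup>+z. indicator \<Omega> (z + v) * indicator (- \<Omega>) (z + v + w) \<partial>lborel)"
    unfolding exit_measure_def by (intro nn_integral_add) measurable
  also have "(\<integral>\<^sup>+z. indicator \<Omega> (z + v) * indicator (- \<Omega>) (z + v + w) \<partial>lborel) = exit_measure \<Omega> w"
    unfolding exit_measure_def
    using nn_integral_lborel_shift[of "\<lambda>z. indicator \<Omega> z * indicator (- \<Omega>) (z + w) :: ennreal" "- v"]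
    by simp
  finally show ?thesis .
qed

lemma exit_measure_multiple:
  fixes \<Omega> :: "'a::euclidean_space set"
  assumes "\<Omega> \<in> sets borel"
  shows "exit_measure \<Omega> (real k *\<^sub>R w) \<le> of_nat k * exit_measure \<Omega> w"
proof (induction k)
  case 0
  have "exit_measure \<Omega> 0 = (\<integral>\<^sup>+z. 0 \<partial>(lborel :: 'a measure))"
    unfolding exit_measure_def by (intro nn_integral_cong) (auto split: split_indicator)
  then show ?case by simp
next
  case (Suc k)
  have "exit_measure \<Omega> (real (Suc k) *\<^sub>R w) \<le> exit_measure \<Omega> (real k *\<^sub>R w) + exit_measure \<Omega> w"
    using exit_measure_add[OF assms, of "real k *\<^sub>R w" w] by (simp add: scaleR_add_left add.commute)
  also have "\<dots> \<le> of_nat (Suc k) * exit_measure \<Omega> w"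
    using add_right_mono[OF Suc] by (simp add: distrib_right add.commute)
  finally show ?case .
qed

lemma exit_measure_ball_far:
  fixes w :: "'a::euclidean_space"
  assumes "norm w \<ge> 2 * R"
  shows "exit_measure (ball 0 R) w = emeasure lborel (ball (0::'a) R)"
proof -
  have "z + w \<notin> ball 0 R" if "z \<in> ball 0 R" for z :: 'a
    using that assms norm_triangle_ineq4[of "z + w" z] by auto
  then have "exit_measure (ball 0 R) w = (\<integral>\<^sup>+z. indicator (ball (0::'a) R) z \<partial>lborel)"
    unfolding exit_measure_def by (intro nn_integral_cong) (auto split: split_indicator)
  then show ?thesis by simp
qed

text \<open>About \<open>2 * R / min (norm w) 1\<close> steps of size \<open>w\<close> move the ball
  off itself; by subadditivity a single step loses at least the volume divided by their
  number.\<close>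

lemma exit_measure_ball_lower:
  fixes w :: "'a::euclidean_space"
  assumes R: "1 \<le> R"
  shows "ennreal (unit_ball_vol DIM('a) / 3 * R ^ (DIM('a) - 1) * min (norm w) 1)
    \<le> exit_measure (ball 0 R) w"
proof (cases "w = 0")
  case False
  define t where "t = min (norm w) 1"
  define k where "k = nat \<lceil>2 * R / t\<rceil>"
  define \<beta> where "\<beta> = unit_ball_vol DIM('a)"
  have t: "0 < t" "t \<le> 1" "t \<le> norm w" using False by (auto simp: t_def)
  have k1: "2 * R / t \<le> real k" unfolding k_def by linarith
  have "real k \<le> 2 * R / t + 1" unfolding k_def using R t by (simp add: of_nat_ceiling)
  \<comment> \<open>Since \<open>t \<le> 1 \<le> R\<close>, the rounding error 1 is at most
    \<open>R / t\<close>; this is the origin of the 3.\<close>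
  also have "\<dots> \<le> 3 * R / t" using R t by (simp add: field_simps)
  finally have k2: "real k \<le> 3 * R / t" .
  have "0 < 2 * R / t" using R t by simp
  with k1 have k0: "0 < real k" by linarith
  have "2 * R \<le> real k * t" using k1 t by (simp add: field_simps)
  also have "\<dots> \<le> norm (real k *\<^sub>R w)" using t by (simp add: mult_left_mono)
  finally have "exit_measure (ball 0 R) (real k *\<^sub>R w) = emeasure lborel (ball (0::'a) R)"
    by (rule exit_measure_ball_far)
  then have *: "ennreal (\<beta> * R ^ DIM('a)) \<le> of_nat k * exit_measure (ball 0 R) w"
    using exit_measure_multiple[of "ball 0 R" k w] R by (simp add: emeasure_ball \<beta>_def)
  have "ennreal (\<beta> * R ^ DIM('a) / real k) \<le> exit_measure (ball 0 R) w"
  proof -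
    have "ennreal (\<beta> * R ^ DIM('a)) = ennreal (real k) * ennreal (\<beta> * R ^ DIM('a) / real k)"
      using k0 by (subst ennreal_mult'[symmetric]) auto
    with * have "ennreal (real k) * ennreal (\<beta> * R ^ DIM('a) / real k)
        \<le> ennreal (real k) * exit_measure (ball 0 R) w"
      by (simp only: ennreal_of_nat_eq_real_of_nat)
    then show ?thesis by (subst (asm) ennreal_mult_le_mult_iff) (use k0 in auto)
  qed
  moreover have "\<beta> / 3 * R ^ (DIM('a) - 1) * t \<le> \<beta> * R ^ DIM('a) / real k"
  proof -
    have "R ^ DIM('a) = R * R ^ (DIM('a) - 1)" by (simp flip: power_Suc)
    moreover have "\<beta> * (R * R ^ (DIM('a) - 1)) / (3 * R / t) \<le> \<beta> * (R * R ^ (DIM('a) - 1)) / real k"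
      using k2 k0 R t by (intro divide_left_mono) (auto simp: \<beta>_def)
    ultimately show ?thesis using R t by (simp add: field_simps)
  qed
  ultimately show ?thesis unfolding \<beta>_def t_def by (meson ennreal_leI order_trans)
qed simp

text \<open>Only points in a shell of thickness \<open>norm w\<close> can leave, and Bernoulli's
  inequality bounds the shell. For \<open>norm w > R\<close> the volume of the whole ball is already
  small enough.\<close>

lemma exit_measure_ball_upper:
  fixes w :: "'a::euclidean_space"
  assumes R: "0 < R"
  shows "exit_measure (ball 0 R) w
    \<le> ennreal (unit_ball_vol DIM('a) * DIM('a) * R ^ (DIM('a) - 1) * norm w)"
proof -
  define \<beta> where "\<beta> = unit_ball_vol DIM('a)"
  have Rn: "R ^ DIM('a) = R * R ^ (DIM('a) - 1)" by (simp flip: power_Suc)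
  show ?thesis
  proof (cases "norm w \<le> R")
    case True
    have "exit_measure (ball 0 R) w \<le> (\<integral>\<^sup>+z. indicator (ball (0::'a) R - ball 0 (R - norm w)) z \<partial>lborel)"
      unfolding exit_measure_def
    proof (intro nn_integral_mono)
      fix z :: 'a
      have "z + w \<in> ball 0 R" if "z \<in> ball 0 (R - norm w)"
        using that norm_triangle_ineq[of z w] by simp
      then show "indicator (ball 0 R) z * indicator (- ball 0 R) (z + w)
          \<le> (indicator (ball 0 R - ball 0 (R - norm w)) z :: ennreal)"
        by (auto split: split_indicator)
    qed
    also have "\<dots> = emeasure lborel (ball (0::'a) R) - emeasure lborel (ball (0::'a) (R - norm w))"
      using emeasure_lborel_ball_finite[of "0::'a" "R - norm w"]
      by (simp add: emeasure_Diff subset_ball)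
    also have "\<dots> = ennreal (\<beta> * R ^ DIM('a) - \<beta> * (R - norm w) ^ DIM('a))"
      using R True by (simp add: emeasure_ball \<beta>_def ennreal_minus)
    also have "\<dots> \<le> ennreal (\<beta> * DIM('a) * R ^ (DIM('a) - 1) * norm w)"
    proof (rule ennreal_leI)
      \<comment> \<open>Bernoulli at \<open>- norm w / R\<close>, which is at least -1 in this
        case.\<close>
      have "1 + real DIM('a) * (- norm w / R) \<le> (1 + - norm w / R) ^ DIM('a)"
        using True R by (intro Bernoulli_inequality) (simp add: field_simps)
      then have "R ^ DIM('a) * (1 + real DIM('a) * (- norm w / R)) \<le> (R * (1 + - norm w / R)) ^ DIM('a)"
        using R by (simp add: power_mult_distrib)
      also have "R * (1 + - norm w / R) = R - norm w" using R by (simp add: field_simps)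
      finally have "R ^ DIM('a) - (R - norm w) ^ DIM('a) \<le> R ^ DIM('a) * (real DIM('a) * (norm w / R))"
        by (simp add: algebra_simps)
      also have "\<dots> = DIM('a) * R ^ (DIM('a) - 1) * norm w" using R unfolding Rn by simp
      finally have "\<beta> * (R ^ DIM('a) - (R - norm w) ^ DIM('a)) \<le> \<beta> * (DIM('a) * R ^ (DIM('a) - 1) * norm w)"
        by (intro mult_left_mono) (simp_all add: \<beta>_def)
      then show "\<beta> * R ^ DIM('a) - \<beta> * (R - norm w) ^ DIM('a) \<le> \<beta> * DIM('a) * R ^ (DIM('a) - 1) * norm w"
        by (simp add: algebra_simps)
    qed
    finally show ?thesis by (simp add: \<beta>_def)
  next
    case False
    have "exit_measure (ball 0 R) w \<le> ennreal (\<beta> * R ^ DIM('a))"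
      using exit_measure_le[of "ball 0 R" w] R by (simp add: emeasure_ball \<beta>_def)
    also have "\<dots> \<le> ennreal (\<beta> * DIM('a) * R ^ (DIM('a) - 1) * norm w)"
    proof (rule ennreal_leI)
      have "1 * R \<le> real DIM('a) * norm w"
        using False R DIM_positive[where 'a = 'a] by (intro mult_mono) (auto simp: Suc_le_eq)
      then have "\<beta> * R ^ (DIM('a) - 1) * R \<le> \<beta> * R ^ (DIM('a) - 1) * (real DIM('a) * norm w)"
        using R by (intro mult_left_mono) (auto simp: \<beta>_def)
      then show "\<beta> * R ^ DIM('a) \<le> \<beta> * DIM('a) * R ^ (DIM('a) - 1) * norm w"
        unfolding Rn by (simp add: mult_ac)
    qed
    finally show ?thesis by (simp add: \<beta>_def)
  qed
qed

section \<open>Eigenvalues of localization operators\<close>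

context
  fixes S :: "'a::euclidean_space L2 \<Rightarrow> 'a L2" and f :: "nat \<Rightarrow> 'a L2"
    and \<Omega> :: "('a \<times> 'a) set" and lam :: "nat \<Rightarrow> real" and h :: "nat \<Rightarrow> 'a L2"
  assumes S: "positive_op S" and f: "op_decomp S f"
    and \<Omega>: "\<Omega> \<in> sets borel" "emeasure lborel \<Omega> < \<infinity>"
    and eig: "eigen_system (conv_fun_op (indicator \<Omega>) S) lam h"
begin

lemma orthonormal_eigen: "orthonormal h"
  using eig by (simp add: eigen_system_def)

lemma norm_eigen: "norm (h k) = 1"
  using orthonormal_eigen by (simp add: orthonormal_def norm_eq_sqrt_inner inner_L2_def)

lemma eigenvalue_eq: "lam k = Re (cinner (conv_fun_op (indicator \<Omega>) S (h k)) (h k))"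
  using eig by (simp add: eigen_system_def cinner.scaleR_left Re_cinner_norm norm_eigen)

lemma eigenvalue_nonneg: "0 \<le> lam k"
  unfolding eigenvalue_eq by (rule conv_fun_op_husimi(2)[OF S f \<Omega>])

lemma eigenvalue_husimi: "ennreal (lam k) = (\<integral>\<^sup>+z. indicator \<Omega> z * husimi f (h k) z \<partial>lborel)"
  unfolding eigenvalue_eq by (rule conv_fun_op_husimi(1)[OF S f \<Omega>])

lemma eigenvalue_le_1: "lam k \<le> 1"
proof -
  have "ennreal (lam k) \<le> (\<integral>\<^sup>+z. husimi f (h k) z \<partial>lborel)"
    unfolding eigenvalue_husimi by (intro nn_integral_mono) (auto split: split_indicator)
  also have "\<dots> = ennreal 1" by (simp add: nn_integral_husimi[OF f] norm_eigen)
  finally show ?thesis by (subst (asm) ennreal_le_iff) auto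
qed

text \<open>The quadratic form of the localization operator computed on phase space and by its
  eigenfunctions. Both moment formulas below sum this identity over a suitable family of vectors
  \<open>\<psi>\<close>.\<close>

lemma husimi_eigen_expansion:
  "(\<integral>\<^sup>+z. indicator \<Omega> z * husimi f \<psi> z \<partial>lborel)
    = (\<Sum>k. ennreal (lam k) * ennreal ((cmod (cinner \<psi> (h k)))\<^sup>2))"
proof -
  have "(\<lambda>k. lam k *\<^sub>R rank_one (h k) (h k) \<psi>) sums conv_fun_op (indicator \<Omega>) S \<psi>"
    using eig by (simp add: eigen_system_def)
  from bounded_linear.sums[OF bounded_linear_Re bounded_linear.sums[OF cinner.bounded_linear_left[of \<psi>] this]]
  have "(\<lambda>k. lam k * (cmod (cinner \<psi> (h k)))\<^sup>2) sums Re (cinner (conv_fun_op (indicator \<Omega>) S \<psi>) \<psi>)"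
    by (simp add: cinner.scaleR_left rank_one_def cinner_scaleC_left cinner_mult_cinner del: of_real_power)
  then have "(\<Sum>k. ennreal (lam k * (cmod (cinner \<psi> (h k)))\<^sup>2))
      = ennreal (Re (cinner (conv_fun_op (indicator \<Omega>) S \<psi>) \<psi>))"
    by (intro suminf_ennreal_eq) (simp_all add: eigenvalue_nonneg)
  then show ?thesis
    by (simp add: conv_fun_op_husimi(1)[OF S f \<Omega>] ennreal_mult eigenvalue_nonneg)
qed

text \<open>The family is the fixed basis: Parseval collects the weight 1 for each eigenvalue, and
  \<open>sum_husimi_basis\<close> the weight 1 for each point of \<Omega>.\<close>

lemma sum_eigenvalues: "(\<Sum>k. ennreal (lam k)) = emeasure lborel \<Omega>"
proof -
  note [measurable] = \<Omega>(1)
  note e = orthonormal_basis_some_basis[where 'a = 'a]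
  have "(\<Sum>k. ennreal (lam k)) = (\<Sum>k. ennreal (lam k) * (\<Sum>n. ennreal ((cmod (cinner (h k) (some_basis n)))\<^sup>2)))"
    by (simp add: parseval_ennreal[OF e] norm_eigen)
  also have "\<dots> = (\<Sum>n. \<Sum>k. ennreal (lam k) * ennreal ((cmod (cinner (some_basis n) (h k)))\<^sup>2))"
    by (subst suminf_ennreal_swap) (simp add: ennreal_suminf_cmult norm_cinner_commute[of "h _"])
  also have "\<dots> = (\<integral>\<^sup>+z. (\<Sum>n. indicator \<Omega> z * husimi f (some_basis n) z) \<partial>lborel)"
    unfolding husimi_eigen_expansion[symmetric] by (rule nn_integral_suminf[symmetric]) measurable
  also have "\<dots> = (\<integral>\<^sup>+z. indicator \<Omega> z \<partial>lborel)"
    by (simp add: ennreal_suminf_cmult sum_husimi_basis[OF f e])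
  finally show ?thesis by simp
qed

text \<open>One factor \<open>lam k\<close> is written as its integral over \<open>z\<close>; the
  other is summed by the expansion for the vectors \<open>tf_shift z (f j)\<close>, which turns the
  Husimi functions into \<open>autoconv_nn f (z' - z)\<close>.\<close>

lemma sum_eigenvalues_square:
  "(\<Sum>k. ennreal ((lam k)\<^sup>2))
    = (\<integral>\<^sup>+z. indicator \<Omega> z * (\<integral>\<^sup>+z'. indicator \<Omega> z' * autoconv_nn f (z' - z) \<partial>lborel) \<partial>lborel)"
proof -
  note [measurable] = \<Omega>(1)
  have "(\<Sum>k. ennreal ((lam k)\<^sup>2))
      = (\<Sum>k. \<integral>\<^sup>+z. ennreal (lam k) * (indicator \<Omega> z * husimi f (h k) z) \<partial>lborel)"
    by (subst nn_integral_cmult)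
      (simp_all add: eigenvalue_husimi[symmetric] power2_eq_square ennreal_mult eigenvalue_nonneg)
  also have "\<dots> = (\<integral>\<^sup>+z. indicator \<Omega> z * (\<Sum>k. ennreal (lam k) * husimi f (h k) z) \<partial>lborel)"
  proof (subst nn_integral_suminf[symmetric])
    have "(\<Sum>k. ennreal (lam k) * (indicator \<Omega> z * husimi f (h k) z))
        = indicator \<Omega> z * (\<Sum>k. ennreal (lam k) * husimi f (h k) z)" for z
      by (subst ennreal_suminf_cmult[symmetric]) (simp add: mult.left_commute)
    then show "(\<integral>\<^sup>+z. (\<Sum>k. ennreal (lam k) * (indicator \<Omega> z * husimi f (h k) z)) \<partial>lborel)
        = (\<integral>\<^sup>+z. indicator \<Omega> z * (\<Sum>k. ennreal (lam k) * husimi f (h k) z) \<partial>lborel)" by simp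
  qed measurable
  also have "\<dots> = (\<integral>\<^sup>+z. indicator \<Omega> z * (\<integral>\<^sup>+z'. indicator \<Omega> z' * autoconv_nn f (z' - z) \<partial>lborel) \<partial>lborel)"
  proof (intro nn_integral_cong arg_cong2[of _ _ _ _ times] refl)
    fix z
    have "(\<Sum>k. ennreal (lam k) * husimi f (h k) z)
        = (\<Sum>j. \<Sum>k. ennreal (lam k) * ennreal ((cmod (cinner (tf_shift z (f j)) (h k)))\<^sup>2))"
      unfolding husimi_def
      by (subst suminf_ennreal_swap) (simp add: ennreal_suminf_cmult norm_cinner_commute[of "h _"])
    also have "\<dots> = (\<integral>\<^sup>+z'. (\<Sum>j. indicator \<Omega> z' * husimi f (tf_shift z (f j)) z') \<partial>lborel)"
      unfolding husimi_eigen_expansion[symmetric] by (rule nn_integral_suminf[symmetric]) measurable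
    also have "\<dots> = (\<integral>\<^sup>+z'. indicator \<Omega> z' * autoconv_nn f (z' - z) \<partial>lborel)"
      by (simp add: ennreal_suminf_cmult sum_husimi_tf_shift)
    finally show "(\<Sum>k. ennreal (lam k) * husimi f (h k) z)
        = (\<integral>\<^sup>+z'. indicator \<Omega> z' * autoconv_nn f (z' - z) \<partial>lborel)" .
  qed
  finally show ?thesis .
qed

text \<open>From each \<open>z\<close> in \<Omega> the unit mass of \<open>autoconv_nn f\<close>
  splits into the part landing in \<Omega>, giving the second moment, and the part leaving it.
  Stated as a sum because subtraction on \<open>ennreal\<close> is truncated.\<close>

lemma measure_eq_sum_eigenvalues_square:
  "emeasure lborel \<Omega> = (\<Sum>k. ennreal ((lam k)\<^sup>2))
    + (\<integral>\<^sup>+w. autoconv_nn f w * exit_measure \<Omega> w \<partial>lborel)"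
proof -
  note [measurable] = \<Omega>(1)
  have "(\<integral>\<^sup>+w. autoconv_nn f w * exit_measure \<Omega> w \<partial>lborel)
      = (\<integral>\<^sup>+w. \<integral>\<^sup>+z. indicator \<Omega> z * (indicator (- \<Omega>) (z + w) * autoconv_nn f w) \<partial>lborel \<partial>lborel)"
    unfolding exit_measure_def by (simp add: mult_ac flip: nn_integral_cmult)
  also have "\<dots> = (\<integral>\<^sup>+z. \<integral>\<^sup>+w. indicator \<Omega> z * (indicator (- \<Omega>) (z + w) * autoconv_nn f w) \<partial>lborel \<partial>lborel)"
    by (rule lborel_pair.Fubini') measurable
  also have "\<dots> = (\<integral>\<^sup>+z. indicator \<Omega> z * (\<integral>\<^sup>+z'. indicator (- \<Omega>) z' * autoconv_nn f (z' - z) \<partial>lborel) \<partial>lborel)"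
  proof (intro nn_integral_cong)
    fix z :: "'a \<times> 'a"
    show "(\<integral>\<^sup>+w. indicator \<Omega> z * (indicator (- \<Omega>) (z + w) * autoconv_nn f w) \<partial>lborel)
        = indicator \<Omega> z * (\<integral>\<^sup>+z'. indicator (- \<Omega>) z' * autoconv_nn f (z' - z) \<partial>lborel)"
      using nn_integral_lborel_shift[of "\<lambda>w. indicator (- \<Omega>) (z + w) * autoconv_nn f w" z]
      by (simp add: nn_integral_cmult)
  qed
  finally have exit_eq: "(\<integral>\<^sup>+w. autoconv_nn f w * exit_measure \<Omega> w \<partial>lborel)
      = (\<integral>\<^sup>+z. indicator \<Omega> z * (\<integral>\<^sup>+z'. indicator (- \<Omega>) z' * autoconv_nn f (z' - z) \<partial>lborel) \<partial>lborel)" .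
  have "(\<Sum>k. ennreal ((lam k)\<^sup>2)) + (\<integral>\<^sup>+w. autoconv_nn f w * exit_measure \<Omega> w \<partial>lborel)
      = (\<integral>\<^sup>+z. indicator \<Omega> z * ((\<integral>\<^sup>+z'. indicator \<Omega> z' * autoconv_nn f (z' - z) \<partial>lborel)
        + (\<integral>\<^sup>+z'. indicator (- \<Omega>) z' * autoconv_nn f (z' - z) \<partial>lborel)) \<partial>lborel)"
    unfolding sum_eigenvalues_square exit_eq by (subst nn_integral_add[symmetric]) (auto simp: distrib_left)
  also have "\<dots> = (\<integral>\<^sup>+z. indicator \<Omega> z \<partial>lborel)"
  proof (intro nn_integral_cong)
    fix z
    have "(\<integral>\<^sup>+z'. indicator \<Omega> z' * autoconv_nn f (z' - z) \<partial>lborel)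
        + (\<integral>\<^sup>+z'. indicator (- \<Omega>) z' * autoconv_nn f (z' - z) \<partial>lborel)
        = (\<integral>\<^sup>+z'. autoconv_nn f (z' - z) \<partial>lborel)"
      by (subst nn_integral_add[symmetric]) (auto intro!: nn_integral_cong split: split_indicator)
    also have "\<dots> = 1"
      by (subst nn_integral_lborel_shift) (auto simp: nn_integral_autoconv_nn[OF f])
    finally show "indicator \<Omega> z * ((\<integral>\<^sup>+z'. indicator \<Omega> z' * autoconv_nn f (z' - z) \<partial>lborel)
        + (\<integral>\<^sup>+z'. indicator (- \<Omega>) z' * autoconv_nn f (z' - z) \<partial>lborel)) = (indicator \<Omega> z :: ennreal)"
      by simp
  qed
  finally show ?thesis by simp
qed

text \<open>Values in the unit interval make the absolute difference to the indicator affine on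
  \<Omega> and on its complement, so the norm depends only on the total mass and the mass on
  \<Omega>.\<close>

lemma L1_norm_accumulated_cohen:
  defines "N \<equiv> nat \<lceil>measure lborel \<Omega>\<rceil>"
  shows "L1_norm (\<lambda>z. accumulated_cohen S \<Omega> h z - indicator \<Omega> z)
    = ennreal (measure lborel \<Omega> + real N - 2 * (\<Sum>k<N. lam k))"
proof -
  note [measurable] = \<Omega>(1)
  define q where "q k z = enn2real (husimi f (h k) z)" for k z
  have [measurable]: "q k \<in> borel_measurable borel" for k unfolding q_def[abs_def] by measurable
  have q: "ennreal (q k z) = husimi f (h k) z" for k z
    by (simp add: q_def husimi_eq[OF f])
  have q0: "0 \<le> q k z" for k z by (simp add: q_def)
  have q1: "has_bochner_integral lborel (q k) 1" for k
    by (rule has_bochner_integral_nn_integral)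
      (auto simp: q0 q nn_integral_husimi[OF f] norm_eigen)
  have q2: "has_bochner_integral lborel (\<lambda>z. indicator \<Omega> z * q k z) (lam k)" for k
    by (rule has_bochner_integral_nn_integral)
      (auto simp: q0 q eigenvalue_nonneg eigenvalue_husimi ennreal_mult ennreal_indicator)
  have ind: "has_bochner_integral lborel (indicator \<Omega> :: 'a \<times> 'a \<Rightarrow> real) (measure lborel \<Omega>)"
    using \<Omega> by (intro has_bochner_integral_real_indicator) auto
  define r where "r z = (\<Sum>k<N. q k z)" for z
  have r01: "0 \<le> r z" "r z \<le> 1" for z
  proof -
    show "0 \<le> r z" by (simp add: r_def q0 sum_nonneg)
    have "ennreal (r z) = (\<Sum>k<N. husimi f (h k) z)" by (simp add: r_def q0 q flip: sum_ennreal)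
    also have "\<dots> \<le> ennreal 1" using sum_husimi_orthonormal_le[OF f orthonormal_eigen] by simp
    finally show "r z \<le> 1" by (subst (asm) ennreal_le_iff) auto
  qed
  have "accumulated_cohen S \<Omega> h z = of_real (r z)" for z
    by (simp add: accumulated_cohen_def r_def N_def cohen_husimi[OF f] q_def)
  then have "cmod (accumulated_cohen S \<Omega> h z - indicator \<Omega> z)
      = cmod (of_real (r z - indicator \<Omega> z))" for z
    by (simp split: split_indicator)
  then have "cmod (accumulated_cohen S \<Omega> h z - indicator \<Omega> z)
      = indicator \<Omega> z + r z - 2 * (indicator \<Omega> z * r z)" for z
    unfolding norm_of_real using r01[of z] by (simp split: split_indicator)
  then have "L1_norm (\<lambda>z. accumulated_cohen S \<Omega> h z - indicator \<Omega> z)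
      = (\<integral>\<^sup>+z. ennreal (indicator \<Omega> z + r z - 2 * (indicator \<Omega> z * r z)) \<partial>lborel)"
    by (simp add: L1_norm_def)
  moreover have "has_bochner_integral lborel (\<lambda>z. indicator \<Omega> z + r z - 2 * (\<Sum>k<N. indicator \<Omega> z * q k z))
      (measure lborel \<Omega> + (\<Sum>k<N. 1) - 2 * (\<Sum>k<N. lam k))"
    unfolding r_def
    by (intro has_bochner_integral_diff has_bochner_integral_add has_bochner_integral_sum
        has_bochner_integral_mult_right ind q1 q2)
  then have "has_bochner_integral lborel (\<lambda>z. indicator \<Omega> z + r z - 2 * (indicator \<Omega> z * r z))
      (measure lborel \<Omega> + real N - 2 * (\<Sum>k<N. lam k))"
    by (simp add: r_def sum_distrib_left)
  moreover have "0 \<le> indicator \<Omega> z + r z - 2 * (indicator \<Omega> z * r z)" for z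
    using r01[of z] by (auto split: split_indicator)
  ultimately show ?thesis
    by (simp add: nn_integral_eq_integral has_bochner_integral_iff)
qed

text \<open>Finite measure of \<Omega> makes both moments finite; the identity in
  \<open>ennreal\<close> then becomes one of reals, to which
  \<open>eigenvalue_sequence_bounds\<close> applies.\<close>

lemma L1_norm_accumulated_cohen_bounds:
  shows "(\<integral>\<^sup>+w. autoconv_nn f w * exit_measure \<Omega> w \<partial>lborel)
      \<le> L1_norm (\<lambda>z. accumulated_cohen S \<Omega> h z - indicator \<Omega> z)"
    and "L1_norm (\<lambda>z. accumulated_cohen S \<Omega> h z - indicator \<Omega> z)
      \<le> 1 + 2 * (\<integral>\<^sup>+w. autoconv_nn f w * exit_measure \<Omega> w \<partial>lborel)"
proof -
  define V where "V = measure lborel \<Omega>"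
  have V: "emeasure lborel \<Omega> = ennreal V" using \<Omega> by (simp add: V_def emeasure_eq_ennreal_measure)
  have V0: "0 \<le> V" by (simp add: V_def)
  define E where "E = (\<integral>\<^sup>+w. autoconv_nn f w * exit_measure \<Omega> w \<partial>lborel)"
  have sum_lam: "lam sums V"
  proof -
    have "summable lam"
      using sum_eigenvalues V eigenvalue_nonneg by (intro summable_suminf_not_top) auto
    moreover have "ennreal (\<Sum>k. lam k) = ennreal V"
      using suminf_ennreal2[OF eigenvalue_nonneg \<open>summable lam\<close>] sum_eigenvalues V by simp
    then have "(\<Sum>k. lam k) = V"
      using V0 suminf_nonneg[OF \<open>summable lam\<close> eigenvalue_nonneg] by (simp add: ennreal_inj)
    ultimately show ?thesis by (simp add: sums_iff)
  qed
  have fin: "(\<Sum>k. ennreal ((lam k)\<^sup>2)) + E = ennreal V"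
    using measure_eq_sum_eigenvalues_square by (simp add: E_def V)
  define Q where "Q = (\<Sum>k. (lam k)\<^sup>2)"
  have sQ: "summable (\<lambda>k. (lam k)\<^sup>2)"
  proof (intro summable_suminf_not_top)
    show "(\<Sum>k. ennreal ((lam k)\<^sup>2)) \<noteq> top" using fin by auto
  qed simp
  have Q: "(\<lambda>k. (lam k)\<^sup>2) sums Q" using sQ by (simp add: Q_def summable_sums)
  have Q0: "0 \<le> Q" unfolding Q_def by (intro suminf_nonneg sQ) simp
  have "ennreal Q + E = ennreal V" using fin unfolding suminf_ennreal2[OF zero_le_power2 sQ] Q_def .
  moreover have "ennreal Q \<le> ennreal Q + E" by simp
  ultimately have "Q \<le> V" using V0 by simp
  define d where "d = V - Q"
  have d: "0 \<le> d" using \<open>Q \<le> V\<close> by (simp add: d_def)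
  have "E = ennreal Q + E - ennreal Q" by simp
  also have "\<dots> = ennreal d" using Q0 \<open>ennreal Q + E = ennreal V\<close> by (simp add: ennreal_minus d_def)
  finally have E: "E = ennreal d" .
  note b = eigenvalue_sequence_bounds[OF _ eigenvalue_nonneg eigenvalue_le_1 sum_lam Q, folded d_def]
  have dec: "decseq lam" using eig by (simp add: eigen_system_def)
  show "E \<le> L1_norm (\<lambda>z. accumulated_cohen S \<Omega> h z - indicator \<Omega> z)"
    unfolding L1_norm_accumulated_cohen E V_def[symmetric] using b(1)[OF dec] by (rule ennreal_leI)
  have "L1_norm (\<lambda>z. accumulated_cohen S \<Omega> h z - indicator \<Omega> z) \<le> ennreal (1 + 2 * d)"
    unfolding L1_norm_accumulated_cohen V_def[symmetric] using b(2)[OF dec] by (rule ennreal_leI)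
  also have "\<dots> = 1 + 2 * E" using d by (simp add: E ennreal_mult)
  finally show "L1_norm (\<lambda>z. accumulated_cohen S \<Omega> h z - indicator \<Omega> z) \<le> 1 + 2 * E" .
qed

end

section \<open>The two-sided estimate for balls\<close>

theorem theorem1p3:
  fixes S :: "(real ^ 'n) L2 \<Rightarrow> (real ^ 'n) L2"
  assumes "S \<in> M_op_star"
  shows "\<exists>C1 C2 :: real. C1 > 0 \<and> C2 > 0 \<and>
    (\<forall>R > 1. \<forall>lam h.
      eigen_system (conv_fun_op (indicator (ball 0 R)) S) lam h \<longrightarrow>
      ennreal (C1 * R ^ (2 * CARD('n) - 1))
        \<le> L1_norm (\<lambda>z. accumulated_cohen S (ball 0 R) h z - indicator (ball 0 R) z) \<and>
      L1_norm (\<lambda>z. accumulated_cohen S (ball 0 R) h z - indicator (ball 0 R) z)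
        \<le> ennreal (C2 * R ^ (2 * CARD('n) - 1)))"
proof -
  have S: "positive_op S" and "density_op S" using assms by (auto simp: M_op_star_def density_op_def)
  then obtain f where f: "op_decomp S f" using density_op_decomp by blast
  let ?G = "autoconv_nn f"
  have dim: "DIM((real ^ 'n) \<times> (real ^ 'n)) = 2 * CARD('n)" by simp
  define \<beta> where "\<beta> = unit_ball_vol (2 * CARD('n))"
  have \<beta>: "0 < \<beta>" by (simp add: \<beta>_def)
  have "(\<integral>\<^sup>+w. ?G w * ennreal (norm w) \<partial>lborel)
      = (\<integral>\<^sup>+w. ennreal (norm (autoconv S w * of_real (norm w))) \<partial>lborel)"
    by (simp add: autoconv_nn_eq[OF S f, symmetric] norm_mult ennreal_mult)
  also have "\<dots> < \<infinity>" using assms by (simp add: M_op_star_def integrable_iff_bounded)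
  finally have "(\<integral>\<^sup>+w. ?G w * ennreal (norm w) \<partial>lborel) \<noteq> \<infinity>" by simp
  then obtain M where M: "(\<integral>\<^sup>+w. ?G w * ennreal (norm w) \<partial>lborel) = ennreal M" "0 \<le> M"
    by (rule ennreal_finiteE)
  \<comment> \<open>The truncation at 1 matches \<open>exit_measure_ball_lower\<close>: for a fixed
    radius the lost volume stops growing once the ball has left itself.\<close>
  have le: "(\<integral>\<^sup>+w. ?G w * ennreal (min (norm w) 1) \<partial>lborel) \<le> (\<integral>\<^sup>+w. ?G w * ennreal (norm w) \<partial>lborel)"
    by (intro nn_integral_mono mult_left_mono ennreal_leI) auto
  then have "(\<integral>\<^sup>+w. ?G w * ennreal (min (norm w) 1) \<partial>lborel) \<noteq> \<infinity>" using M by (auto simp: top_unique)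
  then obtain m where m: "(\<integral>\<^sup>+w. ?G w * ennreal (min (norm w) 1) \<partial>lborel) = ennreal m" "0 \<le> m"
    by (rule ennreal_finiteE)
  \<comment> \<open>The truncated weight is positive off the null set containing only 0; were its
    integral zero, \<open>?G\<close> would vanish almost everywhere, against its integral 1.\<close>
  have "m \<noteq> 0"
  proof
    assume "m = 0"
    then have "(\<integral>\<^sup>+w. ?G w * ennreal (min (norm w) 1) \<partial>lborel) = 0" using m by simp
    then have "AE w in lborel. ?G w * ennreal (min (norm w) 1) = 0"
      by (subst (asm) nn_integral_0_iff_AE) auto
    moreover have "AE w in lborel. w \<noteq> (0 :: (real ^ 'n) \<times> (real ^ 'n))" by (rule AE_lborel_singleton)
    ultimately have "AE w in lborel. ?G w = 0"
    proof eventually_elim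
      case (elim w)
      have "0 < min (norm w) 1" using elim(2) by simp
      then show ?case using elim(1) by (simp del: min_less_iff_conj)
    qed
    then have "(\<integral>\<^sup>+w. ?G w \<partial>lborel) = 0" by (subst nn_integral_0_iff_AE) auto
    then show False by (simp add: nn_integral_autoconv_nn[OF f])
  qed
  then have m0: "0 < m" using m by simp
  \<comment> \<open>\<open>\<beta> / 3\<close> is the constant of
    \<open>exit_measure_ball_lower\<close>, integrated against \<open>?G\<close>.\<close>
  define C1 where "C1 = \<beta> / 3 * m"
  \<comment> \<open>The 1 and the 2 come from \<open>L1_norm_accumulated_cohen_bounds\<close>;
    \<open>\<beta> * (2 * CARD('n))\<close> is the surface area of the unit sphere, as in
    \<open>exit_measure_ball_upper\<close>.\<close>
  define C2 where "C2 = 1 + 2 * (\<beta> * (2 * CARD('n)) * M)"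
  show ?thesis
  proof (rule exI[of _ C1], rule exI[of _ C2], intro conjI allI impI)
    show "0 < C1" using \<beta> m0 by (simp add: C1_def)
    show "0 < C2" using \<beta> M by (simp add: C2_def add_pos_nonneg)
    fix R :: real and lam h
    assume R: "1 < R" and eig: "eigen_system (conv_fun_op (indicator (ball 0 R)) S) lam h"
    let ?B = "ball (0 :: (real ^ 'n) \<times> (real ^ 'n)) R"
    have \<Omega>: "?B \<in> sets borel" "emeasure lborel ?B < \<infinity>"
      using emeasure_lborel_ball_finite by auto
    note bounds = L1_norm_accumulated_cohen_bounds[OF S f \<Omega> eig]
    define P where "P = R ^ (2 * CARD('n) - 1)"
    define a where "a = \<beta> / 3 * P"
    define b where "b = \<beta> * (2 * CARD('n)) * P"
    have P: "1 \<le> P" using R by (simp add: P_def)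
    have ab: "0 \<le> a" "0 \<le> b" using \<beta> P by (simp_all add: a_def b_def)
    have lower: "ennreal (a * min (norm w) 1) \<le> exit_measure ?B w" for w
      using exit_measure_ball_lower[of R w, unfolded dim] R by (simp add: a_def \<beta>_def P_def)
    have upper: "exit_measure ?B w \<le> ennreal (b * norm w)" for w
      using exit_measure_ball_upper[of R w, unfolded dim] R by (simp add: b_def \<beta>_def P_def)
    have "ennreal (C1 * P) = ennreal a * ennreal m"
      using ab m by (simp add: C1_def a_def mult_ac flip: ennreal_mult)
    also have "\<dots> = (\<integral>\<^sup>+w. ennreal a * (?G w * ennreal (min (norm w) 1)) \<partial>lborel)"
      by (subst nn_integral_cmult) (auto simp: m)
    also have "\<dots> = (\<integral>\<^sup>+w. ?G w * ennreal (a * min (norm w) 1) \<partial>lborel)"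
      using ab by (intro nn_integral_cong) (simp add: ennreal_mult mult.left_commute)
    also have "\<dots> \<le> (\<integral>\<^sup>+w. ?G w * exit_measure ?B w \<partial>lborel)"
      by (intro nn_integral_mono mult_left_mono lower) simp
    finally show "ennreal (C1 * R ^ (2 * CARD('n) - 1))
        \<le> L1_norm (\<lambda>z. accumulated_cohen S ?B h z - indicator ?B z)"
      unfolding P_def using bounds(1) by (rule order_trans)
    have "(\<integral>\<^sup>+w. ?G w * exit_measure ?B w \<partial>lborel) \<le> (\<integral>\<^sup>+w. ?G w * ennreal (b * norm w) \<partial>lborel)"
      by (intro nn_integral_mono mult_left_mono upper) simp
    also have "\<dots> = (\<integral>\<^sup>+w. ennreal b * (?G w * ennreal (norm w)) \<partial>lborel)"
      using ab by (intro nn_integral_cong) (simp add: ennreal_mult mult.left_commute)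
    also have "\<dots> = ennreal (b * M)"
      using ab M by (subst nn_integral_cmult) (auto simp flip: ennreal_mult)
    finally have E: "(\<integral>\<^sup>+w. ?G w * exit_measure ?B w \<partial>lborel) \<le> ennreal (b * M)" .
    define c where "c = b * M"
    have c: "0 \<le> c" using ab M by (simp add: c_def)
    note bounds(2)
    also have "1 + 2 * (\<integral>\<^sup>+w. ?G w * exit_measure ?B w \<partial>lborel) \<le> 1 + 2 * ennreal c"
      using E unfolding c_def by (intro add_left_mono mult_left_mono) auto
    also have "\<dots> = ennreal (1 + 2 * c)" using c by (simp add: ennreal_mult)
    \<comment> \<open>Here \<open>1 \<le> P\<close>, a consequence of \<open>R > 1\<close>, absorbs
      the rounding error.\<close>
    also have "\<dots> \<le> ennreal (C2 * P)"
      using P by (intro ennreal_leI) (simp add: C2_def c_def b_def algebra_simps)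
    finally show "L1_norm (\<lambda>z. accumulated_cohen S ?B h z - indicator ?B z)
        \<le> ennreal (C2 * R ^ (2 * CARD('n) - 1))" unfolding P_def .
  qed
qed

end
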